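(* Let $q=2^r$ and let $\psi$ be any nontrivial additive character of $\mathbb{F}_q$. For each of the double cosets $DC_i^{\epsilon}(n,q)$ (with $n$ in its range of definition), identifying $\epsilon\in\{+,-\}$ with $\epsilon1\in\{1,-1\}$: $$\sum_{w\in DC_i^{\epsilon}(n,q)}\psi(\mathrm{Tr}\,w)=\epsilon\,A_i^{\epsilon}(n,q)\,K(\psi;1)\quad (i=1,3),$$ $$\sum_{w\in DC_2^{\epsilon}(n,q)}\psi(\mathrm{Tr}\,w)=-\epsilon\,A_2^{\epsilon}(n,q)\,K(\psi;1)^2,$$ $$\sum_{w\in DC_4^{\epsilon}(n,q)}\psi(\mathrm{Tr}\,w)=-\epsilon\,q^{-1}A_4^{\epsilon}(n,q)\,K_{GL(2,q)}(\psi;1)=-\epsilon\,A_4^{\epsilon}(n,q)\,(K(\psi;1)^2+q^2-q).$$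
   Context: $q=2^r$. For a nontrivial additive character $\psi$ of $\mathbb{F}_q$ and $a\in\mathbb{F}_q^*$: $K(\psi;a)=\sum_{\alpha\in\mathbb{F}_q^*}\psi(\alpha+a\alpha^{-1})$, $K_{GL(t,q)}(\psi;a)=\sum_{w\in GL(t,q)}\psi(\mathrm{Tr}\,w+a\,\mathrm{Tr}\,w^{-1})$, $\mathrm{Tr}$ the matrix trace. ${}^tX$ is transpose; a square matrix is alternating if symmetric with zero diagonal; $\left[\substack{m\\ s}\right]_q=\prod_{j=0}^{s-1}(q^{m-j}-1)/(q^{s-j}-1)$; empty products are 1. Fix $\kappa\in\mathbb{F}_q$ with $z^2+z+\kappa$ irreducible over $\mathbb{F}_q$. For $n\ge1$, $O^-(2n,q)$ is the group of $g\in GL(2n,q)$ preserving $\theta^-(x)=\sum_{i=1}^{n-1}x_ix_{n-1+i}+x_{2n-1}^2+x_{2n-1}x_{2n}+\kappa x_{2n}^2$. Let $\delta=\begin{pmatrix}1&1\\0&\kappa\end{pmatrix}$, $\eta=\begin{pmatrix}0&1\\1&0\end{pmatrix}$, $SO^-(2,q)=\{\begin{pmatrix}d_1&\kappa d_2\\ d_2&d_1+d_2\end{pmatrix}:d_1^2+d_1d_2+\kappa d_2^2=1\}$. $Q=Q^-(2n,q)$ is the group of all products (blocks $n-1,n-1,2$) $\begin{pmatrix}A&0&0\\0&{}^tA^{-1}&0\\0&0&i\end{pmatrix}\begin{pmatrix}1_{n-1}&B&{}^th\,{}^ti\,\eta\,i\\0&1_{n-1}&0\\0&h&1_2\end{pmatrix}$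 with $A\in GL(n-1,q)$, $i\in SO^-(2,q)$, $B\in\mathbb{F}_q^{(n-1)\times(n-1)}$, $h\in\mathbb{F}_q^{2\times(n-1)}$, ${}^tB+{}^th\delta h$ alternating. $\rho=\mathrm{diag}(1_{2n-2},\begin{pmatrix}1&1\\0&1\end{pmatrix})$. $\sigma_s$ ($0\le s\le n-1$) is the permutation matrix interchanging $e^j$ and $e^{n-1+j}$ for $1\le j\le s$. Double cosets: $DC_1^+=Q\sigma_{n-1}Q$, $DC_2^+=Q\sigma_{n-2}Q$, $DC_3^+=\rho Q\sigma_{n-2}Q$ for $n=2,4,\dots$; $DC_4^+=\rho Q\sigma_{n-3}Q$ for $n=4,6,\dots$; $DC_1^-=Q\sigma_{n-1}Q$ for $n=1,3,\dots$; $DC_2^-=Q\sigma_{n-2}Q$, $DC_3^-=\rho Q\sigma_{n-2}Q$, $DC_4^-=\rho Q\sigma_{n-3}Q$ for $n=3,5,\dots$. Constants (arguments $(n,q)$): $A_1^+=q^{(5n^2-2n-4)/4}(q^{n-1}-1)\prod_{j=1}^{(n-2)/2}(q^{2j-1}-1)$; $A_2^+=q^{(5n^2-2n-8)/4}\left[\substack{n-1\\1}\right]_q\prod_{j=1}^{(n-2)/2}(q^{2j-1}-1)$; $A_3^+=(q+1)A_2^+$; $A_4^+=(q+1)q^{(5n^2-6n-4)/4}\left[\substack{n-1\\2}\right]_q\prod_{j=1}^{(n-2)/2}(q^{2j-1}-1)$; $A_1^-=q^{5(n^2-1)/4}\prod_{j=1}^{(n-1)/2}(q^{2j-1}-1)$;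 $A_2^-=q^{(5n^2-4n-5)/4}\left[\substack{n-1\\1}\right]_q\prod_{j=1}^{(n-1)/2}(q^{2j-1}-1)$; $A_3^-=(q+1)A_2^-$; $A_4^-=(q+1)q^{(5n^2-4n-9)/4}\left[\substack{n-1\\2}\right]_q\prod_{j=1}^{(n-3)/2}(q^{2j-1}-1)$. *)

theory Defs
  imports "Jordan_Normal_Form.Gauss_Jordan_Elimination"
    "HOL-Computational_Algebra.Polynomial_Factorial" "HOL-Library.Cardinality" Complex_Main
begin

section \<open>Characters and Kloosterman sums\<close>

definition additive_character :: "('a::ab_group_add \<Rightarrow> complex) \<Rightarrow> bool" where
  "additive_character \<psi> \<longleftrightarrow> \<psi> 0 = 1 \<and> (\<forall>x y. \<psi> (x + y) = \<psi> x * \<psi> y)"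

definition nontrivial_additive_character :: "('a::ab_group_add \<Rightarrow> complex) \<Rightarrow> bool" where
  "nontrivial_additive_character \<psi> \<longleftrightarrow> additive_character \<psi> \<and> (\<exists>x. \<psi> x \<noteq> 1)"

definition mat_trace :: "'a::comm_monoid_add mat \<Rightarrow> 'a" where
  "mat_trace A = (\<Sum>i<dim_row A. A $$ (i, i))"

definition GL :: "nat \<Rightarrow> 'a::field mat set" where
  "GL t = {A \<in> carrier_mat t t. invertible_mat A}"

text \<open>Only meaningful for invertible square matrices.\<close>

definition mat_inv :: "'a::field mat \<Rightarrow> 'a mat" where
  "mat_inv A = the (mat_inverse A)"

definition kloosterman :: "('a::{field,finite} \<Rightarrow> complex) \<Rightarrow> 'a \<Rightarrow> complex" where
  "kloosterman \<psi> a = (\<Sum>\<alpha>\<in>UNIV - {0}. \<psi> (\<alpha> + a * inverse \<alpha>))"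

definition kloosterman_GL :: "nat \<Rightarrow> ('a::{field,finite} \<Rightarrow> complex) \<Rightarrow> 'a \<Rightarrow> complex" where
  "kloosterman_GL t \<psi> a = (\<Sum>w\<in>GL t. \<psi> (mat_trace w + a * mat_trace (mat_inv w)))"

section \<open>The subgroup \<open>Q\<^sup>-(2n,q)\<close> and its double cosets\<close>

definition alternating_mat :: "'a::zero mat \<Rightarrow> bool" where
  "alternating_mat A \<longleftrightarrow> square_mat A \<and> A\<^sup>T = A \<and> (\<forall>i<dim_row A. A $$ (i, i) = 0)"

definition append_cols :: "'a::zero mat \<Rightarrow> 'a mat \<Rightarrow> 'a mat" (infixr \<open>@\<^sub>c\<close> 65) where
  "A @\<^sub>c B = four_block_mat A B (0\<^sub>m 0 (dim_col A)) (0\<^sub>m 0 (dim_col B))"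

definition nine_block_mat ::
  "'a::zero mat \<Rightarrow> 'a mat \<Rightarrow> 'a mat \<Rightarrow>
   'a mat \<Rightarrow> 'a mat \<Rightarrow> 'a mat \<Rightarrow>
   'a mat \<Rightarrow> 'a mat \<Rightarrow> 'a mat \<Rightarrow> 'a mat" where
  "nine_block_mat A11 A12 A13
                  A21 A22 A23
                  A31 A32 A33 =
     four_block_mat (four_block_mat A11 A12 A21 A22) (A13 @\<^sub>r A23) (A31 @\<^sub>c A32) A33"

definition delta_mat :: "'a::field \<Rightarrow> 'a mat" where
  "delta_mat \<kappa> = mat_of_rows_list 2 [[1, 1], [0, \<kappa>]]"

definition eta_mat :: "'a::field mat" where
  "eta_mat = mat_of_rows_list 2 [[0, 1], [1, 0]]"

definition SO_minus_2 :: "'a::field \<Rightarrow> 'a mat set" where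
  "SO_minus_2 \<kappa> =
     {mat_of_rows_list 2 [[d1, \<kappa> * d2], [d2, d1 + d2]] | d1 d2.
        d1\<^sup>2 + d1 * d2 + \<kappa> * d2\<^sup>2 = 1}"

text \<open>In \<open>Q_levi\<close> and \<open>Q_unip\<close> the first argument is the block size \<open>m = n - 1\<close>.\<close>

definition Q_levi :: "nat \<Rightarrow> 'a::field mat \<Rightarrow> 'a mat \<Rightarrow> 'a mat" where
  "Q_levi m A i = nine_block_mat
     A           (0\<^sub>m m m)         (0\<^sub>m m 2)
     (0\<^sub>m m m)   ((mat_inv A)\<^sup>T)   (0\<^sub>m m 2)
     (0\<^sub>m 2 m)   (0\<^sub>m 2 m)         i"

definition Q_unip :: "nat \<Rightarrow> 'a::field mat \<Rightarrow> 'a mat \<Rightarrow> 'a mat \<Rightarrow> 'a mat" where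
  "Q_unip m i B h = nine_block_mat
     (1\<^sub>m m)     B           (h\<^sup>T * i\<^sup>T * eta_mat * i)
     (0\<^sub>m m m)   (1\<^sub>m m)     (0\<^sub>m m 2)
     (0\<^sub>m 2 m)   h           (1\<^sub>m 2)"

definition Q_minus :: "'a::field \<Rightarrow> nat \<Rightarrow> 'a mat set" where
  "Q_minus \<kappa> n =
     {Q_levi (n - 1) A i * Q_unip (n - 1) i B h | A i B h.
        A \<in> GL (n - 1) \<and> i \<in> SO_minus_2 \<kappa> \<and>
        B \<in> carrier_mat (n - 1) (n - 1) \<and> h \<in> carrier_mat 2 (n - 1) \<and>
        alternating_mat (B\<^sup>T + h\<^sup>T * delta_mat \<kappa> * h)}"

definition rho_mat :: "nat \<Rightarrow> 'a::field mat" where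
  "rho_mat n = four_block_mat
     (1\<^sub>m (2 * n - 2))   (0\<^sub>m (2 * n - 2) 2)
     (0\<^sub>m 2 (2 * n - 2)) (mat_of_rows_list 2 [[1, 1], [0, 1]])"

text \<open>Indices are 0-based: \<open>e\<^sup>j\<close> with \<open>1 \<le> j \<le> s\<close> is index \<open>j - 1 < s\<close>.\<close>

definition sigma_perm :: "nat \<Rightarrow> nat \<Rightarrow> nat \<Rightarrow> nat" where
  "sigma_perm n s j =
     (if j < s then n - 1 + j
      else if n - 1 \<le> j \<and> j < n - 1 + s then j - (n - 1)
      else j)"

definition sigma_mat :: "nat \<Rightarrow> nat \<Rightarrow> 'a::field mat" where
  "sigma_mat n s =
     mat (2 * n) (2 * n) (\<lambda>(i, j). if i = sigma_perm n s j then 1 else 0)"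

text \<open>
  The cosets \<open>DC\<^sub>k\<^sup>+\<close> (\<open>n\<close> even) and \<open>DC\<^sub>k\<^sup>-\<close> (\<open>n\<close> odd) are given by the same expression in \<open>n\<close>.
  They are to be used for \<open>n \<ge> 1\<close> (\<open>DC1\<close>), \<open>n \<ge> 2\<close> (\<open>DC2\<close>, \<open>DC3\<close>), \<open>n \<ge> 3\<close> (\<open>DC4\<close>), so that the
  subtractions below are not truncated.
\<close>

definition DC1 :: "'a::field \<Rightarrow> nat \<Rightarrow> 'a mat set" where
  "DC1 \<kappa> n = {x * sigma_mat n (n - 1) * y | x y. x \<in> Q_minus \<kappa> n \<and> y \<in> Q_minus \<kappa> n}"

definition DC2 :: "'a::field \<Rightarrow> nat \<Rightarrow> 'a mat set" where
  "DC2 \<kappa> n = {x * sigma_mat n (n - 2) * y | x y. x \<in> Q_minus \<kappa> n \<and> y \<in> Q_minus \<kappa> n}"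

definition DC3 :: "'a::field \<Rightarrow> nat \<Rightarrow> 'a mat set" where
  "DC3 \<kappa> n = {rho_mat n * x * sigma_mat n (n - 2) * y | x y. x \<in> Q_minus \<kappa> n \<and> y \<in> Q_minus \<kappa> n}"

definition DC4 :: "'a::field \<Rightarrow> nat \<Rightarrow> 'a mat set" where
  "DC4 \<kappa> n = {rho_mat n * x * sigma_mat n (n - 3) * y | x y. x \<in> Q_minus \<kappa> n \<and> y \<in> Q_minus \<kappa> n}"

section \<open>The constants\<close>

definition q_binomial :: "nat \<Rightarrow> nat \<Rightarrow> nat \<Rightarrow> real" where
  "q_binomial q m s = (\<Prod>j<s. (real q ^ (m - j) - 1) / (real q ^ (s - j) - 1))"

definition odd_prod :: "nat \<Rightarrow> nat \<Rightarrow> real" where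
  "odd_prod q k = (\<Prod>j=1..k. (real q ^ (2 * j - 1) - 1))"

text \<open>
  For \<open>n\<close> of the relevant parity and range (even \<open>n \<ge> 2\<close> for \<open>Ak_plus\<close>, odd \<open>n \<ge> 1\<close> for \<open>A1_minus\<close>, odd
  \<open>n \<ge> 3\<close> for the others) all divisions and subtractions on \<open>nat\<close> below are exact.
\<close>

definition A1_plus :: "nat \<Rightarrow> nat \<Rightarrow> real" where
  "A1_plus n q = real q ^ ((5 * n\<^sup>2 - 2 * n - 4) div 4) * (real q ^ (n - 1) - 1) *
     odd_prod q ((n - 2) div 2)"

definition A2_plus :: "nat \<Rightarrow> nat \<Rightarrow> real" where
  "A2_plus n q = real q ^ ((5 * n\<^sup>2 - 2 * n - 8) div 4) * q_binomial q (n - 1) 1 *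
     odd_prod q ((n - 2) div 2)"

definition A3_plus :: "nat \<Rightarrow> nat \<Rightarrow> real" where
  "A3_plus n q = (real q + 1) * A2_plus n q"

definition A4_plus :: "nat \<Rightarrow> nat \<Rightarrow> real" where
  "A4_plus n q = (real q + 1) * real q ^ ((5 * n\<^sup>2 - 6 * n - 4) div 4) *
     q_binomial q (n - 1) 2 * odd_prod q ((n - 2) div 2)"

definition A1_minus :: "nat \<Rightarrow> nat \<Rightarrow> real" where
  "A1_minus n q = real q ^ (5 * (n\<^sup>2 - 1) div 4) * odd_prod q ((n - 1) div 2)"

definition A2_minus :: "nat \<Rightarrow> nat \<Rightarrow> real" where
  "A2_minus n q = real q ^ ((5 * n\<^sup>2 - 4 * n - 5) div 4) * q_binomial q (n - 1) 1 *
     odd_prod q ((n - 1) div 2)"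

definition A3_minus :: "nat \<Rightarrow> nat \<Rightarrow> real" where
  "A3_minus n q = (real q + 1) * A2_minus n q"

definition A4_minus :: "nat \<Rightarrow> nat \<Rightarrow> real" where
  "A4_minus n q = (real q + 1) * real q ^ ((5 * n\<^sup>2 - 4 * n - 9) div 4) *
     q_binomial q (n - 1) 2 * odd_prod q ((n - 3) div 2)"

end

theory Submission
  imports Defs "HOL-Library.FuncSet" "Jordan_Normal_Form.Determinant"
begin

text \<open>
  Write \<open>m = n - 1\<close>. Every double coset occurring here is \<open>R Q \<sigma>\<^sub>s Q\<close> with \<open>R \<in> {1, \<rho>}\<close>, and \<open>R\<close> normalizes \<open>Q\<close>.
  Each of its elements equals \<open>R x \<sigma>\<^sub>s y\<close> for \<open>|Q \<inter> \<sigma>\<^sub>s Q \<sigma>\<^sub>s|\<close> pairs \<open>(x, y)\<close>, and the trace is cyclic, so the sum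
  over the double coset is the index of \<open>Q \<inter> \<sigma>\<^sub>s Q \<sigma>\<^sub>s\<close> in \<open>Q\<close> times the sum of \<open>\<psi> (Tr (R x \<sigma>\<^sub>s))\<close> over \<open>x \<in> Q\<close>.

  Parametrize \<open>x\<close> by \<open>(A, i, h, C)\<close> with \<open>B = C + \<^sup>th \<^sup>t\<delta> h\<close> and \<open>C\<close> alternating. Summing over \<open>C\<close> forces \<open>A\<close> to be
  block lower triangular with symmetric invertible corner \<open>S\<close> of size \<open>s\<close>. The sum over \<open>h\<close> is then a quadratic
  Gauss sum, equal to \<open>(-q)\<^sup>s\<close> times a power of \<open>q\<close> whatever \<open>S\<close> is: its square is \<open>q\<close> to the \<open>2s\<close>, and it is
  congruent to 1 modulo \<open>q + 1\<close> because \<open>SO\<^sup>-(2,q)\<close>, which has order \<open>q + 1\<close>, acts freely on the nonzero \<open>h\<close>. What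
  remains is the number of symmetric \<open>S\<close>, a Kloosterman sum over \<open>GL(m - s, q)\<close> from the lower right corner of \<open>A\<close>,
  and the sum over \<open>i\<close>, which is \<open>-K(\<psi>;1)\<close> for \<open>R = 1\<close> and \<open>q + 1\<close> for \<open>R = \<rho>\<close> since \<open>Tr\<close> then vanishes on \<open>\<rho> SO\<^sup>-(2,q)\<close>.
\<close>

section \<open>Matrices over a field\<close>

text \<open>Characteristic 2 shapes the argument. A quadratic form is a matrix modulo alternating
  matrices, so orthogonality is expressed by an alternating difference; the free parameter
  \<open>C\<close> of \<open>Q\<close> is then alternating, and the condition dual to it, left on
  the corner \<open>S\<close>, is symmetry with an arbitrary diagonal. Bringing such an
  \<open>S\<close> to normal form would mean separating alternating from non-alternating matrices.
  This is avoided because characters take only the values 1 and -1: the Gauss sum is an integer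
  whose sign can be fixed by a congruence. The parity of \<open>n\<close> enters at two points. The
  sign of (-q)^s, together with the minus sign of the sum over \<open>i\<close> for R = 1, gives the
  signs in the theorem. The count of invertible symmetric matrices of size \<open>s\<close> has a
  different shape for even and odd \<open>s\<close>, which accounts for the two families of
  constants. Their binomial coefficients are ratios of orders of general linear groups for m - s =
  1, 2. Identities are kept multiplied out until m - s is fixed, so that no ratio is formed before
  it simplifies.\<close>

lemma GL_iff_det: "A \<in> GL n \<longleftrightarrow> A \<in> carrier_mat n n \<and> det A \<noteq> 0"
proof -
  have "invertible_mat A \<longleftrightarrow> det A \<noteq> 0" if A: "A \<in> carrier_mat n n"
  proof
    assume "invertible_mat A"
    then obtain B where B: "A * B = 1\<^sub>m (dim_row A)" "B * A = 1\<^sub>m (dim_row B)"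
      by (auto simp: invertible_mat_def inverts_mat_def)
    \<comment> \<open>\<open>inverts_mat\<close> prescribes no size for \<open>B\<close>; it is read
      off from the two products being identity matrices.\<close>
    have "dim_row B = n" using arg_cong[OF B(2), of dim_col] A by auto
    moreover have "dim_col B = n" using arg_cong[OF B(1), of dim_col] A by auto
    ultimately have "B \<in> carrier_mat n n" by auto
    then have "det A * det B = 1" using det_mult[OF A] B A by (metis carrier_matD(1) det_one)
    then show "det A \<noteq> 0" by auto
  next
    assume "det A \<noteq> 0"
    from det_non_zero_imp_unit[OF A this] obtain B where "B \<in> carrier_mat n n" "A * B = 1\<^sub>m n" "B * A = 1\<^sub>m n"
      by (auto simp: Units_def ring_mat_def)
    with A show "invertible_mat A" by (auto simp: invertible_mat_def inverts_mat_def)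
  qed
  then show ?thesis by (auto simp: GL_def)
qed

lemma mat_inv:
  assumes "A \<in> GL n"
  shows "mat_inv A \<in> carrier_mat n n" "A * mat_inv A = 1\<^sub>m n" "mat_inv A * A = 1\<^sub>m n"
proof -
  from assms have A: "A \<in> carrier_mat n n" "det A \<noteq> 0" by (auto simp: GL_iff_det)
  have "A \<in> Units (ring_mat TYPE('a) n undefined)" by (rule det_non_zero_imp_unit[OF A])
  then obtain B where "mat_inverse A = Some B"
    using mat_inverse(1)[OF A(1)] by (metis not_None_eq)
  with mat_inverse(2)[OF A(1) this] show "mat_inv A \<in> carrier_mat n n" "A * mat_inv A = 1\<^sub>m n" "mat_inv A * A = 1\<^sub>m n"
    by (auto simp: mat_inv_def)
qed

lemma GL_carrier: "A \<in> GL n \<Longrightarrow> A \<in> carrier_mat n n"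
  by (simp add: GL_def)

lemma GL_I:
  assumes "A \<in> carrier_mat n n" "B \<in> carrier_mat n n" "A * B = 1\<^sub>m n"
  shows "A \<in> GL n"
  unfolding GL_iff_det using assms det_mult[OF assms(1,2)] by auto

lemma mat_inv_unique:
  assumes A: "A \<in> carrier_mat n n" and B: "B \<in> carrier_mat n n" and AB: "A * B = 1\<^sub>m n"
  shows "mat_inv A = B"
proof -
  note I = mat_inv[OF GL_I[OF assms]]
  have "mat_inv A = mat_inv A * (A * B)" using I AB by simp
  also have "\<dots> = B" using I A B by (simp add: assoc_mult_mat[symmetric])
  finally show ?thesis .
qed

lemma GL_mult: "A \<in> GL n \<Longrightarrow> B \<in> GL n \<Longrightarrow> A * B \<in> GL n"
  by (auto simp: GL_iff_det det_mult)

lemma mat_inv_GL: "A \<in> GL n \<Longrightarrow> mat_inv A \<in> GL n"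
  using mat_inv[of A n] GL_I[of "mat_inv A" n A] by (auto simp: GL_carrier)

lemma GL_transpose: "A \<in> GL n \<Longrightarrow> A\<^sup>T \<in> GL n"
  by (auto simp: GL_iff_det det_transpose)

lemma one_GL: "1\<^sub>m n \<in> GL n"
  by (simp add: GL_iff_det)

text \<open>Dimension equations replace carrier premises, so that together with
  \<open>mat_dims\<close> the simplifier can reassociate products of any shape without being told
  the intermediate sizes.\<close>

lemma mult_assoc_dim:
  fixes A :: "'a::semiring_0 mat"
  shows "dim_col A = dim_row B \<Longrightarrow> dim_col B = dim_row C \<Longrightarrow> A * B * C = A * (B * C)"
  by (rule assoc_mult_mat[of A "dim_row A" "dim_col A" B "dim_col B" C "dim_col C"]) auto

lemma transpose_mult_dim:
  fixes A :: "'a::comm_semiring_0 mat"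
  shows "dim_col A = dim_row B \<Longrightarrow> (A * B)\<^sup>T = B\<^sup>T * A\<^sup>T"
  by (rule transpose_mult[of A "dim_row A" "dim_col A" B "dim_col B"]) auto

lemmas mat_dims = index_mult_mat(2,3) index_transpose_mat(2,3) index_add_mat(2,3) index_one_mat(2,3) index_zero_mat(2,3)

lemma mult_add_distrib_dim:
  fixes A :: "'a::semiring_0 mat"
  shows "dim_row B = dim_row C \<Longrightarrow> dim_col B = dim_col C \<Longrightarrow> dim_col A = dim_row B \<Longrightarrow> A * (B + C) = A * B + A * C"
    and "dim_row B = dim_row C \<Longrightarrow> dim_col B = dim_col C \<Longrightarrow> dim_col B = dim_row A \<Longrightarrow> (B + C) * A = B * A + C * A"
   by (auto intro!: mult_add_distrib_mat add_mult_distrib_mat carrier_matI)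

lemma GL_dim: 
  assumes "A \<in> GL n"
  shows "dim_row A = n" "dim_col A = n" "dim_row (mat_inv A) = n" "dim_col (mat_inv A) = n"
  using GL_carrier[OF assms] mat_inv(1)[OF assms] by auto

lemma mat_inv_mult_cancel:
  assumes "A \<in> GL n" "dim_row B = n"
  shows "mat_inv A * (A * B) = B" "A * (mat_inv A * B) = B"
proof -
  have B: "B \<in> carrier_mat n (dim_col B)" using assms(2) by auto
  show "mat_inv A * (A * B) = B"
    using assoc_mult_mat[OF mat_inv(1)[OF assms(1)] GL_carrier[OF assms(1)] B] mat_inv(3)[OF assms(1)]
      left_mult_one_mat[OF B] by metis
  show "A * (mat_inv A * B) = B"
    using assoc_mult_mat[OF GL_carrier[OF assms(1)] mat_inv(1)[OF assms(1)] B] mat_inv(2)[OF assms(1)]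
      left_mult_one_mat[OF B] by metis
qed

lemma GL_mult_cancel_left:
  assumes "R \<in> GL n" "A \<in> carrier_mat n k" "B \<in> carrier_mat n k" "R * A = R * B"
  shows "A = B"
  using mat_inv_mult_cancel(1)[OF assms(1)] assms(2-) by (metis carrier_matD(1))

section \<open>Entries and traces of products\<close>

lemma mult_mat_index:
  assumes "A \<in> carrier_mat n k" "B \<in> carrier_mat k p" "i < n" "j < p"
  shows "(A * B) $$ (i, j) = (\<Sum>l<k. A $$ (i, l) * B $$ (l, j))"
  using assms by (auto simp: scalar_prod_def atLeast0LessThan intro!: sum.cong)

lemma mat_trace_add:
  "A \<in> carrier_mat n n \<Longrightarrow> B \<in> carrier_mat n n \<Longrightarrow> mat_trace (A + B) = mat_trace A + mat_trace B"
  by (simp add: mat_trace_def sum.distrib)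

lemma mat_trace_mult_comm:
  fixes A :: "'a::comm_semiring_0 mat"
  assumes "A \<in> carrier_mat n k" "B \<in> carrier_mat k n"
  shows "mat_trace (A * B) = mat_trace (B * A)"
proof -
  have "mat_trace (A * B) = (\<Sum>i<n. \<Sum>j<k. A $$ (i, j) * B $$ (j, i))"
    unfolding mat_trace_def using assms by (intro sum.cong) (auto simp: mult_mat_index[OF assms] simp del: index_mult_mat(1))
  also have "\<dots> = (\<Sum>j<k. \<Sum>i<n. B $$ (j, i) * A $$ (i, j))"
    by (subst sum.swap) (simp add: mult.commute)
  also have "\<dots> = mat_trace (B * A)"
    unfolding mat_trace_def using assms
    by (intro sum.cong) (auto simp: mult_mat_index[OF assms(2,1)] simp del: index_mult_mat(1))
  finally show ?thesis .
qed

lemma mat_trace_transpose: "A \<in> carrier_mat n n \<Longrightarrow> mat_trace A\<^sup>T = mat_trace A"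
  by (auto simp: mat_trace_def)

section \<open>Cardinality of matrix spaces\<close>

lemma bij_betw_mat_PiE:
  "bij_betw (\<lambda>f. mat n k f) (PiE ({..<n} \<times> {..<k}) (\<lambda>_. UNIV)) (carrier_mat n k)"
proof (rule bij_betwI[where g = "\<lambda>A. restrict (\<lambda>p. A $$ p) ({..<n} \<times> {..<k})"])
  fix f :: "nat \<times> nat \<Rightarrow> 'a" assume "f \<in> PiE ({..<n} \<times> {..<k}) (\<lambda>_. UNIV)"
  then show "restrict (\<lambda>p. mat n k f $$ p) ({..<n} \<times> {..<k}) = f"
    by (intro ext) (force simp: PiE_def extensional_def restrict_def)
qed (auto simp: PiE_def intro!: eq_matI)

lemma card_carrier_mat: "card (carrier_mat n k :: 'a::finite mat set) = CARD('a) ^ (n * k)"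
  using bij_betw_same_card[OF bij_betw_mat_PiE[where 'a='a, of n k]]
  by (simp add: card_PiE)

lemma finite_carrier_mat [simp]: "finite (carrier_mat n k :: 'a::finite mat set)"
  using bij_betw_finite[OF bij_betw_mat_PiE[where 'a='a, of n k]] by (simp add: finite_PiE)

lemma finite_GL [simp]: "finite (GL n :: 'a::{field,finite} mat set)"
  by (rule finite_subset[OF _ finite_carrier_mat[of n n]]) (auto simp: GL_def)

section \<open>Two by two block matrices\<close>

lemma four_block_mat_inject:
  assumes "A \<in> carrier_mat a b" "A' \<in> carrier_mat a b" "B \<in> carrier_mat a d" "B' \<in> carrier_mat a d"
    "C \<in> carrier_mat c b" "C' \<in> carrier_mat c b" "D \<in> carrier_mat c d" "D' \<in> carrier_mat c d"
  shows "four_block_mat A B C D = four_block_mat A' B' C' D' \<longleftrightarrow> A = A' \<and> B = B' \<and> C = C' \<and> D = D'"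
proof
  assume eq: "four_block_mat A B C D = four_block_mat A' B' C' D'"
  have e: "four_block_mat A B C D $$ (i, j) = four_block_mat A' B' C' D' $$ (i, j)" for i j
    using eq by simp
  have "A = A'" 
  proof (rule eq_matI)
    fix i j assume "i < dim_row A'" "j < dim_col A'"
    with e[of i j] assms show "A $$ (i, j) = A' $$ (i, j)" by auto
  qed (use assms in auto)
  moreover have "B = B'"
  proof (rule eq_matI)
    fix i j assume "i < dim_row B'" "j < dim_col B'"
    with e[of i "j + b"] assms show "B $$ (i, j) = B' $$ (i, j)" by auto
  qed (use assms in auto)
  moreover have "C = C'"
  proof (rule eq_matI)
    fix i j assume "i < dim_row C'" "j < dim_col C'"
    with e[of "i + a" j] assms show "C $$ (i, j) = C' $$ (i, j)" by auto
  qed (use assms in auto)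
  moreover have "D = D'"
  proof (rule eq_matI)
    fix i j assume "i < dim_row D'" "j < dim_col D'"
    with e[of "i + a" "j + b"] assms show "D $$ (i, j) = D' $$ (i, j)" by auto
  qed (use assms in auto)
  ultimately show "A = A' \<and> B = B' \<and> C = C' \<and> D = D'" by blast
qed auto

lemma four_block_mat_exhaust:
  assumes "M \<in> carrier_mat (a + c) (b + d)"
  obtains A B C D where "A \<in> carrier_mat a b" "B \<in> carrier_mat a d" "C \<in> carrier_mat c b"
    "D \<in> carrier_mat c d" "M = four_block_mat A B C D"
proof -
  obtain A B C D where s: "split_block M a b = (A, B, C, D)" by (metis prod_cases4)
  from split_block[OF this, of c d] assms that show ?thesis by auto
qed

lemma lower_block_GL_iff:
  assumes "A \<in> carrier_mat s s" "C \<in> carrier_mat t s" "D \<in> carrier_mat t t"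
  shows "four_block_mat A (0\<^sub>m s t) C D \<in> GL (s + t) \<longleftrightarrow> A \<in> GL s \<and> D \<in> GL t"
  using assms by (auto simp: GL_iff_det det_four_block_mat_upper_right_zero[OF assms(1) refl assms(2,3)])

lemma upper_block_GL_iff:
  assumes "A \<in> carrier_mat s s" "B \<in> carrier_mat s t" "D \<in> carrier_mat t t"
  shows "four_block_mat A B (0\<^sub>m t s) D \<in> GL (s + t) \<longleftrightarrow> A \<in> GL s \<and> D \<in> GL t"
  using assms by (auto simp: GL_iff_det det_four_block_mat_lower_left_zero[OF assms(1,2) refl assms(3)])

lemma mult_lower_block:
  fixes A :: "'a::comm_ring_1 mat"
  assumes "A \<in> carrier_mat s s" "C \<in> carrier_mat t s" "D \<in> carrier_mat t t"
    "A' \<in> carrier_mat s s" "C' \<in> carrier_mat t s" "D' \<in> carrier_mat t t"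
  shows "four_block_mat A (0\<^sub>m s t) C D * four_block_mat A' (0\<^sub>m s t) C' D' =
    four_block_mat (A * A') (0\<^sub>m s t) (C * A' + D * C') (D * D')"
proof -
  have "A * A' + 0\<^sub>m s t * C' = A * A'" "A * 0\<^sub>m s t + 0\<^sub>m s t * D' = 0\<^sub>m s t"
    "C * 0\<^sub>m s t + D * D' = D * D'"
    using assms by (auto intro!: eq_matI)
  with mult_four_block_mat[OF assms(1) zero_carrier_mat assms(2,3,4) zero_carrier_mat assms(5,6)]
  show ?thesis by simp
qed

text \<open>Two features are used later: the inverse is again block lower triangular, and its lower
  right corner depends on \<open>D\<close> alone.\<close>

lemma mat_inv_lower_block:
  assumes A: "A \<in> GL s" and C: "C \<in> carrier_mat t s" and D: "D \<in> GL t"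
  shows "mat_inv (four_block_mat A (0\<^sub>m s t) C D) =
    four_block_mat (mat_inv A) (0\<^sub>m s t) (- (mat_inv D * C * mat_inv A)) (mat_inv D)"
proof (rule mat_inv_unique)
  define X where "X = mat_inv D * C * mat_inv A"
  note I = mat_inv[OF A] mat_inv[OF D]
  note c = GL_carrier[OF A] GL_carrier[OF D]
  have X: "X \<in> carrier_mat t s" unfolding X_def using I C by (meson mult_carrier_mat)
  show "four_block_mat A (0\<^sub>m s t) C D \<in> carrier_mat (s + t) (s + t)"
    "four_block_mat (mat_inv A) (0\<^sub>m s t) (- (mat_inv D * C * mat_inv A)) (mat_inv D) \<in> carrier_mat (s + t) (s + t)"
    using c I by auto
  have "D * X = C * mat_inv A"
    unfolding X_def using C I c by (simp add: mult_assoc_dim mat_inv_mult_cancel[OF D])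
  then have "D * (- X) = - (C * mat_inv A)" using X c by simp
  then have "C * mat_inv A + D * (- X) = 0\<^sub>m t s"
    using C I by (intro eq_matI) auto
  then show "four_block_mat A (0\<^sub>m s t) C D *
      four_block_mat (mat_inv A) (0\<^sub>m s t) (- (mat_inv D * C * mat_inv A)) (mat_inv D) = 1\<^sub>m (s + t)"
    using mult_lower_block[of A s C t D "mat_inv A" "- X" "mat_inv D"] X C c I by (simp flip: X_def)
qed

text \<open>The index condition is the one that survives summation over alternating matrices. It
  says that the upper right block is zero; invertibility then constrains the diagonal blocks only,
  so the three blocks vary independently.\<close>

lemma sum_lower_block_GL:
  fixes f :: "'a::{field,finite} mat \<Rightarrow> 'b::comm_monoid_add"
  shows "(\<Sum>A\<in>{A \<in> GL (s + t). \<forall>i<s. \<forall>j\<in>{s..<s + t}. A $$ (i, j) = 0}. f A) =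
    (\<Sum>A\<in>GL s. \<Sum>C\<in>carrier_mat t s. \<Sum>D\<in>GL t. f (four_block_mat A (0\<^sub>m s t) C D))"
proof -
  let ?g = "\<lambda>(A, C, D). four_block_mat A (0\<^sub>m s t) C (D :: 'a mat)"
  have "bij_betw ?g (GL s \<times> carrier_mat t s \<times> GL t) {A \<in> GL (s + t). \<forall>i<s. \<forall>j\<in>{s..<s + t}. A $$ (i, j) = 0}"
    unfolding bij_betw_def
  proof
    show "inj_on ?g (GL s \<times> carrier_mat t s \<times> GL t)"
      by (auto simp: inj_on_def GL_carrier four_block_mat_inject[of _ s s _ _ t _ _ t])
    show "?g ` (GL s \<times> carrier_mat t s \<times> GL t) = {A \<in> GL (s + t). \<forall>i<s. \<forall>j\<in>{s..<s + t}. A $$ (i, j) = 0}"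
    proof (intro equalityI subsetI)
      fix M assume "M \<in> ?g ` (GL s \<times> carrier_mat t s \<times> GL t)"
      then obtain A C D where M: "M = four_block_mat A (0\<^sub>m s t) C D" and "A \<in> GL s" "C \<in> carrier_mat t s" "D \<in> GL t"
        by auto
      then have c: "A \<in> carrier_mat s s" "D \<in> carrier_mat t t" by (auto simp: GL_carrier)
      have "M \<in> GL (s + t)" unfolding M using lower_block_GL_iff[OF c(1) \<open>C \<in> _\<close> c(2)] \<open>A \<in> GL s\<close> \<open>D \<in> GL t\<close> by simp
      moreover have "\<forall>i<s. \<forall>j\<in>{s..<s + t}. M $$ (i, j) = 0"
        unfolding M using c by auto
      ultimately show "M \<in> {A \<in> GL (s + t). \<forall>i<s. \<forall>j\<in>{s..<s + t}. A $$ (i, j) = 0}" by blast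
    next
      fix M :: "'a mat" assume M: "M \<in> {A \<in> GL (s + t). \<forall>i<s. \<forall>j\<in>{s..<s + t}. A $$ (i, j) = 0}"
      then have "M \<in> carrier_mat (s + t) (s + t)" by (auto simp: GL_carrier)
      from four_block_mat_exhaust[OF this] obtain A B C D where c: "A \<in> carrier_mat s s" "B \<in> carrier_mat s t"
        "C \<in> carrier_mat t s" "D \<in> carrier_mat t t" and eq: "M = four_block_mat A B C D" .
      have "B = 0\<^sub>m s t"
      proof (rule eq_matI)
        fix i j assume "i < dim_row (0\<^sub>m s t)" "j < dim_col (0\<^sub>m s t)"
        then show "B $$ (i, j) = 0\<^sub>m s t $$ (i, j)"
          using M c unfolding eq by (auto dest!: spec[of _ i] bspec[of _ _ "s + j"])
      qed (use c in auto)
      with M c eq lower_block_GL_iff[OF c(1,3,4)] show "M \<in> ?g ` (GL s \<times> carrier_mat t s \<times> GL t)"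
        by (auto intro!: image_eqI[of _ _ "(A, C, D)"])
    qed
  qed
  from sum.reindex_bij_betw[OF this, of f, symmetric]
  show ?thesis by (simp add: sum.cartesian_product case_prod_beta)
qed

section \<open>Counting invertible matrices\<close>

text \<open>Columns are encoded as matrices of width 1, so that the lemmas on products and blocks
  apply to them.\<close>

definition e1 :: "nat \<Rightarrow> 'a::zero_neq_one mat" where
  "e1 n = mat n 1 (\<lambda>(i, j). if i = 0 then 1 else 0)"

definition first_col :: "'a mat \<Rightarrow> 'a mat" where
  "first_col A = mat (dim_row A) 1 (\<lambda>(i, j). A $$ (i, 0))"

lemma e1_carrier [simp]: "e1 n \<in> carrier_mat n (Suc 0)"
  by (simp add: e1_def)

text \<open>\<open>v\<close> is completed to a basis; the inverse of the matrix with these columns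
  sends \<open>v\<close> to the first unit vector.\<close>

lemma exists_GL_mult_eq_e1:
  fixes v :: "'a::field mat"
  assumes v: "v \<in> carrier_mat n 1" and nz: "v \<noteq> 0\<^sub>m n 1"
  shows "\<exists>R \<in> GL n. R * v = e1 n"
proof -
  from nz v obtain j where j: "j < n" "v $$ (j, 0) \<noteq> 0"
    by (metis One_nat_def carrier_matD eq_matI index_zero_mat less_Suc0)
  \<comment> \<open>The identity matrix with column 0 replaced by \<open>v\<close> and, if
    \<open>j\<close> is not 0, column \<open>j\<close> replaced by the first unit vector. It is
    nonsingular because entry \<open>j\<close> of \<open>v\<close> is nonzero.\<close>
  define W where "W = mat n n (\<lambda>(r, c). if c = 0 then v $$ (r, 0) else
      if c = j then (if r = 0 then 1 else 0) else (if r = c then 1 else 0))"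
  have W: "W \<in> carrier_mat n n" by (simp add: W_def)
  have "det W\<^sup>T \<noteq> 0"
  proof
    assume "det W\<^sup>T = 0"
    with W obtain y where y: "y \<in> carrier_vec n" "y \<noteq> 0\<^sub>v n" "W\<^sup>T *\<^sub>v y = 0\<^sub>v n"
      using det_0_iff_vec_prod_zero_field[of "W\<^sup>T" n] by auto
    have col: "(\<Sum>r<n. W $$ (r, c) * y $ r) = 0" if "c < n" for c
    proof -
      have "(W\<^sup>T *\<^sub>v y) $ c = 0" using y that by simp
      then show ?thesis using that W y(1)
        by (simp add: scalar_prod_def atLeast0LessThan)
    qed
    \<comment> \<open>\<open>y\<close> is orthogonal to all columns of \<open>W\<close>. The
      standard columns kill its entries away from 0 and \<open>j\<close>, column \<open>j\<close>
      kills entry 0, and column 0 then leaves entry \<open>j\<close> times a nonzero factor.\<close>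
    have other: "y $ c = 0" if "c < n" "c \<noteq> 0" "c \<noteq> j" for c
    proof -
      have "(\<Sum>r<n. W $$ (r, c) * y $ r) = (\<Sum>r<n. if r = c then y $ r else 0)"
        using that by (intro sum.cong) (auto simp: W_def)
      with col[of c] that show ?thesis by simp
    qed
    have zero: "y $ 0 = 0" if "j \<noteq> 0"
    proof -
      have "(\<Sum>r<n. W $$ (r, j) * y $ r) = (\<Sum>r<n. if r = 0 then y $ r else 0)"
        using that j by (intro sum.cong) (auto simp: W_def)
      with col[of j] j show ?thesis by simp
    qed
    have "(\<Sum>r<n. W $$ (r, 0) * y $ r) = (\<Sum>r<n. if r = j then v $$ (j, 0) * y $ j else 0)"
    proof (rule sum.cong[OF refl])
      fix r assume r: "r \<in> {..<n}"
      have "y $ r = 0" if "r \<noteq> j" using zero other[of r] r that by (cases "r = 0") auto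
      with r show "W $$ (r, 0) * y $ r = (if r = j then v $$ (j, 0) * y $ j else 0)"
        using j by (auto simp: W_def)
    qed
    with col[of 0] j have "y $ j = 0" by simp
    with other zero have "y $ c = 0" if "c < n" for c using that by metis
    then have "y = 0\<^sub>v n" using y(1) by (intro eq_vecI) auto
    with y show False by simp
  qed
  then have WG: "W \<in> GL n" using W by (simp add: GL_iff_det det_transpose)
  have "W * e1 n = v"
  proof (rule eq_matI)
    fix i k assume ik: "i < dim_row v" "k < dim_col v"
    have "(W * e1 n) $$ (i, k) = (\<Sum>l<n. W $$ (i, l) * e1 n $$ (l, k))"
      using W ik v by (intro mult_mat_index[of _ _ _ _ 1]) auto
    also have "\<dots> = (\<Sum>l<n. if l = 0 then v $$ (i, 0) else 0)"
      using ik v by (intro sum.cong) (auto simp: W_def e1_def)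
    also have "\<dots> = v $$ (i, k)" using ik v by auto
    finally show "(W * e1 n) $$ (i, k) = v $$ (i, k)" .
  qed (use W v in \<open>auto simp: e1_def\<close>)
  then have "mat_inv W * v = e1 n"
    using mat_inv_mult_cancel(1)[OF WG, of "e1 n"] by (simp add: e1_def)
  with mat_inv_GL[OF WG] show ?thesis by blast
qed

lemma first_col_mult:
  fixes R :: "'a::semiring_0 mat"
  assumes "R \<in> carrier_mat n k" "A \<in> carrier_mat k p" "p > 0"
  shows "first_col (R * A) = R * first_col A"
  using assms by (intro eq_matI) (auto simp: first_col_def scalar_prod_def)

lemma first_col_GL_nonzero:
  assumes A: "A \<in> GL (Suc k)"
  shows "first_col A \<noteq> 0\<^sub>m (Suc k) 1"
proof
  assume z: "first_col A = 0\<^sub>m (Suc k) 1"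
  have "first_col (mat_inv A * A) = mat_inv A * first_col A"
    using mat_inv(1)[OF A] GL_carrier[OF A] by (intro first_col_mult) auto
  then have "first_col (1\<^sub>m (Suc k) :: 'a mat) = 0\<^sub>m (Suc k) 1"
    using mat_inv[OF A] z by auto
  then have "first_col (1\<^sub>m (Suc k) :: 'a mat) $$ (0, 0) = 0" by simp
  then show False by (simp add: first_col_def)
qed

text \<open>Left multiplication by an invertible matrix that sends \<open>v\<close> to
  \<open>e1\<close> reduces the count to the first column \<open>e1\<close>. There the rest of the
  first row is free and the lower right block is any invertible matrix.\<close>

lemma card_GL_fixed_first_col:
  fixes v :: "'a::{field,finite} mat"
  assumes v: "v \<in> carrier_mat (Suc k) 1" and nz: "v \<noteq> 0\<^sub>m (Suc k) 1"
  shows "card {A \<in> GL (Suc k). first_col A = v} = CARD('a) ^ k * card (GL k :: 'a mat set)"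
proof -
  obtain R where R: "R \<in> GL (Suc k)" "R * v = e1 (Suc k)" using exists_GL_mult_eq_e1[OF v nz] by blast
  have Rc: "R \<in> carrier_mat (Suc k) (Suc k)" using R(1) by (rule GL_carrier)
  have "bij_betw ((*) R) {A \<in> GL (Suc k). first_col A = v} {A \<in> GL (Suc k). first_col A = e1 (Suc k)}"
  proof (rule bij_betwI[where g = "(*) (mat_inv R)"])
    show "(*) R \<in> {A \<in> GL (Suc k). first_col A = v} \<rightarrow> {A \<in> GL (Suc k). first_col A = e1 (Suc k)}"
      using R by (auto simp: GL_mult first_col_mult[OF GL_carrier[OF R(1)] GL_carrier])
    have "mat_inv R * e1 (Suc k) = v"
      using mat_inv_mult_cancel(1)[OF R(1), of v] R v by simp
    then show "(*) (mat_inv R) \<in> {A \<in> GL (Suc k). first_col A = e1 (Suc k)} \<rightarrow> {A \<in> GL (Suc k). first_col A = v}"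
      using R by (auto simp: GL_mult mat_inv_GL first_col_mult[OF mat_inv(1)[OF R(1)] GL_carrier])
  qed (auto simp: mat_inv_mult_cancel[OF R(1)] GL_dim)
  then have "card {A \<in> GL (Suc k). first_col A = v} = card {A \<in> GL (Suc k). first_col A = e1 (Suc k) \<and> (A :: 'a mat) = A}"
    by (simp add: bij_betw_same_card)
  also have "{A \<in> GL (Suc k). first_col A = e1 (Suc k) \<and> (A :: 'a mat) = A} =
      (\<lambda>(B, D). four_block_mat (1\<^sub>m 1) B (0\<^sub>m k 1) D) ` (carrier_mat 1 k \<times> GL k)" (is "?L = ?f ` ?D")
  proof (intro equalityI subsetI)
    fix A :: "'a mat" assume A: "A \<in> ?L"
    then have "A \<in> carrier_mat (1 + k) (1 + k)" by (auto simp: GL_carrier)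
    from four_block_mat_exhaust[OF this] obtain X B C D where c: "X \<in> carrier_mat 1 1" "B \<in> carrier_mat 1 k"
      "C \<in> carrier_mat k 1" "D \<in> carrier_mat k k" and eq: "A = four_block_mat X B C D" .
    have fc: "A $$ (i, 0) = (if i = 0 then 1 else 0)" if "i < Suc k" for i
    proof -
      have "first_col A $$ (i, 0) = e1 (Suc k) $$ (i, 0)" using A by simp
      moreover have "dim_row A = Suc k" using A by (auto simp: GL_dim)
      ultimately show ?thesis using that unfolding first_col_def e1_def by simp
    qed
    have "X = 1\<^sub>m 1" using fc[of 0] c unfolding eq by (intro eq_matI) auto
    moreover have "C = 0\<^sub>m k 1"
    proof (rule eq_matI)
      fix i j assume "i < dim_row (0\<^sub>m k 1)" "j < dim_col (0\<^sub>m k 1)"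
      then show "C $$ (i, j) = 0\<^sub>m k 1 $$ (i, j)" using fc[of "Suc i"] c unfolding eq by auto
    qed (use c in auto)
    ultimately show "A \<in> ?f ` ?D"
      using A eq c upper_block_GL_iff[OF c(1,2,4)] by (auto intro!: image_eqI[of _ _ "(B, D)"])
  next
    fix A assume "A \<in> ?f ` ?D"
    then obtain B D where c: "B \<in> carrier_mat 1 k" "D \<in> GL k" and eq: "A = four_block_mat (1\<^sub>m 1) B (0\<^sub>m k 1) D" by auto
    have "A \<in> GL (1 + k)" unfolding eq using upper_block_GL_iff[OF one_carrier_mat c(1) GL_carrier[OF c(2)]] c one_GL
      by blast
    moreover have "first_col A = e1 (Suc k)" unfolding eq using c
      by (intro eq_matI) (auto simp: first_col_def e1_def GL_dim)
    ultimately show "A \<in> ?L" by simp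
  qed
  also have "card \<dots> = card ?D"
    by (rule card_image) (auto simp: inj_on_def GL_carrier four_block_mat_inject[of _ 1 1 _ _ k _ _ k])
  also have "\<dots> = CARD('a) ^ k * card (GL k :: 'a mat set)"
    by (simp add: card_cartesian_product card_carrier_mat)
  finally show ?thesis by simp
qed

lemma card_GL_Suc:
  "card (GL (Suc k) :: 'a::{field,finite} mat set) =
    (CARD('a) ^ Suc k - 1) * CARD('a) ^ k * card (GL k :: 'a mat set)"
proof -
  let ?T = "carrier_mat (Suc k) 1 - {0\<^sub>m (Suc k) 1} :: 'a mat set"
  have "card (GL (Suc k) :: 'a mat set) = (\<Sum>A\<in>(GL (Suc k) :: 'a mat set). 1)" by simp
  also have "\<dots> = (\<Sum>v\<in>?T. \<Sum>A\<in>{A \<in> GL (Suc k). first_col A = v}. 1)"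
  proof (rule sum.group[symmetric])
    show "first_col ` GL (Suc k) \<subseteq> ?T"
    proof
      fix v assume "v \<in> first_col ` (GL (Suc k) :: 'a mat set)"
      then obtain A where A: "A \<in> GL (Suc k)" "v = first_col A" by blast
      then have "v \<in> carrier_mat (Suc k) 1" by (auto simp: first_col_def GL_dim)
      with first_col_GL_nonzero[OF A(1)] A(2) show "v \<in> ?T" by simp
    qed
  qed auto
  also have "\<dots> = (\<Sum>v\<in>?T. CARD('a) ^ k * card (GL k :: 'a mat set))"
    by (intro sum.cong) (auto simp: card_GL_fixed_first_col)
  also have "\<dots> = card ?T * (CARD('a) ^ k * card (GL k :: 'a mat set))" by simp
  also have "card ?T = CARD('a) ^ Suc k - 1" by (simp add: card_Diff_singleton card_carrier_mat)
  finally show ?thesis by (simp add: mult.assoc)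
qed

lemma card_GL_0: "card (GL 0 :: 'a::field mat set) = 1"
proof -
  have "(GL 0 :: 'a mat set) = {1\<^sub>m 0}" by (auto simp: GL_iff_det intro!: eq_matI)
  then show ?thesis by simp
qed

section \<open>Counting invertible symmetric matrices\<close>

definition sym_GL :: "nat \<Rightarrow> 'a::field mat set" where
  "sym_GL n = {S \<in> GL n. S\<^sup>T = S}"

lemma sym_GL_carrier: "S \<in> sym_GL n \<Longrightarrow> S \<in> carrier_mat n n"
  by (auto simp: sym_GL_def GL_carrier)

lemma finite_sym_GL [simp]: "finite (sym_GL n :: 'a::{field,finite} mat set)"
  by (auto simp: sym_GL_def)

lemma mat_single_inject: "mat (Suc 0) (Suc 0) (\<lambda>_. a) = mat (Suc 0) (Suc 0) (\<lambda>_. a') \<longleftrightarrow> a = a'"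
proof
  assume "mat (Suc 0) (Suc 0) (\<lambda>_. a) = mat (Suc 0) (Suc 0) (\<lambda>_. a')"
  then have "mat (Suc 0) (Suc 0) (\<lambda>_. a) $$ (0, 0) = mat (Suc 0) (Suc 0) (\<lambda>_. a') $$ (0, 0)" by simp
  then show "a = a'" by simp
qed simp

lemma symmetric_border_exhaust:
  assumes "S \<in> carrier_mat (Suc p) (Suc p)" "S\<^sup>T = S"
  obtains a b D where "b \<in> carrier_mat p 1" "D \<in> carrier_mat p p" "D\<^sup>T = D"
    "S = four_block_mat (mat 1 1 (\<lambda>_. a)) b\<^sup>T b D"
proof -
  have "S \<in> carrier_mat (1 + p) (1 + p)" using assms by simp
  from four_block_mat_exhaust[OF this] obtain X B C D where c: "X \<in> carrier_mat 1 1" "B \<in> carrier_mat 1 p"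
      "C \<in> carrier_mat p 1" "D \<in> carrier_mat p p" and eq: "S = four_block_mat X B C D" .
  have "four_block_mat X\<^sup>T C\<^sup>T B\<^sup>T D\<^sup>T = four_block_mat X B C D"
    using transpose_four_block_mat[OF c] assms(2) unfolding eq by simp
  then have "C\<^sup>T = B" "D\<^sup>T = D"
    using c by (auto simp: four_block_mat_inject[of _ 1 1 _ _ p _ _ p])
  moreover have "X = mat 1 1 (\<lambda>_. X $$ (0, 0))" using c by (intro eq_matI) auto
  ultimately show ?thesis using that[of C D "X $$ (0,0)"] c eq by metis
qed

lemma symmetric_border:
  assumes "b \<in> carrier_mat p 1" "D \<in> carrier_mat p p" "D\<^sup>T = D"
  shows "(four_block_mat (mat 1 1 (\<lambda>_. a)) b\<^sup>T b D)\<^sup>T = four_block_mat (mat 1 1 (\<lambda>_. a)) b\<^sup>T b D"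
proof -
  have "(mat 1 1 (\<lambda>_. a))\<^sup>T = mat 1 1 (\<lambda>_. a)" by (intro eq_matI) auto
  then show ?thesis
    using transpose_four_block_mat[of "mat 1 1 (\<lambda>_. a)" 1 1 "b\<^sup>T" p b p D] assms by simp
qed

lemma card_symmetric_border:
  "card (sym_GL (Suc p) :: 'a::{field,finite} mat set) =
    (\<Sum>a\<in>UNIV. \<Sum>b\<in>carrier_mat p 1. card {D \<in> carrier_mat p p. D\<^sup>T = D \<and>
       four_block_mat (mat 1 1 (\<lambda>_. a :: 'a)) b\<^sup>T b D \<in> GL (Suc p)})"
proof -
  let ?X = "\<lambda>(a :: 'a) b. {D \<in> carrier_mat p p. D\<^sup>T = D \<and> four_block_mat (mat 1 1 (\<lambda>_. a)) b\<^sup>T b D \<in> GL (Suc p)}"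
  let ?S = "SIGMA a : UNIV. SIGMA b : carrier_mat p 1. ?X a b"
  let ?f = "\<lambda>(a :: 'a, b, D). four_block_mat (mat 1 1 (\<lambda>_. a)) b\<^sup>T b D"
  have inj: "inj_on ?f ?S"
  proof (rule inj_onI, clarsimp)
    fix a b D a' b' D'
    assume c: "b \<in> carrier_mat p (Suc 0)" "D \<in> carrier_mat p p" "b' \<in> carrier_mat p (Suc 0)" "D' \<in> carrier_mat p p"
      and eq: "four_block_mat (mat (Suc 0) (Suc 0) (\<lambda>_. a)) b\<^sup>T b D = four_block_mat (mat (Suc 0) (Suc 0) (\<lambda>_. a')) b'\<^sup>T b' D'"
    have "mat 1 1 (\<lambda>_. a) = mat 1 1 (\<lambda>_. a') \<and> b\<^sup>T = b'\<^sup>T \<and> b = b' \<and> D = D'"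
      using eq c by (subst four_block_mat_inject[symmetric, of _ 1 1 _ _ p _ _ p]) auto
    then show "a = a' \<and> b = b' \<and> D = D'" by (simp add: mat_single_inject)
  qed
  have img: "?f ` ?S = sym_GL (Suc p)"
  proof (intro equalityI subsetI)
    fix S assume "S \<in> ?f ` ?S"
    then obtain a b D where c: "b \<in> carrier_mat p 1" "D \<in> carrier_mat p p" "D\<^sup>T = D" "S \<in> GL (Suc p)"
      and eq: "S = four_block_mat (mat 1 1 (\<lambda>_. a)) b\<^sup>T b D" by auto
    have "S\<^sup>T = S" unfolding eq using c by (intro symmetric_border) auto
    with c show "S \<in> sym_GL (Suc p)" by (simp add: sym_GL_def)
  next
    fix S :: "'a mat" assume S: "S \<in> sym_GL (Suc p)"
    then have "S \<in> carrier_mat (Suc p) (Suc p)" "S\<^sup>T = S" by (auto simp: sym_GL_def GL_carrier)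
    from symmetric_border_exhaust[OF this] obtain a b D where c: "b \<in> carrier_mat p 1" "D \<in> carrier_mat p p" "D\<^sup>T = D"
      and eq: "S = four_block_mat (mat 1 1 (\<lambda>_. a)) b\<^sup>T b D" .
    with S show "S \<in> ?f ` ?S" by (intro image_eqI[of _ _ "(a, b, D)"]) (auto simp: sym_GL_def)
  qed
  have fin: "finite (?X a b)" for a b by auto
  have "card (sym_GL (Suc p) :: 'a mat set) = card ?S" using card_image[OF inj] unfolding img .
  also have "\<dots> = (\<Sum>a\<in>UNIV. card (SIGMA b : carrier_mat p 1. ?X a b))"
    using fin by (intro card_SigmaI) (auto intro!: finite_SigmaI)
  also have "\<dots> = (\<Sum>a\<in>UNIV. \<Sum>b\<in>carrier_mat p 1. card (?X a b))"
    using fin by (intro sum.cong refl card_SigmaI) auto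
  finally show ?thesis .
qed

lemma card_sym_GL_nonzero_corner:
  fixes a :: "'a::{field,finite}"
  assumes a: "a \<noteq> 0" and b: "b \<in> carrier_mat p 1"
  shows "card {D \<in> carrier_mat p p. D\<^sup>T = D \<and> four_block_mat (mat 1 1 (\<lambda>_. a)) b\<^sup>T b D \<in> GL (Suc p)} =
    card (sym_GL p :: 'a mat set)"
proof -
  let ?a = "mat 1 1 (\<lambda>_. a)"
  \<comment> \<open>The rank-one correction in the Schur complement of \<open>a\<close>: while
    \<open>D\<close> runs over the Schur complements, \<open>D + c\<close> runs over the lower right
    blocks.\<close>
  define c where "c = (inverse a \<cdot>\<^sub>m b) * b\<^sup>T"
  have c: "c \<in> carrier_mat p p" "c\<^sup>T = c"
    using b unfolding c_def by (auto intro!: eq_matI simp: scalar_prod_def)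
  have iff: "four_block_mat ?a b\<^sup>T b (D + c) \<in> GL (Suc p) \<longleftrightarrow> D \<in> GL p" if D: "D \<in> carrier_mat p p" for D
  proof -
    let ?L = "four_block_mat (1\<^sub>m 1) (0\<^sub>m 1 p) (inverse a \<cdot>\<^sub>m b) (1\<^sub>m p)"
    let ?U = "four_block_mat ?a b\<^sup>T (0\<^sub>m p 1) D"
    have ib: "inverse a \<cdot>\<^sub>m b \<in> carrier_mat p 1" using b by simp
    have L: "?L \<in> carrier_mat (1 + p) (1 + p)" by (intro four_block_carrier_mat) auto
    have U: "?U \<in> carrier_mat (1 + p) (1 + p)" using D by (intro four_block_carrier_mat) auto
    have "?L * ?U = four_block_mat (1\<^sub>m 1 * ?a + 0\<^sub>m 1 p * 0\<^sub>m p 1) (1\<^sub>m 1 * b\<^sup>T + 0\<^sub>m 1 p * D)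
       (inverse a \<cdot>\<^sub>m b * ?a + 1\<^sub>m p * 0\<^sub>m p 1) (inverse a \<cdot>\<^sub>m b * b\<^sup>T + 1\<^sub>m p * D)"
      by (rule mult_four_block_mat[OF one_carrier_mat zero_carrier_mat ib one_carrier_mat]) (use b D in auto)
    also have "1\<^sub>m 1 * ?a + 0\<^sub>m 1 p * 0\<^sub>m p 1 = ?a" by (intro eq_matI) (auto simp: scalar_prod_def)
    also have "1\<^sub>m 1 * b\<^sup>T + 0\<^sub>m 1 p * D = b\<^sup>T" using b D by (intro eq_matI) (auto simp: scalar_prod_def)
    also have "inverse a \<cdot>\<^sub>m b * ?a + 1\<^sub>m p * 0\<^sub>m p 1 = b" using a b by (intro eq_matI) (auto simp: scalar_prod_def)
    also have "inverse a \<cdot>\<^sub>m b * b\<^sup>T + 1\<^sub>m p * D = D + c"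
      unfolding c_def[symmetric] using D c by (simp add: comm_add_mat[of _ p p])
    finally have "det (four_block_mat ?a b\<^sup>T b (D + c)) = det ?L * det ?U" using det_mult[OF L U] by simp
    also have "det ?L = 1"
      by (subst det_four_block_mat_upper_right_zero[OF one_carrier_mat refl ib one_carrier_mat]) simp
    also have "det ?U = a * det D"
      by (subst det_four_block_mat_lower_left_zero[of _ 1 _ p]) (use b D in \<open>auto simp: det_single\<close>)
    finally show ?thesis using a D c by (auto simp: GL_iff_det)
  qed
  have "bij_betw (\<lambda>D. D + c) (sym_GL p)
    {D \<in> carrier_mat p p. D\<^sup>T = D \<and> four_block_mat ?a b\<^sup>T b D \<in> GL (Suc p)}" (is "bij_betw _ _ ?R")
  proof (rule bij_betwI[where g = "\<lambda>D. D - c"])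
    show "(\<lambda>D. D + c) \<in> sym_GL p \<rightarrow> ?R"
      using c iff by (auto simp: sym_GL_def GL_carrier transpose_add[of _ p p])
    show "(\<lambda>D. D - c) \<in> ?R \<rightarrow> sym_GL p"
    proof
      fix D assume D: "D \<in> ?R"
      have "D - c + c = D" using D c by (intro eq_matI) auto
      moreover have "(D - c)\<^sup>T = D - c" using D c by (simp add: transpose_minus[of _ p p])
      ultimately show "D - c \<in> sym_GL p" using iff[of "D - c"] D c minus_carrier_mat[of c p p D] by (auto simp: sym_GL_def)
    qed
    show "D + c - c = D" if "D \<in> sym_GL p" for D
      using sym_GL_carrier[OF that] c by (intro eq_matI) auto
    show "D - c + c = D" if "D \<in> ?R" for D
      using that c by (intro eq_matI) auto
  qed
  from bij_betw_same_card[OF this] show ?thesis by (rule sym)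
qed

text \<open>After exchanging the first two rows the matrix is block triangular with leading entry 1,
  and so is what remains. Hence the determinant is that of \<open>D\<close> up to sign, and
  \<open>d\<close> and \<open>f\<close> stay free.\<close>

lemma four_block_zero_e1_GL_iff:
  fixes D :: "'a::field mat"
  assumes f: "f \<in> carrier_mat k 1" and D: "D \<in> carrier_mat k k"
  shows "four_block_mat (mat 1 1 (\<lambda>_. 0)) (e1 (Suc k))\<^sup>T (e1 (Suc k)) (four_block_mat (mat 1 1 (\<lambda>_. d)) f\<^sup>T f D)
      \<in> GL (Suc (Suc k)) \<longleftrightarrow> D \<in> GL k"
proof -
  let ?S = "four_block_mat (mat 1 1 (\<lambda>_. 0)) (e1 (Suc k))\<^sup>T (e1 (Suc k)) (four_block_mat (mat 1 1 (\<lambda>_. d)) f\<^sup>T f D)"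
  let ?B = "mat 1 (Suc k) (\<lambda>(i, j). if j = 0 then d else f $$ (j - 1, 0))"
  let ?E = "four_block_mat (1\<^sub>m 1) (0\<^sub>m 1 k) f D"
  have S: "?S \<in> carrier_mat (Suc (Suc k)) (Suc (Suc k))" using f D by (auto simp: e1_def)
  have E: "?E \<in> carrier_mat (Suc k) (Suc k)" using D by (auto intro: carrier_matI)
  have "swaprows 0 1 ?S = four_block_mat (1\<^sub>m 1) ?B (0\<^sub>m (Suc k) 1) ?E"
    using f D by (intro eq_matI) (auto simp: e1_def mat_swaprows_def less_Suc_eq_0_disj)
  moreover have "det (swaprows 0 1 ?S) = - det ?S"
    by (rule det_swaprows[OF _ _ _ S]) auto
  moreover have "det (four_block_mat (1\<^sub>m 1) ?B (0\<^sub>m (Suc k) 1) ?E) = det ?E"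
    using E by (subst det_four_block_mat_lower_left_zero[of _ 1 _ "Suc k"]) auto
  moreover have "det ?E = det D"
    by (subst det_four_block_mat_upper_right_zero[OF one_carrier_mat refl f D]) simp
  ultimately have "- det ?S = det D" by simp
  with S D show ?thesis unfolding GL_iff_det by (metis neg_equal_0_iff_equal)
qed

lemma card_sym_GL_zero_corner:
  fixes b :: "'a::{field,finite} mat"
  assumes b: "b \<in> carrier_mat (Suc k) 1" and nz: "b \<noteq> 0\<^sub>m (Suc k) 1"
  shows "card {D \<in> carrier_mat (Suc k) (Suc k). D\<^sup>T = D \<and>
      four_block_mat (mat 1 1 (\<lambda>_. 0)) b\<^sup>T b D \<in> GL (Suc (Suc k))} =
    CARD('a) ^ Suc k * card (sym_GL k :: 'a mat set)"
proof -
  let ?z = "mat 1 1 (\<lambda>_. 0 :: 'a)"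
  let ?R = "\<lambda>b. {D \<in> carrier_mat (Suc k) (Suc k). D\<^sup>T = D \<and> four_block_mat ?z b\<^sup>T b D \<in> GL (Suc (Suc k))}"
  obtain R where R: "R \<in> GL (Suc k)" "R * b = e1 (Suc k)" using exists_GL_mult_eq_e1[OF b nz] by blast
  note Rc = GL_carrier[OF R(1)]
  note dims [simp] = GL_dim[OF R(1)]
  note RT = GL_transpose[OF R(1)]
  have RTi: "(mat_inv R)\<^sup>T * R\<^sup>T = 1\<^sub>m (Suc k)" "R\<^sup>T * (mat_inv R)\<^sup>T = 1\<^sub>m (Suc k)"
    using transpose_mult[OF Rc mat_inv(1)[OF R(1)]] transpose_mult[OF mat_inv(1)[OF R(1)] Rc] mat_inv[OF R(1)] by (metis transpose_one)+
  \<comment> \<open>Congruence by the block diagonal matrix with blocks 1 and \<open>R\<close>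
    replaces \<open>b\<close> by \<open>R * b\<close> and \<open>D\<close> by
    \<open>R * D * R\<^sup>T\<close>, and preserves invertibility.\<close>
  have iff: "four_block_mat ?z (e1 (Suc k))\<^sup>T (e1 (Suc k)) (R * D * R\<^sup>T) \<in> GL (Suc (Suc k)) \<longleftrightarrow>
      four_block_mat ?z b\<^sup>T b D \<in> GL (Suc (Suc k))" if D: "D \<in> carrier_mat (Suc k) (Suc k)" for D
  proof -
    let ?P = "four_block_mat (1\<^sub>m 1) (0\<^sub>m 1 (Suc k)) (0\<^sub>m (Suc k) 1) R"
    let ?PT = "four_block_mat (1\<^sub>m 1) (0\<^sub>m 1 (Suc k)) (0\<^sub>m (Suc k) 1) R\<^sup>T"
    let ?S = "four_block_mat ?z b\<^sup>T b D"
    have P: "?P \<in> carrier_mat (1 + Suc k) (1 + Suc k)" using Rc by (intro four_block_carrier_mat) auto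
    have PT: "?PT \<in> carrier_mat (1 + Suc k) (1 + Suc k)" using Rc by (intro four_block_carrier_mat) auto
    have S: "?S \<in> carrier_mat (1 + Suc k) (1 + Suc k)" using D by (intro four_block_carrier_mat) auto
    have 1: "?P * ?S = four_block_mat (1\<^sub>m 1 * ?z + 0\<^sub>m 1 (Suc k) * b) (1\<^sub>m 1 * b\<^sup>T + 0\<^sub>m 1 (Suc k) * D)
      (0\<^sub>m (Suc k) 1 * ?z + R * b) (0\<^sub>m (Suc k) 1 * b\<^sup>T + R * D)"
      by (rule mult_four_block_mat[OF one_carrier_mat zero_carrier_mat zero_carrier_mat Rc]) (use b D in auto)
    have 2: "1\<^sub>m 1 * ?z + 0\<^sub>m 1 (Suc k) * b = ?z" using b by (intro eq_matI) (auto simp: scalar_prod_def)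
    have 3: "1\<^sub>m 1 * b\<^sup>T + 0\<^sub>m 1 (Suc k) * D = b\<^sup>T" using b D by (intro eq_matI) (auto simp: scalar_prod_def)
    have 4: "0\<^sub>m (Suc k) 1 * ?z + R * b = R * b" using b by (intro eq_matI) (auto simp: scalar_prod_def)
    have 5: "0\<^sub>m (Suc k) 1 * b\<^sup>T + R * D = R * D" using b D by (intro eq_matI) (auto simp: scalar_prod_def)
    have PS: "?P * ?S = four_block_mat ?z b\<^sup>T (R * b) (R * D)" using 1 unfolding 2 3 4 5 .
    have cRb: "R * b \<in> carrier_mat (Suc k) 1" "R * D \<in> carrier_mat (Suc k) (Suc k)" using Rc b D by auto
    have 1: "four_block_mat ?z b\<^sup>T (R * b) (R * D) * ?PT =
      four_block_mat (?z * 1\<^sub>m 1 + b\<^sup>T * 0\<^sub>m (Suc k) 1) (?z * 0\<^sub>m 1 (Suc k) + b\<^sup>T * R\<^sup>T)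
      (R * b * 1\<^sub>m 1 + R * D * 0\<^sub>m (Suc k) 1) (R * b * 0\<^sub>m 1 (Suc k) + R * D * R\<^sup>T)"
      by (rule mult_four_block_mat[OF _ _ cRb one_carrier_mat zero_carrier_mat zero_carrier_mat]) (use b D Rc in auto)
    have 2: "?z * 1\<^sub>m 1 + b\<^sup>T * 0\<^sub>m (Suc k) 1 = ?z" using b by (intro eq_matI) (auto simp: scalar_prod_def)
    have 3: "?z * 0\<^sub>m 1 (Suc k) + b\<^sup>T * R\<^sup>T = (R * b)\<^sup>T"
      unfolding transpose_mult[OF Rc b] using b Rc by (intro eq_matI) (auto simp: scalar_prod_def)
    have 4: "R * b * 1\<^sub>m 1 + R * D * 0\<^sub>m (Suc k) 1 = R * b"
      unfolding right_mult_one_mat[OF cRb(1)] right_mult_zero_mat[OF cRb(2)] right_add_zero_mat[OF cRb(1)] ..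
    have 5: "R * b * 0\<^sub>m 1 (Suc k) + R * D * R\<^sup>T = R * D * R\<^sup>T" 
      unfolding right_mult_zero_mat[OF cRb(1)] using cRb Rc by (intro left_add_zero_mat) auto
    have "?P * ?S * ?PT = four_block_mat ?z (R * b)\<^sup>T (R * b) (R * D * R\<^sup>T)"
      unfolding PS 1 2 3 4 5 ..
    then have "det (four_block_mat ?z (R * b)\<^sup>T (R * b) (R * D * R\<^sup>T)) = det ?P * det ?S * det ?PT"
      using det_mult[OF P S] det_mult[OF mult_carrier_mat[OF P S] PT] by metis
    moreover have "det ?P \<noteq> 0"
      using R(1) by (subst det_four_block_mat_lower_left_zero[of _ 1 _ "Suc k"]) (auto simp: GL_iff_det)
    moreover have "det ?PT \<noteq> 0"
      using RT by (subst det_four_block_mat_lower_left_zero[of _ 1 _ "Suc k"]) (auto simp: GL_iff_det)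
    moreover have "four_block_mat ?z (R * b)\<^sup>T (R * b) (R * D * R\<^sup>T) \<in> carrier_mat (1 + Suc k) (1 + Suc k)"
      using Rc D by (intro four_block_carrier_mat) auto
    ultimately show ?thesis using S unfolding R(2) by (auto simp: GL_iff_det)
  qed
  have sym: "(R * D * R\<^sup>T)\<^sup>T = R * D * R\<^sup>T" if "D\<^sup>T = D" "D \<in> carrier_mat (Suc k) (Suc k)"
      "R \<in> carrier_mat (Suc k) (Suc k)" for D R :: "'a mat" and k
    by (simp only: that(1) transpose_mult_dim mult_assoc_dim mat_dims carrier_matD[OF that(2)] carrier_matD[OF that(3)] transpose_transpose)
  have inv1: "mat_inv R * (R * D * R\<^sup>T) * (mat_inv R)\<^sup>T = D" if "D \<in> carrier_mat (Suc k) (Suc k)" for D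
  proof -
    have "mat_inv R * (R * D * R\<^sup>T) * (mat_inv R)\<^sup>T = mat_inv R * (R * (D * (R\<^sup>T * (mat_inv R)\<^sup>T)))"
      by (simp only: mult_assoc_dim mat_dims dims carrier_matD[OF that])
    also have "\<dots> = D" unfolding RTi right_mult_one_mat[OF that]
      using carrier_matD[OF that] mat_inv_mult_cancel[OF R(1)] by metis
    finally show ?thesis .
  qed
  have inv2: "R * (mat_inv R * D * (mat_inv R)\<^sup>T) * R\<^sup>T = D" if "D \<in> carrier_mat (Suc k) (Suc k)" for D
  proof -
    have "R * (mat_inv R * D * (mat_inv R)\<^sup>T) * R\<^sup>T = R * (mat_inv R * (D * ((mat_inv R)\<^sup>T * R\<^sup>T)))"
      by (simp only: mult_assoc_dim mat_dims dims carrier_matD[OF that])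
    also have "\<dots> = D" unfolding RTi right_mult_one_mat[OF that]
      using carrier_matD[OF that] mat_inv_mult_cancel[OF R(1)] by metis
    finally show ?thesis .
  qed
  have "bij_betw (\<lambda>D. R * D * R\<^sup>T) (?R b) (?R (e1 (Suc k)))"
  proof (rule bij_betwI[where g = "\<lambda>D. mat_inv R * D * (mat_inv R)\<^sup>T"])
    show "(\<lambda>D. R * D * R\<^sup>T) \<in> ?R b \<rightarrow> ?R (e1 (Suc k))"
      using iff sym Rc by auto
    show "(\<lambda>D. mat_inv R * D * (mat_inv R)\<^sup>T) \<in> ?R (e1 (Suc k)) \<rightarrow> ?R b"
    proof
      fix D assume D: "D \<in> ?R (e1 (Suc k))"
      then have Dc: "D \<in> carrier_mat (Suc k) (Suc k)" by simp
      then have c: "mat_inv R * D * (mat_inv R)\<^sup>T \<in> carrier_mat (Suc k) (Suc k)" by auto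
      show "mat_inv R * D * (mat_inv R)\<^sup>T \<in> ?R b"
        using D iff[OF c] inv2[OF Dc] c sym[OF _ Dc mat_inv(1)[OF R(1)]] by auto
    qed
  qed (use inv1 inv2 in auto)
  then have "card (?R b) = card (?R (e1 (Suc k)))" by (rule bij_betw_same_card)
  also have "?R (e1 (Suc k)) = (\<lambda>(d, f, D). four_block_mat (mat 1 1 (\<lambda>_. d)) f\<^sup>T f D) ` (UNIV \<times> carrier_mat k 1 \<times> sym_GL k)"
    (is "_ = ?g ` ?D")
  proof (intro equalityI subsetI)
    fix S assume S: "S \<in> ?R (e1 (Suc k))"
    then have "S \<in> carrier_mat (Suc k) (Suc k)" "S\<^sup>T = S" by auto
    from symmetric_border_exhaust[OF this] obtain a b D where c: "b \<in> carrier_mat k 1" "D \<in> carrier_mat k k" "D\<^sup>T = D"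
      and eq: "S = four_block_mat (mat 1 1 (\<lambda>_. a)) b\<^sup>T b D" .
    have "D \<in> GL k" using S four_block_zero_e1_GL_iff[OF c(1,2), of a] unfolding eq by simp
    with c eq show "S \<in> ?g ` ?D" by (intro image_eqI[of _ _ "(a, b, D)"]) (auto simp: sym_GL_def)
  next
    fix S assume "S \<in> ?g ` ?D"
    then obtain d f D where c: "f \<in> carrier_mat k 1" "D \<in> sym_GL k" and eq: "S = four_block_mat (mat 1 1 (\<lambda>_. d)) f\<^sup>T f D"
      by auto
    have D: "D \<in> carrier_mat k k" "D\<^sup>T = D" "D \<in> GL k" using c(2) by (auto simp: sym_GL_def GL_carrier)
    have "S \<in> carrier_mat (1 + k) (1 + k)" unfolding eq using D by (intro four_block_carrier_mat) auto
    then show "S \<in> ?R (e1 (Suc k))"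
      using four_block_zero_e1_GL_iff[OF c(1) D(1), of d] D symmetric_border[OF c(1) D(1,2), of d] unfolding eq by auto
  qed
  also have "card \<dots> = card ?D"
  proof (rule card_image, rule inj_onI, clarsimp)
    fix a b D a' b' D'
    assume c: "b \<in> carrier_mat k (Suc 0)" "D \<in> sym_GL k" "b' \<in> carrier_mat k (Suc 0)" "D' \<in> sym_GL k"
      and eq: "four_block_mat (mat (Suc 0) (Suc 0) (\<lambda>_. a :: 'a)) b\<^sup>T b D = four_block_mat (mat (Suc 0) (Suc 0) (\<lambda>_. a')) b'\<^sup>T b' D'"
    have "mat 1 1 (\<lambda>_. a) = mat 1 1 (\<lambda>_. a') \<and> b\<^sup>T = b'\<^sup>T \<and> b = b' \<and> D = D'"
      using eq c by (subst four_block_mat_inject[symmetric, of _ 1 1 _ _ k _ _ k]) (auto simp: sym_GL_carrier)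
    then show "a = a' \<and> b = b' \<and> D = D'" by (simp add: mat_single_inject)
  qed
  also have "\<dots> = CARD('a) ^ Suc k * card (sym_GL k :: 'a mat set)"
    by (simp add: card_cartesian_product card_carrier_mat)
  finally show ?thesis .
qed

lemma card_sym_GL_0: "card (sym_GL 0 :: 'a::field mat set) = 1"
proof -
  have "(sym_GL 0 :: 'a mat set) = {1\<^sub>m 0}" by (auto simp: sym_GL_def GL_iff_det intro!: eq_matI)
  then show ?thesis by simp
qed

lemma card_sym_GL_1: "card (sym_GL (Suc 0) :: 'a::{field,finite} mat set) = CARD('a) - 1"
proof -
  have "sym_GL (Suc 0) = (\<lambda>a. mat (Suc 0) (Suc 0) (\<lambda>_. a)) ` (UNIV - {0 :: 'a})"
  proof (intro equalityI subsetI)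
    fix S :: "'a mat" assume "S \<in> sym_GL (Suc 0)"
    then have S: "S \<in> carrier_mat 1 1" "det S \<noteq> 0" by (auto simp: sym_GL_def GL_iff_det)
    then have "S = mat (Suc 0) (Suc 0) (\<lambda>_. S $$ (0, 0))" by (intro eq_matI) auto
    with S show "S \<in> (\<lambda>a. mat (Suc 0) (Suc 0) (\<lambda>_. a)) ` (UNIV - {0})"
      by (intro image_eqI[of _ _ "S $$ (0, 0)"]) (auto simp: det_single)
  next
    fix S assume "S \<in> (\<lambda>a. mat (Suc 0) (Suc 0) (\<lambda>_. a)) ` (UNIV - {0 :: 'a})"
    then show "S \<in> sym_GL (Suc 0)"
      by (auto simp: sym_GL_def GL_iff_det det_single intro!: eq_matI)
  qed
  moreover have "inj_on (\<lambda>a. mat (Suc 0) (Suc 0) (\<lambda>_. a)) (UNIV - {0 :: 'a})"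
    by (auto simp: inj_on_def mat_single_inject)
  ultimately show ?thesis by (simp add: card_image card_Diff_singleton)
qed

text \<open>
  Split on the corner entry \<open>a\<close>: if \<open>a \<noteq> 0\<close> it can be eliminated by a Schur complement; if \<open>a = 0\<close>, the rest of the
  first column is nonzero and a congruence moves it to the first unit vector.
\<close>

lemma card_sym_GL_Suc_Suc:
  "card (sym_GL (Suc (Suc k)) :: 'a::{field,finite} mat set) =
    (CARD('a) - 1) * CARD('a) ^ Suc k * card (sym_GL (Suc k) :: 'a mat set) +
    (CARD('a) ^ Suc k - 1) * CARD('a) ^ Suc k * card (sym_GL k :: 'a mat set)"
proof -
  let ?N = "\<lambda>k. card (sym_GL k :: 'a mat set)"
  let ?X = "\<lambda>a (b :: 'a mat). card {D \<in> carrier_mat (Suc k) (Suc k). D\<^sup>T = D \<and>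
      four_block_mat (mat 1 1 (\<lambda>_. a)) b\<^sup>T b D \<in> GL (Suc (Suc k))}"
  have zero: "?X 0 (0\<^sub>m (Suc k) 1) = 0"
  proof -
    have "four_block_mat (mat 1 1 (\<lambda>_. 0 :: 'a)) (0\<^sub>m (Suc k) 1)\<^sup>T (0\<^sub>m (Suc k) 1) D \<notin> GL (Suc (Suc k))"
      if D: "D \<in> carrier_mat (Suc k) (Suc k)" for D
    proof -
      have "mat 1 1 (\<lambda>_. 0 :: 'a) = 0\<^sub>m 1 1" by (intro eq_matI) auto
      then have "det (four_block_mat (mat 1 1 (\<lambda>_. 0 :: 'a)) (0\<^sub>m (Suc k) 1)\<^sup>T (0\<^sub>m (Suc k) 1) D) = 0"
        by (subst det_four_block_mat_lower_left_zero[of _ 1 _ "Suc k"]) (use D in auto)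
      then show ?thesis by (simp add: GL_iff_det)
    qed
    then show ?thesis by auto
  qed
  have "?N (Suc (Suc k)) = (\<Sum>a\<in>UNIV. \<Sum>b\<in>carrier_mat (Suc k) 1. ?X a b)"
    by (rule card_symmetric_border)
  also have "\<dots> = (\<Sum>a\<in>UNIV - {0}. \<Sum>b\<in>carrier_mat (Suc k) 1. ?X a b) + (\<Sum>b\<in>carrier_mat (Suc k) 1. ?X 0 b)"
    by (subst sum.remove[of UNIV 0]) auto
  also have "(\<Sum>b\<in>carrier_mat (Suc k) 1. ?X 0 b) = (\<Sum>b\<in>carrier_mat (Suc k) 1 - {0\<^sub>m (Suc k) 1}. ?X 0 b)"
    using zero by (subst sum.remove[of _ "0\<^sub>m (Suc k) 1"]) auto
  also have "\<dots> = (\<Sum>b\<in>carrier_mat (Suc k) 1 - {0\<^sub>m (Suc k) 1 :: 'a mat}. CARD('a) ^ Suc k * ?N k)"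
    by (intro sum.cong refl card_sym_GL_zero_corner) auto
  also have "\<dots> = (CARD('a) ^ Suc k - 1) * CARD('a) ^ Suc k * ?N k"
    by (simp add: card_Diff_singleton card_carrier_mat mult.assoc)
  also have "(\<Sum>a\<in>UNIV - {0}. \<Sum>b\<in>carrier_mat (Suc k) 1. ?X a b) =
      (\<Sum>a\<in>UNIV - {0 :: 'a}. \<Sum>b\<in>(carrier_mat (Suc k) 1 :: 'a mat set). ?N (Suc k))"
    by (intro sum.cong refl card_sym_GL_nonzero_corner) auto
  also have "\<dots> = (CARD('a) - 1) * CARD('a) ^ Suc k * ?N (Suc k)"
    by (simp add: card_Diff_singleton card_carrier_mat mult.assoc)
  finally show ?thesis .
qed

lemma odd_prod_Suc: "odd_prod q (Suc k) = odd_prod q k * (real q ^ (2 * k + 1) - 1)"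
  by (simp add: odd_prod_def)

text \<open>The recursion reaches back two sizes, so both parities are carried through one
  induction. In each step the two terms share a factor, and the rest collapses by (x - 1) + 1 = x
  for even size and by (x - 1) x^(2k+2) + x^(2k+2) - 1 = x^(2k+3) - 1 for odd size.\<close>

lemma card_sym_GL:
  fixes k :: nat
  defines "q \<equiv> CARD('a::{field,finite})"
  shows "real (card (sym_GL (2 * k) :: 'a mat set)) = real q ^ (k * (k + 1)) * odd_prod q k \<and>
    real (card (sym_GL (2 * k + 1) :: 'a mat set)) = real q ^ (k * (k + 1)) * odd_prod q (k + 1)"
proof (induction k)
  have q: "q \<ge> 1" by (simp add: q_def Suc_leI)
  case 0
  show ?case using q by (simp add: card_sym_GL_0 card_sym_GL_1 odd_prod_def of_nat_diff flip: q_def)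
next
  have q: "q \<ge> 1" "q ^ j \<ge> 1" for j by (simp_all add: q_def Suc_leI)
  case (Suc k)
  let ?N = "\<lambda>k. real (card (sym_GL k :: 'a mat set))"
  have rec: "?N (Suc (Suc j)) = (real q - 1) * real q ^ Suc j * ?N (Suc j) + (real q ^ Suc j - 1) * real q ^ Suc j * ?N j" for j
    unfolding card_sym_GL_Suc_Suc q_def[symmetric] using q by (simp add: of_nat_diff)
  let ?x = "real q" and ?P = "odd_prod q k"
  have even: "?N (2 * Suc k) = ?x ^ (Suc k * (Suc k + 1)) * odd_prod q (Suc k)"
  proof -
    have "?N (2 * Suc k) = (?x - 1) * ?x ^ (2 * k + 1) * ?N (2 * k + 1) + (?x ^ (2 * k + 1) - 1) * ?x ^ (2 * k + 1) * ?N (2 * k)"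
      using rec[of "2 * k"] by simp
    also have "\<dots> = (?x * ?x ^ (2 * k + 1) * ?x ^ (k * (k + 1))) * odd_prod q (Suc k)"
      unfolding Suc[THEN conjunct1] Suc[THEN conjunct2] Suc_eq_plus1[symmetric, of k] odd_prod_Suc
      by (simp only: algebra_simps)
    also have "?x * ?x ^ (2 * k + 1) * ?x ^ (k * (k + 1)) = ?x ^ (1 + (2 * k + 1) + k * (k + 1))"
      by (simp only: power_add power_one_right)
    also have "1 + (2 * k + 1) + k * (k + 1) = Suc k * (Suc k + 1)" by simp
    finally show ?thesis .
  qed
  have "?N (2 * Suc k + 1) = (?x - 1) * ?x ^ (2 * k + 2) * ?N (2 * Suc k) + (?x ^ (2 * k + 2) - 1) * ?x ^ (2 * k + 2) * ?N (2 * k + 1)"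
    using rec[of "2 * k + 1"] by simp
  also have "(?x ^ (2 * k + 2) - 1) * ?x ^ (2 * k + 2) * ?N (2 * k + 1) =
      (?x ^ (2 * k + 2) - 1) * (?x ^ (2 * k + 2 + k * (k + 1)) * odd_prod q (Suc k))"
    unfolding Suc[THEN conjunct2] power_add[of _ "2 * k + 2" "k * (k + 1)"] by simp
  also have "2 * k + 2 + k * (k + 1) = Suc k * (Suc k + 1)" by simp
  finally have "?N (2 * Suc k + 1) = ?x ^ (Suc k * (Suc k + 1)) * odd_prod q (Suc k) * ((?x - 1) * ?x ^ (2 * k + 2) + (?x ^ (2 * k + 2) - 1))"
    unfolding even by (simp only: algebra_simps)
  also have "(?x - 1) * ?x ^ (2 * k + 2) + (?x ^ (2 * k + 2) - 1) = ?x ^ (2 * Suc k + 1) - 1"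
    by (simp add: algebra_simps)
  finally have "?N (2 * Suc k + 1) = ?x ^ (Suc k * (Suc k + 1)) * odd_prod q (Suc k + 1)"
    unfolding odd_prod_Suc[of q "Suc k"] Suc_eq_plus1[symmetric, of "Suc k"] by (simp only: mult.assoc)
  with even show ?case by simp
qed

section \<open>Character sums\<close>

text \<open>The substitution \<open>g\<close> multiplies the sum by \<open>z\<close>. This is
  orthogonality of characters, needed for scalars, for the matrices \<open>h\<close> and for
  alternating matrices.\<close>

lemma sum_eq_0_by_translation:
  fixes f :: "'b \<Rightarrow> complex"
  assumes "bij_betw g S S" "\<And>x. x \<in> S \<Longrightarrow> f (g x) = z * f x" "z \<noteq> 1"
  shows "(\<Sum>x\<in>S. f x) = 0"
proof -
  have "(\<Sum>x\<in>S. f x) = (\<Sum>x\<in>S. f (g x))" using sum.reindex_bij_betw[OF assms(1), of f] by simp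
  also have "\<dots> = z * (\<Sum>x\<in>S. f x)" using assms(2) by (simp add: sum_distrib_left)
  finally have "(1 - z) * (\<Sum>x\<in>S. f x) = 0" by (simp add: algebra_simps)
  with assms(3) show ?thesis by simp
qed

text \<open>Irreducibility of the quadratic polynomial is used in the form that it has no root,
  which makes the norm form anisotropic; the assumption that q is a power of 2 is used in the form 1
  + 1 = 0.\<close>

locale char2_character =
  fixes \<psi> :: "'a::{field,finite} \<Rightarrow> complex" and \<kappa> :: 'a and q :: nat
  assumes card_field [simp]: "CARD('a) = q"
    and char_two: "(1::'a) + 1 = 0"
    and no_root: "\<And>z. z\<^sup>2 + z + \<kappa> \<noteq> 0"
    and nontrivial: "nontrivial_additive_character \<psi>"
begin

lemma q_ge_2: "q \<ge> 2"
  using card_mono[of UNIV "{0, 1 :: 'a}"] by simp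

lemma add_self [simp]: "(x::'a) + x = 0"
proof -
  have "x + x = (1 + 1) * x" by (simp only: distrib_right mult_1_left)
  then show ?thesis unfolding char_two by simp
qed

lemma two_eq_0 [simp]: "(2::'a) = 0"
  using char_two by (simp only: one_add_one)

lemma add_self_left [simp]: "(x::'a) + (x + y) = y"
  by (simp flip: add.assoc)

lemma uminus_eq: "- (x::'a) = x"
  using add_self[of x] by (simp add: neg_eq_iff_add_eq_0)

lemma minus_eq: "(x::'a) - y = x + y"
  using uminus_eq[of y] by simp

lemma add_eq_0_iff_eq: "(x::'a) + y = 0 \<longleftrightarrow> x = y"
  using minus_eq[of x y] by (metis eq_iff_diff_eq_0)

lemma square_add: "((x::'a) + y)\<^sup>2 = x\<^sup>2 + y\<^sup>2"
  by (simp add: power2_sum)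

lemma bij_square: "bij (\<lambda>x::'a. x\<^sup>2)"
proof -
  have "inj (\<lambda>x::'a. x\<^sup>2)"
  proof (rule injI)
    fix x y :: 'a assume "x\<^sup>2 = y\<^sup>2"
    then have "(x + y)\<^sup>2 = 0" by (simp add: square_add)
    then show "x = y" by (simp add: add_eq_0_iff_eq)
  qed
  then show ?thesis using finite_UNIV_inj_surj[of "\<lambda>x::'a. x\<^sup>2"] by (simp add: bij_def)
qed

lemma psi_0 [simp]: "\<psi> 0 = 1"
  and psi_add: "\<psi> (x + y) = \<psi> x * \<psi> y"
  using nontrivial by (auto simp: nontrivial_additive_character_def additive_character_def)

lemma psi_square: "\<psi> x * \<psi> x = 1"
  by (simp flip: psi_add)

text \<open>Every element is its own negative, so characters are real valued; this makes the Gauss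
  sums integers.\<close>

lemma psi_cases: "\<psi> x = 1 \<or> \<psi> x = - 1"
  using psi_square[of x] by (simp add: square_eq_1_iff)

lemma exists_psi_mult_neq_1: "a \<noteq> 0 \<Longrightarrow> \<exists>x. \<psi> (a * x) \<noteq> 1"
proof -
  assume a: "a \<noteq> 0"
  obtain y where "\<psi> y \<noteq> 1" using nontrivial by (auto simp: nontrivial_additive_character_def)
  then have "\<psi> (a * (y / a)) \<noteq> 1" using a by simp
  then show ?thesis by blast
qed

lemma sum_psi_mult: "(\<Sum>x\<in>UNIV. \<psi> (a * x)) = (if a = 0 then of_nat q else 0)"
proof (cases "a = 0")
  case False
  then obtain c where "\<psi> (a * c) \<noteq> 1" using exists_psi_mult_neq_1 by blast
  then have "(\<Sum>x\<in>UNIV. \<psi> (a * x)) = 0"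
    by (intro sum_eq_0_by_translation[where g = "\<lambda>x. c + x" and z = "\<psi> (a * c)"])
      (auto simp: psi_add distrib_left bij_betw_def)
  with False show ?thesis by simp
qed simp

lemma sum_psi_nonzero: "a \<noteq> 0 \<Longrightarrow> (\<Sum>x\<in>UNIV - {0}. \<psi> (a * x)) = - 1"
  using sum_psi_mult[of a] by (subst (asm) sum.remove[of UNIV 0]) (auto simp: add_eq_0_iff)

section \<open>Level sets of the norm form\<close>

definition theta :: "'a \<times> 'a \<Rightarrow> 'a" where
  "theta = (\<lambda>(x, y). x\<^sup>2 + x * y + \<kappa> * y\<^sup>2)"

lemma theta_eq_0_iff: "theta d = 0 \<longleftrightarrow> d = (0, 0)"
proof -
  obtain x y where d: "d = (x, y)" by force
  have "x\<^sup>2 + x * y + \<kappa> * y\<^sup>2 = y\<^sup>2 * ((x / y)\<^sup>2 + x / y + \<kappa>)" if "y \<noteq> 0"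
    using that by (simp add: field_simps power2_eq_square)
  then show ?thesis using no_root[of "x / y"] by (cases "y = 0") (auto simp: d theta_def)
qed

lemma theta_scale: "theta (s * x, s * y) = s\<^sup>2 * theta (x, y)"
  by (simp add: theta_def algebra_simps power2_eq_square)

text \<open>Every scalar is a square, so scaling identifies all nonzero level sets. They share the
  q^2 - 1 nonzero pairs equally, and (q^2 - 1) / (q - 1) = q + 1.\<close>

lemma card_theta_eq:
  assumes "c \<noteq> 0"
  shows "card {d. theta d = c} = q + 1"
proof -
  have scale: "card {d. theta d = c} = card {d. theta d = 1}" if c: "c \<noteq> 0" for c
  proof -
    obtain s where s: "c = s\<^sup>2" using bij_square by (metis bij_pointE)
    with c have "s \<noteq> 0" by auto
    have "bij_betw (\<lambda>(x, y). (s * x, s * y)) {d. theta d = 1} {d. theta d = c}"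
      by (rule bij_betwI[where g = "\<lambda>(x, y). (inverse s * x, inverse s * y)"])
        (use \<open>s \<noteq> 0\<close> in \<open>auto simp: theta_scale s power_inverse simp flip: mult.assoc\<close>)
    from bij_betw_same_card[OF this] show ?thesis by simp
  qed
  let ?N = "card {d. theta d = 1}"
  have "card (UNIV :: ('a \<times> 'a) set) = (\<Sum>d\<in>(UNIV :: ('a \<times> 'a) set). 1)" by simp
  also have "\<dots> = (\<Sum>c\<in>UNIV. \<Sum>d\<in>{d \<in> UNIV. theta d = c}. 1)"
    by (rule sum.group[symmetric]) auto
  also have "\<dots> = (\<Sum>c\<in>UNIV. card {d. theta d = c})" by simp
  also have "\<dots> = card {d. theta d = 0} + (\<Sum>c\<in>UNIV - {0}. card {d. theta d = c})"
    by (subst sum.remove[of UNIV 0]) auto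
  also have "(\<Sum>c\<in>UNIV - {0}. card {d. theta d = c}) = (\<Sum>c\<in>UNIV - {0 :: 'a}. ?N)"
    by (intro sum.cong refl scale) auto
  also have "\<dots> = (q - 1) * ?N" by (simp add: card_Diff_singleton)
  also have "card {d. theta d = 0} = 1" by (simp add: theta_eq_0_iff)
  finally have eq: "q * q = 1 + (q - 1) * ?N" by (simp add: card_prod)
  \<comment> \<open>Writing q as p + 2 avoids truncated subtraction: q^2 - 1 becomes (p + 1) (p +
    3).\<close>
  from q_ge_2 obtain p where p: "q = p + 2" by (metis add.commute le_Suc_ex)
  from eq have "(p + 1) * ?N = (p + 1) * (p + 3)" unfolding p by (simp add: algebra_simps)
  then have "?N = q + 1" unfolding p by (subst (asm) mult_cancel1) auto
  with scale[OF assms] show ?thesis by metis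
qed

text \<open>Sorting by the value of \<open>theta\<close>: the value 0 occurs once and every other
  value q + 1 times, which gives 1 - (q + 1).\<close>

lemma sum_psi_theta:
  assumes "t \<noteq> 0"
  shows "(\<Sum>d\<in>UNIV. \<psi> (t * theta d)) = - of_nat q"
proof -
  have "(\<Sum>d\<in>UNIV. \<psi> (t * theta d)) = (\<Sum>c\<in>UNIV. \<Sum>d\<in>{d \<in> UNIV. theta d = c}. \<psi> (t * theta d))"
    by (rule sum.group[symmetric]) auto
  also have "\<dots> = (\<Sum>c\<in>UNIV. of_nat (card {d. theta d = c}) * \<psi> (t * c))"
    by (intro sum.cong) auto
  also have "\<dots> = 1 + (\<Sum>c\<in>UNIV - {0}. of_nat (card {d. theta d = c}) * \<psi> (t * c))"
    by (subst sum.remove[of UNIV 0]) (auto simp: theta_eq_0_iff)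
  also have "(\<Sum>c\<in>UNIV - {0}. of_nat (card {d. theta d = c}) * \<psi> (t * c)) =
      (\<Sum>c\<in>UNIV - {0}. of_nat (q + 1) * \<psi> (t * c))"
    by (intro sum.cong) (auto simp: card_theta_eq)
  also have "\<dots> = - of_nat (q + 1)"
    using sum_psi_nonzero[OF assms] by (simp flip: sum_distrib_left)
  finally show ?thesis by simp
qed

text \<open>
  The condition \<open>theta d = 1\<close> is detected by summing \<open>\<psi> (t * (theta d + 1))\<close> over \<open>t\<close>; for \<open>t \<noteq> 0\<close> the linear term
  is absorbed by the shift \<open>x \<mapsto> x + 1/t\<close>.
\<close>

lemma sum_psi_norm_one: "(\<Sum>(x, y)\<in>{d. theta d = 1}. \<psi> y) = - kloosterman \<psi> 1"
proof -
  have inner: "(\<Sum>d\<in>UNIV. \<psi> (snd d + t * theta d)) = (if t = 0 then 0 else - of_nat q * \<psi> (inverse t))" for t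
  proof (cases "t = 0")
    case True
    have "(\<Sum>d\<in>(UNIV :: ('a \<times> 'a) set). \<psi> (snd d)) = (\<Sum>x\<in>(UNIV::'a set). \<Sum>y\<in>UNIV. \<psi> y)"
      by (subst sum.cartesian_product) (simp add: case_prod_beta)
    with True show ?thesis using sum_psi_mult[of 1] by simp
  next
    case False
    have "(\<Sum>d\<in>UNIV. \<psi> (snd d + t * theta d)) = (\<Sum>d\<in>UNIV. \<psi> (inverse t) * \<psi> (t * theta (fst d + inverse t, snd d)))"
    proof (intro sum.cong refl)
      fix d :: "'a \<times> 'a"
      obtain x y where d: "d = (x, y)" by force
      have "t * theta (x + inverse t, y) = (y + t * theta (x, y)) + inverse t"
        using False by (simp add: theta_def square_add field_simps power2_eq_square)
      then show "\<psi> (snd d + t * theta d) = \<psi> (inverse t) * \<psi> (t * theta (fst d + inverse t, snd d))"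
        unfolding d by (simp add: psi_add psi_square)
    qed
    also have "\<dots> = \<psi> (inverse t) * (\<Sum>d\<in>UNIV. \<psi> (t * theta (fst d + inverse t, snd d)))"
      by (simp add: sum_distrib_left)
    also have "(\<Sum>d\<in>UNIV. \<psi> (t * theta (fst d + inverse t, snd d))) = (\<Sum>d\<in>UNIV. \<psi> (t * theta d))"
      by (rule sum.reindex_bij_witness[where i = "\<lambda>d. (fst d + inverse t, snd d)" and j = "\<lambda>d. (fst d + inverse t, snd d)"])
        (auto simp: add.assoc)
    also have "\<dots> = - of_nat q" using False by (rule sum_psi_theta)
    finally show ?thesis using False by simp
  qed
  have "of_nat q * (\<Sum>(x, y)\<in>{d. theta d = 1}. \<psi> y) = (\<Sum>d\<in>UNIV. \<psi> (snd d) * (if theta d + 1 = 0 then of_nat q else 0))"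
    by (simp add: add_eq_0_iff_eq sum_distrib_left case_prod_beta sum.If_cases mult.commute if_distrib[of "(*) _"] cong: if_cong)
  also have "\<dots> = (\<Sum>d\<in>UNIV. \<Sum>t\<in>UNIV. \<psi> (snd d) * \<psi> ((theta d + 1) * t))"
    by (simp add: sum_psi_mult flip: sum_distrib_left)
  also have "\<dots> = (\<Sum>t\<in>UNIV. \<psi> t * (\<Sum>d\<in>UNIV. \<psi> (snd d + t * theta d)))"
    by (subst sum.swap) (simp add: sum_distrib_left psi_add distrib_left distrib_right mult_ac)
  also have "\<dots> = (\<Sum>t\<in>UNIV - {0}. \<psi> t * (- of_nat q * \<psi> (inverse t)))"
    unfolding inner by (subst sum.remove[of UNIV 0]) auto
  also have "\<dots> = of_nat q * (- kloosterman \<psi> 1)"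
    unfolding kloosterman_def by (simp add: psi_add sum_distrib_left sum_negf mult_ac)
  finally show ?thesis using q_ge_2 by (subst (asm) mult_left_cancel) auto
qed

text \<open>
  \<open>so2 (x, y)\<close> is multiplication by \<open>x + y \<omega>\<close> on the quadratic extension, where \<open>\<omega>\<^sup>2 = \<omega> + \<kappa>\<close>, and \<open>theta\<close> is the norm.
\<close>

definition so2 :: "'a \<times> 'a \<Rightarrow> 'a mat" where
  "so2 = (\<lambda>(x, y). mat_of_rows_list 2 [[x, \<kappa> * y], [y, x + y]])"

lemma so2_carrier [simp]: "so2 d \<in> carrier_mat 2 2"
  by (cases d) (auto simp: so2_def mat_of_rows_list_def numeral_2_eq_2)

lemma so2_index:
  "so2 d $$ (0, 0) = fst d" "so2 d $$ (0, Suc 0) = \<kappa> * snd d"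
  "so2 d $$ (Suc 0, 0) = snd d" "so2 d $$ (Suc 0, Suc 0) = fst d + snd d"
  by (cases d; simp add: so2_def mat_of_rows_list_def)+

lemma SO_minus_2_eq: "SO_minus_2 \<kappa> = so2 ` {d. theta d = 1}"
  by (auto simp: SO_minus_2_def so2_def theta_def image_def)

lemma inj_so2: "inj so2"
proof (rule injI)
  fix d e assume "so2 d = so2 e"
  then have "so2 d $$ (0, 0) = so2 e $$ (0, 0)" "so2 d $$ (1, 0) = so2 e $$ (1, 0)" by simp_all
  then show "d = e" by (simp add: so2_index prod_eq_iff)
qed

lemma sum_SO_minus_2: "(\<Sum>i\<in>SO_minus_2 \<kappa>. f i) = (\<Sum>d\<in>{d. theta d = 1}. f (so2 d))"
  unfolding SO_minus_2_eq using inj_so2 by (subst sum.reindex) (auto intro: inj_on_subset)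

lemma card_SO_minus_2: "card (SO_minus_2 \<kappa>) = q + 1"
  unfolding SO_minus_2_eq using inj_so2 card_theta_eq[of 1] by (subst card_image) (auto intro: inj_on_subset)

text \<open>In characteristic 2 the trace x + (x + y) of \<open>so2 (x, y)\<close> is y.\<close>

lemma sum_psi_trace_SO_minus_2: "(\<Sum>i\<in>SO_minus_2 \<kappa>. \<psi> (mat_trace i)) = - kloosterman \<psi> 1"
proof -
  have "mat_trace (so2 d) = snd d" for d
    using carrier_matD[OF so2_carrier[of d]]
    by (simp add: mat_trace_def numeral_2_eq_2 so2_index)
  then show ?thesis using sum_psi_norm_one by (simp add: sum_SO_minus_2 case_prod_beta)
qed

section \<open>Kloosterman sums over GL(0), GL(1) and GL(2)\<close>

lemma kloosterman_GL_0: "kloosterman_GL 0 \<psi> 1 = 1"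
proof -
  have G: "(GL 0 :: 'a mat set) = {1\<^sub>m 0}" by (auto simp: GL_iff_det intro!: eq_matI)
  have "mat_inv (1\<^sub>m 0) = (1\<^sub>m 0 :: 'a mat)" by (rule mat_inv_unique[of _ 0]) auto
  then show ?thesis by (simp add: kloosterman_GL_def G mat_trace_def)
qed

lemma kloosterman_GL_1: "kloosterman_GL 1 \<psi> 1 = kloosterman \<psi> 1"
proof -
  have G: "(GL 1 :: 'a mat set) = (\<lambda>a. mat 1 1 (\<lambda>_. a)) ` (UNIV - {0})"
  proof (intro equalityI subsetI)
    fix A :: "'a mat" assume "A \<in> GL 1"
    then have A: "A \<in> carrier_mat 1 1" "det A \<noteq> 0" by (auto simp: GL_iff_det)
    then have "A = mat 1 1 (\<lambda>_. A $$ (0, 0))" by (intro eq_matI) auto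
    with A show "A \<in> (\<lambda>a. mat 1 1 (\<lambda>_. a)) ` (UNIV - {0})"
      by (intro image_eqI[of _ _ "A $$ (0, 0)"]) (auto simp: det_single)
  qed (auto simp: GL_iff_det det_single)
  have inv: "mat_inv (mat 1 1 (\<lambda>_. a)) = mat 1 1 (\<lambda>_. inverse a)" if "a \<noteq> 0" for a :: 'a
    using that by (intro mat_inv_unique[of _ 1]) (auto intro!: eq_matI simp: scalar_prod_def)
  show ?thesis
    unfolding kloosterman_GL_def kloosterman_def G
    by (subst sum.reindex) (auto simp: inj_on_def mat_single_inject inv[simplified] mat_trace_def intro!: sum.cong)
qed

text \<open>The trace of the inverse is the trace divided by the determinant, so the summand depends
  on these two invariants only. With K for \<open>kloosterman \<psi> 1\<close>, the matrices with
  lower left entry c = 0 contribute q K^2, and each of the q - 1 nonzero values of c contributes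
  q^2.\<close>

lemma kloosterman_GL_2: "kloosterman_GL 2 \<psi> 1 = of_nat q * (kloosterman \<psi> 1)\<^sup>2 + of_nat q ^ 3 - of_nat q ^ 2"
proof -
  define M :: "'a \<times> 'a \<times> 'a \<times> 'a \<Rightarrow> 'a mat" where
    "M = (\<lambda>(a, b, c, d). four_block_mat (mat 1 1 (\<lambda>_. a)) (mat 1 1 (\<lambda>_. b)) (mat 1 1 (\<lambda>_. c)) (mat 1 1 (\<lambda>_. d)))"
  have Mc: "M x \<in> carrier_mat 2 2" for x by (cases x) (auto simp: M_def numeral_2_eq_2)
  have M_mat: "M (a, b, c, d) = mat 2 2 (\<lambda>(i, j). if i = 0 then (if j = 0 then a else b) else (if j = 0 then c else d))" for a b c d
    unfolding M_def by (auto intro!: eq_matI)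
  have det: "det (M (a, b, c, d)) = a * d + b * c" for a b c d
  proof -
    have "det (M (a, b, c, d)) = det (mat 1 1 (\<lambda>_. a) * mat 1 1 (\<lambda>_. d) - mat 1 1 (\<lambda>_. b) * mat 1 1 (\<lambda>_. c))"
      unfolding M_def prod.case by (rule det_four_block_mat[of _ 1]) (auto intro!: eq_matI simp: scalar_prod_def)
    also have "\<dots> = a * d + b * c" by (subst det_single) (auto simp: scalar_prod_def minus_eq)
    finally show ?thesis .
  qed
  let ?D = "{(a, b, c, d). a * d + b * c \<noteq> (0 :: 'a)}"
  have GL: "GL 2 = M ` ?D"
  proof (intro equalityI subsetI)
    fix A :: "'a mat" assume A: "A \<in> GL 2"
    have "A = M (A $$ (0, 0), A $$ (0, 1), A $$ (1, 0), A $$ (1, 1))"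
      unfolding M_mat using GL_carrier[OF A] by (auto intro!: eq_matI simp: less_2_cases_iff)
    with A det show "A \<in> M ` ?D"
      by (intro image_eqI[of _ _ "(A $$ (0, 0), A $$ (0, 1), A $$ (1, 0), A $$ (1, 1))"]) (auto simp: GL_iff_det, metis)
  qed (use Mc det in \<open>auto simp: GL_iff_det\<close>)
  have injM: "inj M"
  proof (rule injI)
    fix x y assume eq: "M x = M y"
    obtain a b c d a' b' c' d' where xy: "x = (a, b, c, d)" "y = (a', b', c', d')" by (cases x, cases y)
    from eq have "M x $$ (i, j) = M y $$ (i, j)" for i j by simp
    from this[of 0 0] this[of 0 1] this[of 1 0] this[of 1 1] show "x = y" unfolding xy M_mat by simp
  qed
  have tr: "mat_trace (M (a, b, c, d)) = a + d" for a b c d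
    unfolding M_mat mat_trace_def by (simp add: numeral_2_eq_2)
  have inv: "mat_inv (M (a, b, c, d)) = M (d / (a * d + b * c), b / (a * d + b * c), c / (a * d + b * c), a / (a * d + b * c))"
    if "a * d + b * c \<noteq> 0" for a b c d
  proof (rule mat_inv_unique[OF Mc Mc])
    have "a * d / (a * d + b * c) + b * c / (a * d + b * c) = 1" using that by (simp flip: add_divide_distrib)
    then show "M (a, b, c, d) * M (d / (a * d + b * c), b / (a * d + b * c), c / (a * d + b * c), a / (a * d + b * c)) = 1\<^sub>m 2"
      unfolding M_mat by (auto intro!: eq_matI simp: scalar_prod_def numeral_2_eq_2 less_Suc_eq mult_ac add.commute)
  qed
  let ?g = "\<lambda>a b c d. \<psi> ((a + d) * (1 + inverse (a * d + b * c)))"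
  have "kloosterman_GL 2 \<psi> 1 = (\<Sum>x\<in>?D. \<psi> (mat_trace (M x) + mat_trace (mat_inv (M x))))"
    unfolding kloosterman_GL_def GL using injM by (subst sum.reindex) (auto intro: inj_on_subset)
  also have "\<dots> = (\<Sum>(a, b, c, d)\<in>?D. ?g a b c d)"
    by (intro sum.cong refl) (auto simp: tr inv algebra_simps divide_inverse)
  also have "\<dots> = (\<Sum>(a, b, c, d)\<in>UNIV. if a * d + b * c \<noteq> 0 then ?g a b c d else 0)"
    by (rule sum.mono_neutral_cong_left) auto
  also have "\<dots> = (\<Sum>(c, d, a, b)\<in>UNIV. if a * d + b * c \<noteq> 0 then ?g a b c d else 0)"
    by (rule sum.reindex_bij_witness[where i = "\<lambda>(c, d, a, b). (a, b, c, d)" and j = "\<lambda>(a, b, c, d). (c, d, a, b)"]) auto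
  also have "\<dots> = (\<Sum>c\<in>UNIV. \<Sum>d\<in>UNIV. \<Sum>a\<in>UNIV. \<Sum>b\<in>UNIV. if a * d + b * c \<noteq> 0 then ?g a b c d else 0)"
    (is "_ = (\<Sum>c\<in>UNIV. ?h c)")
    by (simp add: sum.cartesian_product)
  also have "\<dots> = ?h 0 + (\<Sum>c\<in>UNIV - {0}. ?h c)" by (subst sum.remove[of UNIV 0]) auto
  also have "?h 0 = of_nat q * (kloosterman \<psi> 1)\<^sup>2"
  proof -
    \<comment> \<open>For c = 0 the argument (a + d) (1 + 1/(a d)) splits into a + 1/a and d + 1/d,
      and \<open>b\<close> is free.\<close>
    have "?h 0 = (\<Sum>d\<in>UNIV. \<Sum>a\<in>UNIV. if d \<noteq> 0 then (if a \<noteq> 0 then of_nat q * (\<psi> (d + inverse d) * \<psi> (a + inverse a)) else 0) else 0)"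
      by (intro sum.cong refl) (auto simp: psi_add[symmetric] field_simps)
    also have "\<dots> = (\<Sum>d\<in>UNIV - {0}. \<Sum>a\<in>UNIV - {0}. of_nat q * (\<psi> (d + inverse d) * \<psi> (a + inverse a)))"
      by (subst sum.remove[of UNIV 0], simp, simp, subst sum.remove[of UNIV 0]) (auto intro!: sum.cong)
    also have "\<dots> = of_nat q * (kloosterman \<psi> 1)\<^sup>2"
      unfolding kloosterman_def power2_eq_square sum_product by (simp add: sum_distrib_left)
    finally show ?thesis .
  qed
  also have "(\<Sum>c\<in>UNIV - {0}. ?h c) = (\<Sum>c\<in>UNIV - {0 :: 'a}. of_nat q * of_nat q)"
  proof (intro sum.cong refl)
    fix c :: 'a assume c: "c \<in> UNIV - {0}"
    \<comment> \<open>For nonzero \<open>c\<close> the entry \<open>b\<close> can be traded for the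
      determinant \<open>e\<close>.\<close>
    have "(\<Sum>b\<in>UNIV. if a * d + b * c \<noteq> 0 then ?g a b c d else 0) = (\<Sum>e\<in>UNIV - {0}. \<psi> ((a + d) * (1 + inverse e)))" for a d
    proof -
      have "(\<Sum>b\<in>UNIV. if a * d + b * c \<noteq> 0 then ?g a b c d else 0) =
          (\<Sum>e\<in>UNIV. if e \<noteq> 0 then \<psi> ((a + d) * (1 + inverse e)) else 0)"
        by (rule sum.reindex_bij_witness[where i = "\<lambda>e. (e + a * d) / c" and j = "\<lambda>b. a * d + b * c"])
          (use c in \<open>auto simp: add_ac\<close>)
      also have "\<dots> = (\<Sum>e\<in>UNIV - {0}. \<psi> ((a + d) * (1 + inverse e)))"
        by (subst sum.remove[of UNIV 0]) auto
      finally show ?thesis .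
    qed
    then have "?h c = (\<Sum>d\<in>UNIV. \<Sum>a\<in>UNIV. \<Sum>e\<in>UNIV - {0}. \<psi> ((a + d) * (1 + inverse e)))" by simp
    \<comment> \<open>The sum over \<open>a\<close> kills every \<open>e\<close> except 1, the zero
      of 1 + 1/e.\<close>
    also have "\<dots> = (\<Sum>d\<in>(UNIV :: 'a set). \<Sum>e\<in>UNIV - {0 :: 'a}. if e = 1 then of_nat q else 0)"
    proof (rule sum.cong[OF refl], subst sum.swap, intro sum.cong refl)
      fix d e :: 'a assume e: "e \<in> UNIV - {0}"
      have "(\<Sum>a\<in>UNIV. \<psi> ((a + d) * (1 + inverse e))) = (\<Sum>a\<in>UNIV. \<psi> ((1 + inverse e) * a))"
        by (rule sum.reindex_bij_witness[where i = "\<lambda>a. a + d" and j = "\<lambda>a. a + d"])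
          (auto simp: add.assoc mult.commute)
      also have "\<dots> = (if e = 1 then of_nat q else 0)"
        unfolding sum_psi_mult add_eq_0_iff_eq using e by auto
      finally show "(\<Sum>a\<in>UNIV. \<psi> ((a + d) * (1 + inverse e))) = (if e = 1 then of_nat q else 0)" .
    qed
    also have "\<dots> = of_nat q * of_nat q" by simp
    finally show "?h c = of_nat q * of_nat q" .
  qed
  also have "\<dots> = of_nat q ^ 3 - of_nat q ^ 2"
  proof -
    have "q \<ge> 1" using q_ge_2 by simp
    then show ?thesis by (simp add: card_Diff_singleton of_nat_diff algebra_simps power2_eq_square power3_eq_cube)
  qed
  finally show ?thesis by simp
qed

end

section \<open>Block matrices and the quadratic form\<close>

text \<open>Sizes have to keep the form \<open>2 * m + 2\<close>, in which the block boundaries are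
  visible, instead of turning into successors.\<close>

declare add_2_eq_Suc [simp del] add_2_eq_Suc' [simp del]

text \<open>The arguments are row offset and height, then column offset and width. Matrices of size
  \<open>2 * m + 2\<close> are handled through their nine blocks at offsets 0, m and 2m, which
  avoids nested \<open>four_block_mat\<close> terms in products.\<close>

definition blk :: "'a mat \<Rightarrow> nat \<Rightarrow> nat \<Rightarrow> nat \<Rightarrow> nat \<Rightarrow> 'a mat" where
  "blk g i r j c = mat r c (\<lambda>(k, l). g $$ (i + k, j + l))"

lemma blk_carrier [simp]: "blk g i r j c \<in> carrier_mat r c"
  and blk_dim [simp]: "dim_row (blk g i r j c) = r" "dim_col (blk g i r j c) = c"
  and blk_index [simp]: "k < r \<Longrightarrow> l < c \<Longrightarrow> blk g i r j c $$ (k, l) = g $$ (i + k, j + l)"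
  by (auto simp: blk_def)

lemma blk_add:
  assumes "A \<in> carrier_mat n p" "B \<in> carrier_mat n p" "i + r \<le> n" "j + c \<le> p"
  shows "blk (A + B) i r j c = blk A i r j c + blk B i r j c"
  using assms by (intro eq_matI) auto

lemma blk_transpose:
  assumes "A \<in> carrier_mat n p" "i + r \<le> p" "j + c \<le> n"
  shows "blk A\<^sup>T i r j c = (blk A j c i r)\<^sup>T"
  using assms by (intro eq_matI) auto

lemma sum_lessThan_add: "(\<Sum>k<a + b. f k) = (\<Sum>k<a. f k) + (\<Sum>k<b. f (a + k :: nat) :: 'b::comm_monoid_add)"
  by (induction b) (auto simp: add.assoc)

lemma blk_mult_index:
  fixes A :: "'a::semiring_0 mat"
  assumes "x < r" "y < c"
  shows "(blk A i r j k * blk B j k p c) $$ (x, y) = (\<Sum>l<k. A $$ (i + x, j + l) * B $$ (j + l, p + y))"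
  using mult_mat_index[OF blk_carrier blk_carrier assms, of A i j k B j p] assms by (auto intro!: sum.cong)

lemma blk_mult2:
  fixes A :: "'a::semiring_0 mat"
  assumes "A \<in> carrier_mat n (s + t)" "B \<in> carrier_mat (s + t) p" "i + r \<le> n" "j + c \<le> p"
  shows "blk (A * B) i r j c = blk A i r 0 s * blk B 0 s j c + blk A i r s t * blk B s t j c"
  using assms
  by (intro eq_matI)
    (auto simp: mult_mat_index[OF assms(1,2)] blk_mult_index sum_lessThan_add simp del: index_mult_mat(1))

lemma blk_mult3_gen:
  fixes A :: "'a::semiring_0 mat"
  assumes "A \<in> carrier_mat n (a + b + d)" "B \<in> carrier_mat (a + b + d) p" "i + r \<le> n" "j + c \<le> p"
  shows "blk (A * B) i r j c = blk A i r 0 a * blk B 0 a j c + blk A i r a b * blk B a b j c +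
    blk A i r (a + b) d * blk B (a + b) d j c"
  using assms
  by (intro eq_matI)
    (auto simp: mult_mat_index[OF assms(1,2)] blk_mult_index sum_lessThan_add simp del: index_mult_mat(1))

lemma blk_mult3:
  fixes A :: "'a::semiring_0 mat"
  assumes "A \<in> carrier_mat n (2 * m + 2)" "B \<in> carrier_mat (2 * m + 2) p" "i + r \<le> n" "j + c \<le> p"
  shows "blk (A * B) i r j c = blk A i r 0 m * blk B 0 m j c + blk A i r m m * blk B m m j c +
    blk A i r (2 * m) 2 * blk B (2 * m) 2 j c"
  using assms unfolding mult_2 by (rule blk_mult3_gen)

lemma blk_ext:
  assumes "A \<in> carrier_mat (2 * m + 2) (2 * m + 2)" "B \<in> carrier_mat (2 * m + 2) (2 * m + 2)"
    "\<And>i r j c. (i, r) \<in> {(0, m), (m, m), (2 * m, 2)} \<Longrightarrow> (j, c) \<in> {(0, m), (m, m), (2 * m, 2)} \<Longrightarrow>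
      blk A i r j c = blk B i r j c"
  shows "A = B"
proof (rule eq_matI)
  fix x y assume xy: "x < dim_row B" "y < dim_col B"
  have ex: "\<exists>i r k. (i, r) \<in> {(0, m), (m, m), (2 * m, 2)} \<and> x = i + k \<and> k < r" if "x < 2 * m + 2" for x
  proof -
    consider "x < m" | "m \<le> x" "x < 2 * m" | "2 * m \<le> x" by linarith
    then show ?thesis
    proof cases
      case 1 then show ?thesis by (intro exI[of _ 0] exI[of _ m] exI[of _ x]) auto
    next
      case 2 then show ?thesis by (intro exI[of _ m] exI[of _ m] exI[of _ "x - m"]) auto
    next
      case 3 with that show ?thesis by (intro exI[of _ "2 * m"] exI[of _ 2] exI[of _ "x - (2 * m)"]) auto
    qed
  qed
  obtain i r k where 1: "(i, r) \<in> {(0, m), (m, m), (2 * m, 2)}" "x = i + k" "k < r" using ex[of x] xy assms by auto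
  obtain j c l where 2: "(j, c) \<in> {(0, m), (m, m), (2 * m, 2)}" "y = j + l" "l < c" using ex[of y] xy assms by auto
  have "blk A i r j c $$ (k, l) = blk B i r j c $$ (k, l)" using assms(3)[OF 1(1) 2(1)] by simp
  with 1 2 show "A $$ (x, y) = B $$ (x, y)" by simp
qed (use assms in auto)

context
  fixes A11 A12 A13 A21 A22 A23 A31 A32 A33 :: "'a::zero mat" and m :: nat
  assumes c: "A11 \<in> carrier_mat m m" "A12 \<in> carrier_mat m m" "A13 \<in> carrier_mat m 2"
    "A21 \<in> carrier_mat m m" "A22 \<in> carrier_mat m m" "A23 \<in> carrier_mat m 2"
    "A31 \<in> carrier_mat 2 m" "A32 \<in> carrier_mat 2 m" "A33 \<in> carrier_mat 2 2"
begin

lemma nine_block_carrier: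
  "nine_block_mat A11 A12 A13 A21 A22 A23 A31 A32 A33 \<in> carrier_mat (2 * m + 2) (2 * m + 2)"
  using c unfolding nine_block_mat_def mult_2 by (intro four_block_carrier_mat) auto

lemma blk_nine_block:
  "blk (nine_block_mat A11 A12 A13 A21 A22 A23 A31 A32 A33) 0 m 0 m = A11"
  "blk (nine_block_mat A11 A12 A13 A21 A22 A23 A31 A32 A33) 0 m m m = A12"
  "blk (nine_block_mat A11 A12 A13 A21 A22 A23 A31 A32 A33) 0 m (2 * m) 2 = A13"
  "blk (nine_block_mat A11 A12 A13 A21 A22 A23 A31 A32 A33) m m 0 m = A21"
  "blk (nine_block_mat A11 A12 A13 A21 A22 A23 A31 A32 A33) m m m m = A22"
  "blk (nine_block_mat A11 A12 A13 A21 A22 A23 A31 A32 A33) m m (2 * m) 2 = A23"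
  "blk (nine_block_mat A11 A12 A13 A21 A22 A23 A31 A32 A33) (2 * m) 2 0 m = A31"
  "blk (nine_block_mat A11 A12 A13 A21 A22 A23 A31 A32 A33) (2 * m) 2 m m = A32"
  "blk (nine_block_mat A11 A12 A13 A21 A22 A23 A31 A32 A33) (2 * m) 2 (2 * m) 2 = A33"
  using c unfolding nine_block_mat_def append_rows_def append_cols_def mult_2
  by (auto intro!: eq_matI)

end

lemma delta_mat_carrier [simp]: "delta_mat \<kappa> \<in> carrier_mat 2 2"
  and eta_mat_carrier [simp]: "eta_mat \<in> carrier_mat 2 2"
  by (auto simp: delta_mat_def eta_mat_def mat_of_rows_list_def numeral_2_eq_2)

lemma delta_mat_dim [simp]: "dim_row (delta_mat \<kappa>) = 2" "dim_col (delta_mat \<kappa>) = 2"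
  and eta_mat_dim [simp]: "dim_row eta_mat = 2" "dim_col eta_mat = 2"
  by (auto simp: delta_mat_def eta_mat_def mat_of_rows_list_def numeral_2_eq_2)

lemma delta_mat_index: "delta_mat \<kappa> $$ (0, 0) = 1" "delta_mat \<kappa> $$ (0, Suc 0) = 1"
    "delta_mat \<kappa> $$ (Suc 0, 0) = 0" "delta_mat \<kappa> $$ (Suc 0, Suc 0) = \<kappa>"
  and eta_mat_index: "eta_mat $$ (0, 0) = 0" "eta_mat $$ (0, Suc 0) = 1"
    "eta_mat $$ (Suc 0, 0) = 1" "eta_mat $$ (Suc 0, Suc 0) = 0"
  by (auto simp: delta_mat_def eta_mat_def mat_of_rows_list_def)

lemma alternating_mat_iff:
  assumes "A \<in> carrier_mat n n"
  shows "alternating_mat A \<longleftrightarrow> (\<forall>i<n. \<forall>j<n. A $$ (i, j) = A $$ (j, i)) \<and> (\<forall>i<n. A $$ (i, i) = 0)"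
proof -
  have "A\<^sup>T = A \<longleftrightarrow> (\<forall>i<n. \<forall>j<n. A $$ (i, j) = A $$ (j, i))"
  proof
    assume "A\<^sup>T = A"
    then show "\<forall>i<n. \<forall>j<n. A $$ (i, j) = A $$ (j, i)"
      using assms by (metis carrier_matD index_transpose_mat(1))
  qed (use assms in \<open>auto intro!: eq_matI\<close>)
  then show ?thesis using assms by (auto simp: alternating_mat_def)
qed

lemma alternating_mat_add:
  assumes "A \<in> carrier_mat n n" "B \<in> carrier_mat n n" "alternating_mat A" "alternating_mat (B :: 'a::comm_monoid_add mat)"
  shows "alternating_mat (A + B)"
  using assms by (auto simp: alternating_mat_iff[of _ n])

context char2_character
begin

text \<open>Entries off the diagonal come in equal pairs, and x + x = 0. Invariance of alternating
  matrices under congruence and the trivial case of \<open>sum_psi_Alt\<close> both rest on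
  this.\<close>

lemma sum_symmetric_zero_diagonal:
  fixes f :: "nat \<Rightarrow> nat \<Rightarrow> 'a"
  assumes "\<And>i j. i < n \<Longrightarrow> j < n \<Longrightarrow> f i j = f j i" "\<And>i. i < n \<Longrightarrow> f i i = 0"
  shows "(\<Sum>i<n. \<Sum>j<n. f i j) = 0"
  using assms
proof (induction n)
  case (Suc n)
  have "(\<Sum>i<Suc n. \<Sum>j<Suc n. f i j) = (\<Sum>i<n. \<Sum>j<n. f i j) + ((\<Sum>i<n. f i n) + (\<Sum>j<n. f n j)) + f n n"
    by (simp add: sum.distrib add_ac)
  also have "(\<Sum>i<n. f i n) = (\<Sum>j<n. f n j)" using Suc.prems(1) by (intro sum.cong) auto
  also have "f n n = 0" using Suc.prems(2) by auto
  also have "(\<Sum>i<n. \<Sum>j<n. f i j) = 0" using Suc by auto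
  finally show ?case by simp
qed simp

lemma mat_add_self [simp]: "(A :: 'a mat) \<in> carrier_mat n k \<Longrightarrow> A + A = 0\<^sub>m n k"
  by (intro eq_matI) auto

lemma congruence_index:
  assumes "Z \<in> carrier_mat n n" "(P :: 'a mat) \<in> carrier_mat n k" "r < k" "c < k"
  shows "(P\<^sup>T * Z * P) $$ (r, c) = (\<Sum>i<n. \<Sum>j<n. P $$ (j, r) * Z $$ (j, i) * P $$ (i, c))"
proof -
  have "(P\<^sup>T * Z * P) $$ (r, c) = (\<Sum>i<n. (P\<^sup>T * Z) $$ (r, i) * P $$ (i, c))"
    using assms by (intro mult_mat_index) auto
  also have "\<dots> = (\<Sum>i<n. (\<Sum>j<n. P $$ (j, r) * Z $$ (j, i)) * P $$ (i, c))"
  proof (intro sum.cong refl arg_cong2[of _ _ _ _ "(*)"])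
    fix i assume "i \<in> {..<n}"
    then have "(P\<^sup>T * Z) $$ (r, i) = (\<Sum>j<n. P\<^sup>T $$ (r, j) * Z $$ (j, i))"
      using assms by (intro mult_mat_index[of _ k]) auto
    then show "(P\<^sup>T * Z) $$ (r, i) = (\<Sum>j<n. P $$ (j, r) * Z $$ (j, i))"
      using assms by simp
  qed
  finally show ?thesis by (simp add: sum_distrib_right)
qed

text \<open>A diagonal entry of the congruent matrix is the quadratic form of \<open>Z\<close> at a
  column of \<open>P\<close>, hence zero.\<close>

lemma alternating_mat_congruence:
  assumes Z: "Z \<in> carrier_mat n n" "alternating_mat Z" and P: "(P :: 'a mat) \<in> carrier_mat n k"
  shows "alternating_mat (P\<^sup>T * Z * P)"
proof -
  have sym: "Z $$ (i, j) = Z $$ (j, i)" "Z $$ (i, i) = 0" if "i < n" "j < n" for i j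
    using Z that by (auto simp: alternating_mat_iff[of _ n])
  have "(P\<^sup>T * Z * P) $$ (r, c) = (P\<^sup>T * Z * P) $$ (c, r)" if "r < k" "c < k" for r c
    unfolding congruence_index[OF Z(1) P that] congruence_index[OF Z(1) P that(2,1)]
    by (subst sum.swap) (auto simp: sym mult_ac intro!: sum.cong)
  moreover have "(P\<^sup>T * Z * P) $$ (r, r) = 0" if "r < k" for r
    unfolding congruence_index[OF Z(1) P that that]
    by (rule sum_symmetric_zero_diagonal) (auto simp: sym mult_ac)
  moreover have "P\<^sup>T * Z * P \<in> carrier_mat k k" using Z P by auto
  ultimately show ?thesis by (simp add: alternating_mat_iff[of _ k])
qed

text \<open>
  \<open>Mform m\<close> is a matrix of the quadratic form \<open>\<theta>\<^sup>-\<close>. Two matrices define the same quadratic form iff they differ by an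
  alternating matrix; in characteristic 2 the difference is written as a sum.
\<close>

definition Mform :: "nat \<Rightarrow> 'a mat" where
  "Mform m = nine_block_mat (0\<^sub>m m m) (1\<^sub>m m) (0\<^sub>m m 2) (0\<^sub>m m m) (0\<^sub>m m m) (0\<^sub>m m 2) (0\<^sub>m 2 m) (0\<^sub>m 2 m) (delta_mat \<kappa>)"

lemma Mform_carrier [simp]: "Mform m \<in> carrier_mat (2 * m + 2) (2 * m + 2)"
  unfolding Mform_def by (rule nine_block_carrier) auto

lemma blk_Mform [simp]:
  "blk (Mform m) 0 m 0 m = 0\<^sub>m m m" "blk (Mform m) 0 m m m = 1\<^sub>m m" "blk (Mform m) 0 m (2 * m) 2 = 0\<^sub>m m 2"
  "blk (Mform m) m m 0 m = 0\<^sub>m m m" "blk (Mform m) m m m m = 0\<^sub>m m m" "blk (Mform m) m m (2 * m) 2 = 0\<^sub>m m 2"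
  "blk (Mform m) (2 * m) 2 0 m = 0\<^sub>m 2 m" "blk (Mform m) (2 * m) 2 m m = 0\<^sub>m 2 m"
  "blk (Mform m) (2 * m) 2 (2 * m) 2 = delta_mat \<kappa>"
  unfolding Mform_def by (rule blk_nine_block; auto)+

definition preserves_form :: "nat \<Rightarrow> 'a mat \<Rightarrow> bool" where
  "preserves_form m g \<longleftrightarrow> g \<in> carrier_mat (2 * m + 2) (2 * m + 2) \<and> alternating_mat (g\<^sup>T * Mform m * g + Mform m)"

lemma preserves_form_mult:
  assumes "preserves_form m g" "preserves_form m h"
  shows "preserves_form m (g * h)"
proof -
  let ?N = "2 * m + 2" and ?M = "Mform m"
  have c: "g \<in> carrier_mat ?N ?N" "h \<in> carrier_mat ?N ?N" using assms by (auto simp: preserves_form_def)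
  note [simp] = carrier_matD[OF c(1)] carrier_matD[OF c(2)] carrier_matD[OF Mform_carrier[of m]]
  let ?G = "g\<^sup>T * ?M * g + ?M" and ?H = "h\<^sup>T * ?M * h + ?M"
  have cG: "?G \<in> carrier_mat ?N ?N" "?H \<in> carrier_mat ?N ?N" by auto
  have "(g * h)\<^sup>T * ?M * (g * h) = h\<^sup>T * (g\<^sup>T * ?M * g) * h"
    by (simp only: transpose_mult_dim mult_assoc_dim mat_dims carrier_matD[OF c(1)] carrier_matD[OF c(2)]
        carrier_matD[OF Mform_carrier[of m]])
  moreover have "h\<^sup>T * ?G * h = h\<^sup>T * (g\<^sup>T * ?M * g) * h + h\<^sup>T * ?M * h"
    by (simp only: mult_add_distrib_dim mat_dims carrier_matD[OF c(1)] carrier_matD[OF c(2)]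
        carrier_matD[OF Mform_carrier[of m]])
  \<comment> \<open>\<open>h\<^sup>T * ?M * h\<close> occurs twice on the right and cancels.\<close>
  ultimately have "(g * h)\<^sup>T * ?M * (g * h) + ?M = h\<^sup>T * ?G * h + ?H"
    by (intro eq_matI) (auto simp: add_ac simp del: index_mult_mat(1))
  moreover have "alternating_mat (h\<^sup>T * ?G * h + ?H)"
    using assms alternating_mat_congruence[OF cG(1) _ c(2)] cG c
    by (intro alternating_mat_add[of "h\<^sup>T * ?G * h" ?N]) (auto simp: preserves_form_def simp del: assoc_mult_mat)
  ultimately show ?thesis using c by (auto simp: preserves_form_def)
qed

text \<open>Only the identity block and the block \<open>delta_mat \<kappa>\<close> of
  \<open>Mform m\<close> are nonzero, hence the two terms.\<close>

lemma blk_form: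
  assumes g: "g \<in> carrier_mat (2 * m + 2) (2 * m + 2)" and "i + r \<le> 2 * m + 2" "j + c \<le> 2 * m + 2"
  shows "blk (g\<^sup>T * Mform m * g) i r j c =
    (blk g 0 m i r)\<^sup>T * blk g m m j c + (blk g (2 * m) 2 i r)\<^sup>T * delta_mat \<kappa> * blk g (2 * m) 2 j c"
proof -
  have gT: "g\<^sup>T \<in> carrier_mat (2 * m + 2) (2 * m + 2)" using g by simp
  note mult = blk_mult3[OF gT Mform_carrier assms(2)]
  have T: "blk (g\<^sup>T * Mform m) i r 0 m = 0\<^sub>m r m" "blk (g\<^sup>T * Mform m) i r m m = (blk g 0 m i r)\<^sup>T"
    "blk (g\<^sup>T * Mform m) i r (2 * m) 2 = (blk g (2 * m) 2 i r)\<^sup>T * delta_mat \<kappa>"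
    using blk_transpose[OF g assms(2)] by (simp_all add: mult) (auto intro!: eq_matI)
  have "g\<^sup>T * Mform m \<in> carrier_mat (2 * m + 2) (2 * m + 2)" using gT Mform_carrier by (rule mult_carrier_mat)
  from blk_mult3[OF this g assms(2,3)] show ?thesis unfolding T by (intro eq_matI) auto
qed

lemma mat_add_eq_0_iff:
  assumes "(A :: 'a mat) \<in> carrier_mat n k" "B \<in> carrier_mat n k"
  shows "A + B = 0\<^sub>m n k \<longleftrightarrow> A = B"
proof
  assume eq: "A + B = 0\<^sub>m n k"
  show "A = B"
  proof (rule eq_matI)
    fix i j assume ij: "i < dim_row B" "j < dim_col B"
    have "(A + B) $$ (i, j) = 0\<^sub>m n k $$ (i, j)" using eq by simp
    then show "A $$ (i, j) = B $$ (i, j)" using ij assms by (simp add: add_eq_0_iff_eq)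
  qed (use assms in auto)
qed (use assms in auto)

lemma mat_add_cancel:
  assumes "(A :: 'a mat) \<in> carrier_mat n k" "B \<in> carrier_mat n k"
  shows "A + B + B = A" "A + (A + B) = B"
  using assms by (auto intro!: eq_matI simp: add.assoc)

lemma index_2m_cases:
  fixes i m :: nat
  assumes "i < 2 * m + 2"
  obtains "i < m" | k where "k < m" "i = m + k" | k where "k < 2" "i = 2 * m + k"
proof -
  consider "i < m" | "m \<le> i" "i < 2 * m" | "2 * m \<le> i" by linarith
  then show thesis
  proof cases
    case 1 then show ?thesis by (rule that(1))
  next
    case 2 then show ?thesis using that(2)[of "i - m"] by simp
  next
    case 3 then show ?thesis using that(3)[of "i - 2 * m"] assms by simp
  qed
qed

lemma alternating_mat_blk_iff:
  assumes Z: "(Z :: 'a mat) \<in> carrier_mat (2 * m + 2) (2 * m + 2)"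
  shows "alternating_mat Z \<longleftrightarrow> alternating_mat (blk Z 0 m 0 m) \<and> alternating_mat (blk Z m m m m) \<and>
    alternating_mat (blk Z (2 * m) 2 (2 * m) 2) \<and> blk Z 0 m m m = (blk Z m m 0 m)\<^sup>T \<and>
    blk Z 0 m (2 * m) 2 = (blk Z (2 * m) 2 0 m)\<^sup>T \<and> blk Z m m (2 * m) 2 = (blk Z (2 * m) 2 m m)\<^sup>T"
    (is "?L \<longleftrightarrow> ?R")
proof
  assume ?L
  then have s: "i < 2 * m + 2 \<Longrightarrow> j < 2 * m + 2 \<Longrightarrow> Z $$ (i, j) = Z $$ (j, i)" "i < 2 * m + 2 \<Longrightarrow> Z $$ (i, i) = 0" for i j
    by (auto simp: alternating_mat_iff[OF Z])
  show ?R
    by (intro conjI; (intro eq_matI; force intro: s)?) (auto simp: alternating_mat_iff[OF blk_carrier] intro: s)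
next
  assume R: ?R
  note d = R[unfolded alternating_mat_iff[OF blk_carrier]]
  have "Z\<^sup>T = Z"
  proof (rule blk_ext[of _ m])
    fix i r j c assume "(i, r) \<in> {(0, m), (m, m), (2 * m, 2)}" "(j, c) \<in> {(0, m), (m, m), (2 * m, 2)}"
    then show "blk Z\<^sup>T i r j c = blk Z i r j c"
      using R by (auto simp: blk_transpose[OF Z] alternating_mat_def)
  qed (use Z in auto)
  moreover have "Z $$ (i, i) = 0" if "i < 2 * m + 2" for i
    using that by (cases rule: index_2m_cases) (use d in auto)
  ultimately show ?L using Z by (auto simp: alternating_mat_def)
qed

section \<open>The anisotropic plane and its special orthogonal group\<close>

lemma delta_add_transpose: "delta_mat \<kappa> + (delta_mat \<kappa>)\<^sup>T = eta_mat"
  by (intro eq_matI) (auto simp: less_2_cases_iff delta_mat_index eta_mat_index)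

lemma SO_minus_2_carrier: "i \<in> SO_minus_2 \<kappa> \<Longrightarrow> i \<in> carrier_mat 2 2"
  by (auto simp: SO_minus_2_eq)

lemma mult_2x2_index:
  assumes "(A :: 'a mat) \<in> carrier_mat 2 2" "B \<in> carrier_mat 2 2" "r < 2" "c < 2"
  shows "(A * B) $$ (r, c) = A $$ (r, 0) * B $$ (0, c) + A $$ (r, Suc 0) * B $$ (Suc 0, c)"
  using mult_mat_index[OF assms] by (simp add: numeral_2_eq_2)

text \<open>The matrix \<delta> itself is preserved, not merely up to an alternating matrix; \<rho>
  by contrast changes it by \<eta>. Both the parameter \<open>h\<close> of \<open>Q\<close> and the
  invariance of the Gauss sum use the exact form.\<close>

lemma SO_minus_2_delta:
  assumes "i \<in> SO_minus_2 \<kappa>"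
  shows "i\<^sup>T * delta_mat \<kappa> * i = delta_mat \<kappa>"
proof -
  obtain d where i: "i = so2 d" and "theta d = 1" using assms by (auto simp: SO_minus_2_eq)
  then obtain x y where d: "d = (x, y)" and t: "x * x + x * y + \<kappa> * (y * y) = 1"
    by (cases d) (auto simp: theta_def power2_eq_square)
  have c: "i \<in> carrier_mat 2 2" "i\<^sup>T \<in> carrier_mat 2 2" "i\<^sup>T * delta_mat \<kappa> \<in> carrier_mat 2 2"
    by (auto simp: i carrier_matD[OF so2_carrier] intro!: carrier_matI)
  have k: "\<kappa> * (x * x) + (\<kappa> * (x * y) + \<kappa> * (\<kappa> * (y * y))) = \<kappa>"
    using arg_cong[OF t, of "(*) \<kappa>"] by (simp add: distrib_left add.assoc)
  show ?thesis
  proof (rule eq_matI)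
    fix r s assume "r < dim_row (delta_mat \<kappa>)" "s < dim_col (delta_mat \<kappa>)"
    then have rs: "r < 2" "s < 2" by auto
    have "(i\<^sup>T * delta_mat \<kappa> * i) $$ (r, s) = (i $$ (0, r) * delta_mat \<kappa> $$ (0, 0) + i $$ (1, r) * delta_mat \<kappa> $$ (1, 0)) * i $$ (0, s) +
      (i $$ (0, r) * delta_mat \<kappa> $$ (0, 1) + i $$ (1, r) * delta_mat \<kappa> $$ (1, 1)) * i $$ (1, s)"
      using rs c by (simp add: mult_2x2_index del: index_mult_mat(1) assoc_mult_mat)
    then show "(i\<^sup>T * delta_mat \<kappa> * i) $$ (r, s) = delta_mat \<kappa> $$ (r, s)"
      using rs t k unfolding i d
      by (auto simp: less_2_cases_iff so2_index delta_mat_index algebra_simps simp del: index_mult_mat(1) assoc_mult_mat)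
  qed (use c in auto)
qed

text \<open>\<eta> is the polar form of \<delta>, the sum of that matrix and its transpose, and so
  inherits the invariance.\<close>

lemma SO_minus_2_eta:
  assumes "i \<in> SO_minus_2 \<kappa>"
  shows "i\<^sup>T * eta_mat * i = eta_mat"
proof -
  note c = SO_minus_2_carrier[OF assms]
  have "(i\<^sup>T * delta_mat \<kappa> * i)\<^sup>T = i\<^sup>T * (delta_mat \<kappa>)\<^sup>T * i"
    by (simp only: transpose_mult_dim mult_assoc_dim mat_dims carrier_matD[OF c] delta_mat_dim transpose_transpose)
  moreover have "i\<^sup>T * (delta_mat \<kappa> + (delta_mat \<kappa>)\<^sup>T) * i = i\<^sup>T * delta_mat \<kappa> * i + i\<^sup>T * (delta_mat \<kappa>)\<^sup>T * i"
    by (simp only: mult_add_distrib_dim mat_dims carrier_matD[OF c] delta_mat_dim)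
  ultimately show ?thesis using SO_minus_2_delta[OF assms] delta_add_transpose by metis
qed

lemma eta_mat_square: "eta_mat * eta_mat = (1\<^sub>m 2 :: 'a mat)"
  by (intro eq_matI) (auto simp: mult_2x2_index less_2_cases_iff eta_mat_index simp del: index_mult_mat(1))

text \<open>\<eta> is its own inverse, so its invariance exhibits
  \<open>eta_mat * i\<^sup>T * eta_mat\<close> as a left inverse of \<open>i\<close>.\<close>

lemma SO_minus_2_GL: "i \<in> SO_minus_2 \<kappa> \<Longrightarrow> i \<in> GL 2"
proof -
  assume i: "i \<in> SO_minus_2 \<kappa>"
  note c = SO_minus_2_carrier[OF i]
  have "eta_mat * i\<^sup>T * eta_mat * i = eta_mat * (i\<^sup>T * eta_mat * i)"
    by (simp only: mult_assoc_dim mat_dims carrier_matD[OF c] eta_mat_dim)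
  then have eq: "eta_mat * i\<^sup>T * eta_mat * i = 1\<^sub>m 2" unfolding SO_minus_2_eta[OF i] eta_mat_square .
  have "eta_mat * i\<^sup>T * eta_mat \<in> carrier_mat 2 2" using c by auto
  with mat_mult_left_right_inverse[OF this c eq] show ?thesis using c GL_I by blast
qed

lemma SO_minus_2_iff: "so2 d \<in> SO_minus_2 \<kappa> \<longleftrightarrow> theta d = 1"
  using inj_so2 by (auto simp: SO_minus_2_eq dest: injD)

lemma so2_mult: "so2 (x, y) * so2 (x', y') = so2 (x * x' + \<kappa> * y * y', y * x' + x * y' + y * y')"
  by (rule eq_matI)
    (auto simp: mult_2x2_index less_2_cases_iff so2_index algebra_simps carrier_matD[OF so2_carrier] simp del: index_mult_mat(1))

lemma theta_mult: "theta (x * x' + \<kappa> * y * y', y * x' + x * y' + y * y') = theta (x, y) * theta (x', y')"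
  by (simp add: theta_def square_add power_mult_distrib) (simp add: algebra_simps power2_eq_square)

lemma SO_minus_2_mult: "i \<in> SO_minus_2 \<kappa> \<Longrightarrow> j \<in> SO_minus_2 \<kappa> \<Longrightarrow> i * j \<in> SO_minus_2 \<kappa>"
proof -
  assume "i \<in> SO_minus_2 \<kappa>" "j \<in> SO_minus_2 \<kappa>"
  then obtain x y x' y' where ij: "i = so2 (x, y)" "theta (x, y) = 1" "j = so2 (x', y')" "theta (x', y') = 1"
    by (auto simp: SO_minus_2_eq)
  then show ?thesis unfolding ij so2_mult SO_minus_2_iff theta_mult by simp
qed

text \<open>
  An intrinsic description of \<open>Q\<^sup>-(2m + 2, q)\<close>, from which closure under products and under conjugation by \<open>\<rho>\<close> can be
  read off.
\<close>

definition Qc :: "nat \<Rightarrow> 'a mat set" where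
  "Qc m = {g. preserves_form m g \<and> blk g m m 0 m = 0\<^sub>m m m \<and> blk g (2 * m) 2 0 m = 0\<^sub>m 2 m \<and>
     blk g m m (2 * m) 2 = 0\<^sub>m m 2 \<and> blk g (2 * m) 2 (2 * m) 2 \<in> SO_minus_2 \<kappa>}"

lemma Qc_carrier: "g \<in> Qc m \<Longrightarrow> g \<in> carrier_mat (2 * m + 2) (2 * m + 2)"
  by (simp add: Qc_def preserves_form_def)

lemma finite_Qc: "finite (Qc m)"
  by (rule finite_subset[OF _ finite_carrier_mat[of "2 * m + 2" "2 * m + 2"]]) (auto simp: Qc_carrier)

text \<open>With three blocks zero the condition decouples: \<open>D\<close> is the inverse
  transpose of \<open>A\<close>, \<open>Y\<close> is determined by \<open>D\<close>,
  \<open>E\<close> and \<open>i\<close>, and only \<open>X\<close> is left with an alternating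
  condition. This is the shape of a product of a Levi and a unipotent factor.\<close>

lemma preserves_form_blk_iff:
  assumes g: "g \<in> carrier_mat (2 * m + 2) (2 * m + 2)"
    and z: "blk g m m 0 m = 0\<^sub>m m m" "blk g (2 * m) 2 0 m = 0\<^sub>m 2 m" "blk g m m (2 * m) 2 = 0\<^sub>m m 2"
    and SO: "blk g (2 * m) 2 (2 * m) 2 \<in> SO_minus_2 \<kappa>"
  defines "A \<equiv> blk g 0 m 0 m" and "X \<equiv> blk g 0 m m m" and "Y \<equiv> blk g 0 m (2 * m) 2"
    and "D \<equiv> blk g m m m m" and "E \<equiv> blk g (2 * m) 2 m m" and "i \<equiv> blk g (2 * m) 2 (2 * m) 2"
  shows "preserves_form m g \<longleftrightarrow> A\<^sup>T * D = 1\<^sub>m m \<and> alternating_mat (X\<^sup>T * D + E\<^sup>T * delta_mat \<kappa> * E) \<and>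
    D\<^sup>T * Y = E\<^sup>T * eta_mat * i"
proof -
  let ?d = "delta_mat \<kappa>"
  have c: "A \<in> carrier_mat m m" "X \<in> carrier_mat m m" "Y \<in> carrier_mat m 2" "D \<in> carrier_mat m m"
    "E \<in> carrier_mat 2 m" "i \<in> carrier_mat 2 2"
    by (auto simp: A_def X_def Y_def D_def E_def i_def)
  note dims = carrier_matD[OF c(1)] carrier_matD[OF c(2)] carrier_matD[OF c(3)] carrier_matD[OF c(4)]
    carrier_matD[OF c(5)] carrier_matD[OF c(6)] delta_mat_dim eta_mat_dim mat_dims
  let ?Z = "g\<^sup>T * Mform m * g + Mform m"
  have gM: "g\<^sup>T * Mform m * g \<in> carrier_mat (2 * m + 2) (2 * m + 2)"
    using g Mform_carrier by (metis mult_carrier_mat transpose_carrier_mat)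
  then have Zc: "?Z \<in> carrier_mat (2 * m + 2) (2 * m + 2)" by simp
  note blkZ = blk_add[OF gM Mform_carrier] blk_form[OF g]
  have sd: "i\<^sup>T * ?d * i = ?d" using SO_minus_2_delta[OF SO] by (simp only: i_def)
  have Z: "blk ?Z 0 m 0 m = 0\<^sub>m m m" "blk ?Z 0 m m m = A\<^sup>T * D + 1\<^sub>m m" "blk ?Z 0 m (2 * m) 2 = 0\<^sub>m m 2"
    "blk ?Z m m 0 m = 0\<^sub>m m m" "blk ?Z m m m m = X\<^sup>T * D + E\<^sup>T * ?d * E" "blk ?Z m m (2 * m) 2 = E\<^sup>T * ?d * i"
    "blk ?Z (2 * m) 2 0 m = 0\<^sub>m 2 m" "blk ?Z (2 * m) 2 m m = Y\<^sup>T * D + i\<^sup>T * ?d * E"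
    "blk ?Z (2 * m) 2 (2 * m) 2 = i\<^sup>T * ?d * i + ?d"
    using c
    by (simp_all add: blkZ z flip: A_def X_def Y_def D_def E_def i_def del: assoc_mult_mat) (auto simp: dims intro!: eq_matI)
  have Zii: "blk ?Z (2 * m) 2 (2 * m) 2 = 0\<^sub>m 2 2" unfolding Z sd by simp
  have alt0: "alternating_mat (0\<^sub>m n n :: 'a mat)" for n by (simp add: alternating_mat_iff[of _ n])
  have T: "(Y\<^sup>T * D + i\<^sup>T * ?d * E)\<^sup>T = D\<^sup>T * Y + E\<^sup>T * ?d\<^sup>T * i"
  proof -
    have "(Y\<^sup>T * D + i\<^sup>T * ?d * E)\<^sup>T = (Y\<^sup>T * D)\<^sup>T + (i\<^sup>T * ?d * E)\<^sup>T"
      by (rule transpose_add[of _ 2 m]) (auto simp: dims)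
    then show ?thesis by (simp only: dims transpose_mult_dim transpose_transpose mult_assoc_dim)
  qed
  \<comment> \<open>The term with the transposed \<delta> moves across without change of sign, and
    the two \<delta> terms add up to \<eta>. This is the origin of \<eta> in
    \<open>Q_unip\<close>.\<close>
  have "E\<^sup>T * ?d * i = D\<^sup>T * Y + E\<^sup>T * ?d\<^sup>T * i \<longleftrightarrow> D\<^sup>T * Y = E\<^sup>T * ?d * i + E\<^sup>T * ?d\<^sup>T * i"
  proof -
    have cc: "D\<^sup>T * Y \<in> carrier_mat m 2" "E\<^sup>T * ?d\<^sup>T * i \<in> carrier_mat m 2" "E\<^sup>T * ?d * i \<in> carrier_mat m 2"
      by (auto simp: dims)
    show ?thesis using mat_add_cancel(1)[OF cc(1,2)] mat_add_cancel(1)[OF cc(3,2)] by metis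
  qed
  also have "E\<^sup>T * ?d * i + E\<^sup>T * ?d\<^sup>T * i = E\<^sup>T * (?d + ?d\<^sup>T) * i"
    by (simp only: dims mult_add_distrib_dim)
  finally have Yiff: "E\<^sup>T * ?d * i = D\<^sup>T * Y + E\<^sup>T * ?d\<^sup>T * i \<longleftrightarrow> D\<^sup>T * Y = E\<^sup>T * eta_mat * i"
    unfolding delta_add_transpose .
  have "alternating_mat ?Z \<longleftrightarrow> alternating_mat (X\<^sup>T * D + E\<^sup>T * ?d * E) \<and> A\<^sup>T * D + 1\<^sub>m m = 0\<^sub>m m m \<and>
     E\<^sup>T * ?d * i = D\<^sup>T * Y + E\<^sup>T * ?d\<^sup>T * i"
    unfolding alternating_mat_blk_iff[OF Zc] Zii unfolding Z T using alt0 by simp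
  also have "A\<^sup>T * D + 1\<^sub>m m = 0\<^sub>m m m \<longleftrightarrow> A\<^sup>T * D = 1\<^sub>m m"
    by (rule mat_add_eq_0_iff) (auto simp: dims)
  finally show ?thesis using g unfolding preserves_form_def Yiff by blast
qed

lemma Qc_mult:
  assumes "g \<in> Qc m" "h \<in> Qc m"
  shows "g * h \<in> Qc m"
proof -
  note gc = Qc_carrier[OF assms(1)] and hc = Qc_carrier[OF assms(2)]
  note mult = blk_mult3[OF gc hc]
  have ii: "blk g (2 * m) 2 (2 * m) 2 * blk h (2 * m) 2 (2 * m) 2 \<in> SO_minus_2 \<kappa>"
    using assms by (auto simp: Qc_def SO_minus_2_mult)
  have "preserves_form m (g * h)" using assms preserves_form_mult by (auto simp: Qc_def)
  moreover have "blk (g * h) (2 * m) 2 (2 * m) 2 = blk g (2 * m) 2 (2 * m) 2 * blk h (2 * m) 2 (2 * m) 2"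
    "blk (g * h) m m 0 m = 0\<^sub>m m m" "blk (g * h) (2 * m) 2 0 m = 0\<^sub>m 2 m" "blk (g * h) m m (2 * m) 2 = 0\<^sub>m m 2"
    using assms by (simp_all add: mult Qc_def) (auto intro!: eq_matI)
  ultimately show ?thesis using ii by (simp add: Qc_def)
qed

end

section \<open>Sums over double cosets\<close>

text \<open>The sum of \<open>f\<close> over all R x S y is evaluated in two ways: by the value of
  the product, where all fibres have the same size, and by \<open>y\<close>, where the sum over
  \<open>x\<close> does not depend on \<open>y\<close>. The result is left multiplied out instead of
  forming an index.\<close>

lemma sum_double_coset:
  fixes Q :: "'a::{field,finite} mat set" and f :: "'a mat \<Rightarrow> complex"
  assumes Q: "Q \<subseteq> GL n" and mult: "\<And>x y. x \<in> Q \<Longrightarrow> y \<in> Q \<Longrightarrow> x * y \<in> Q"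
    and inv: "\<And>x. x \<in> Q \<Longrightarrow> mat_inv x \<in> Q"
    and S: "S \<in> carrier_mat n n" "S * S = 1\<^sub>m n"
    and R: "R \<in> carrier_mat n n" "R * R = 1\<^sub>m n" "\<And>x. x \<in> Q \<Longrightarrow> R * x * R \<in> Q"
    and f: "\<And>x y. x \<in> carrier_mat n n \<Longrightarrow> y \<in> carrier_mat n n \<Longrightarrow> f (x * y) = f (y * x)"
  shows "of_nat (card {x \<in> Q. S * x * S \<in> Q}) * (\<Sum>w\<in>{R * x * S * y | x y. x \<in> Q \<and> y \<in> Q}. f w) =
    of_nat (card Q) * (\<Sum>x\<in>Q. f (R * x * S))"
proof -
  let ?B = "{x \<in> Q. S * x * S \<in> Q}" and ?W = "{R * x * S * y | x y. x \<in> Q \<and> y \<in> Q}"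
  have fin: "finite Q" using Q by (rule finite_subset) simp
  have car: "x \<in> carrier_mat n n" if "x \<in> Q" for x using Q that by (auto simp: GL_carrier)
  note assoc = assoc_mult_mat[of _ n n _ n _ n]
  note mc = mult_carrier_mat[of _ n n _ n]
  have can: "S * (S * x) = x" "R * (R * x) = x" if "x \<in> carrier_mat n n" for x
    using assoc_mult_mat[OF S(1) S(1) that] assoc_mult_mat[OF R(1) R(1) that] S R that by (metis left_mult_one_mat)+
  have can': "mat_inv x * (x * y) = y" "x * (mat_inv x * y) = y" if "x \<in> Q" "y \<in> carrier_mat n n" for x y
    using mat_inv_mult_cancel[of x n y] Q that by auto
  have invc: "mat_inv x \<in> carrier_mat n n" if "x \<in> Q" for x using car[OF inv[OF that]] .
  \<comment> \<open>The fibre over R x0 S y0 is parametrized by the b in \<open>?B\<close>: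
    multiplying x0 by b on the right is undone behind \<open>S\<close>, which gives the pair (x0 b,
    S b^-1 S y0).\<close>
  have fiber: "card {p \<in> Q \<times> Q. R * fst p * S * snd p = w} = card ?B" if "w \<in> ?W" for w
  proof -
    from that obtain x0 y0 where 0: "x0 \<in> Q" "y0 \<in> Q" and w: "w = R * x0 * S * y0" by blast
    note c0 = car[OF 0(1)] car[OF 0(2)]
    have Binv: "S * mat_inv b * S \<in> Q" if b: "b \<in> ?B" for b
    proof -
      have "mat_inv (S * b * S) = S * mat_inv b * S"
      proof (rule mat_inv_unique)
        have "S * b * S * (S * mat_inv b * S) = 1\<^sub>m n"
          using b S car[of b] invc[of b] can' can by (simp add: assoc mc)
        then show "S * b * S * (S * mat_inv b * S) = 1\<^sub>m n" .
      qed (use b S car invc in \<open>auto intro!: mc\<close>)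
      then show ?thesis using b inv by force
    qed
    have key: "mat_inv x0 * fst p \<in> ?B \<and> (x0 * (mat_inv x0 * fst p), S * mat_inv (mat_inv x0 * fst p) * S * y0) = p"
      if p: "p \<in> {p \<in> Q \<times> Q. R * fst p * S * snd p = w}" for p
    proof -
      obtain x y where xy: "p = (x, y)" by force
      with p have pQ: "x \<in> Q" "y \<in> Q" and eq: "R * x * S * y = R * x0 * S * y0" by (auto simp: w)
      note c = car[OF pQ(1)] car[OF pQ(2)]
      have "R * (R * x * S * y) = R * (R * x0 * S * y0)" using eq by simp
      then have eq1: "x * (S * y) = x0 * (S * y0)"
        using c c0 R(1) S(1) by (simp add: assoc mc can)
      have i0: "mat_inv x0 \<in> Q" using inv 0 by simp
      have eq2: "mat_inv x0 * (x * (S * y)) = S * y0"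
        unfolding eq1 using 0 S(1) c0 by (simp add: can' mc)
      let ?b = "mat_inv x0 * x"
      have bc: "?b \<in> carrier_mat n n" using car mult i0 pQ by blast
      have "S * ?b * S * y = S * (mat_inv x0 * (x * (S * y)))"
        using bc c S(1) invc[OF 0(1)] by (simp add: assoc mc)
      also have "\<dots> = y0" unfolding eq2 using can c0 by simp
      finally have sb: "S * ?b * S * y = y0" .
      have "S * ?b * S = S * ?b * S * (y * mat_inv y)"
        using mat_inv(2)[of y n] Q pQ S(1) bc by (auto simp: right_mult_one_mat[of _ n n] mc)
      also have "\<dots> = y0 * mat_inv y"
        using sb assoc_mult_mat[of "S * ?b * S" n n y n "mat_inv y" n] S(1) bc c invc[OF pQ(2)] by (simp add: mc)
      finally have "S * ?b * S = y0 * mat_inv y" .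
      then have bB: "?b \<in> ?B" using mult i0 pQ inv 0 by auto
      have "S * mat_inv ?b * S * y0 = y"
      proof -
        have "S * mat_inv ?b * S * y0 = S * (mat_inv ?b * (S * (S * ?b * S * y)))"
          unfolding sb using S(1) invc[of ?b] bB c0 by (simp add: assoc mc)
        also have "\<dots> = y" using S(1) invc[of ?b] bB bc c can can' by (simp add: assoc mc)
        finally show ?thesis .
      qed
      moreover have "x0 * ?b = x" using can' 0 c by simp
      ultimately show ?thesis using bB by (simp add: xy)
    qed
    have "bij_betw (\<lambda>b. (x0 * b, S * mat_inv b * S * y0)) ?B {p \<in> Q \<times> Q. R * fst p * S * snd p = w}"
    proof (rule bij_betwI[where g = "\<lambda>p. mat_inv x0 * fst p"])
      show "(\<lambda>b. (x0 * b, S * mat_inv b * S * y0)) \<in> ?B \<rightarrow> {p \<in> Q \<times> Q. R * fst p * S * snd p = w}"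
      proof
        fix b assume b: "b \<in> ?B"
        have "R * (x0 * b) * S * (S * mat_inv b * S * y0) = w"
          unfolding w using b 0 c0 car[of b] invc[of b] R S can can' by (simp add: assoc mc)
        with b 0 mult Binv[OF b] show "(x0 * b, S * mat_inv b * S * y0) \<in> {p \<in> Q \<times> Q. R * fst p * S * snd p = w}"
          by auto
      qed
      show "(\<lambda>p. mat_inv x0 * fst p) \<in> {p \<in> Q \<times> Q. R * fst p * S * snd p = w} \<rightarrow> ?B"
        using key by blast
      show "(x0 * (mat_inv x0 * fst p), S * mat_inv (mat_inv x0 * fst p) * S * y0) = p"
        if "p \<in> {p \<in> Q \<times> Q. R * fst p * S * snd p = w}" for p using key[OF that] by blast
    qed (use can' 0 car in auto)
    then show ?thesis by (simp add: bij_betw_same_card)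
  qed
  have finW: "finite ?W"
  proof -
    have "?W = (\<lambda>(x, y). R * x * S * y) ` (Q \<times> Q)" by auto
    then show ?thesis using fin by simp
  qed
  have "(\<Sum>p\<in>Q \<times> Q. f (R * fst p * S * snd p)) = (\<Sum>w\<in>?W. \<Sum>p\<in>{p \<in> Q \<times> Q. R * fst p * S * snd p = w}. f (R * fst p * S * snd p))"
  proof (rule sum.group[symmetric])
    show "(\<lambda>p. R * fst p * S * snd p) ` (Q \<times> Q) \<subseteq> ?W" by fastforce
  qed (use fin finW in auto)
  also have "\<dots> = (\<Sum>w\<in>?W. of_nat (card ?B) * f w)"
    by (intro sum.cong refl) (simp add: fiber)
  finally have 1: "(\<Sum>p\<in>Q \<times> Q. f (R * fst p * S * snd p)) = of_nat (card ?B) * (\<Sum>w\<in>?W. f w)"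
    by (simp add: sum_distrib_left)
  have inner: "(\<Sum>x\<in>Q. f (R * x * S * y)) = (\<Sum>x\<in>Q. f (R * x * S))" if y: "y \<in> Q" for y
  proof -
    note yc = car[OF y]
    let ?y = "R * y * R"
    have yQ: "?y \<in> Q" using R(3) y .
    \<comment> \<open>Cyclicity brings \<open>y\<close> to the front, y R = R (R y R), and R y R
      lies in \<open>Q\<close>, so that a translation of \<open>x\<close> absorbs it.\<close>
    have "f (R * x * S * y) = f (R * (?y * x) * S)" if x: "x \<in> Q" for x
    proof -
      have "f (R * x * S * y) = f (y * (R * x * S))" using car[OF x] yc R(1) S(1) by (intro f) (auto intro!: mc)
      also have "y * (R * x * S) = R * (?y * x) * S" using car[OF x] yc R(1) S(1) by (simp add: assoc mc can)
      finally show ?thesis .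
    qed
    then have "(\<Sum>x\<in>Q. f (R * x * S * y)) = (\<Sum>x\<in>Q. f (R * (?y * x) * S))" by simp
    also have "\<dots> = (\<Sum>x\<in>Q. f (R * x * S))"
      by (rule sum.reindex_bij_witness[where i = "\<lambda>x. mat_inv ?y * x" and j = "\<lambda>x. ?y * x"])
        (use yQ can' car mult inv in auto)
    finally show ?thesis .
  qed
  have "(\<Sum>p\<in>Q \<times> Q. f (R * fst p * S * snd p)) = (\<Sum>x\<in>Q. \<Sum>y\<in>Q. f (R * x * S * y))"
    by (simp add: sum.cartesian_product case_prod_beta)
  also have "\<dots> = (\<Sum>y\<in>Q. \<Sum>x\<in>Q. f (R * x * S * y))" by (rule sum.swap)
  also have "\<dots> = of_nat (card Q) * (\<Sum>x\<in>Q. f (R * x * S))" by (simp add: inner)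
  finally show ?thesis using 1 by simp
qed

section \<open>The group \<open>Q\<^sup>-(2n,q)\<close>\<close>

context char2_character
begin

text \<open>The polar form J, the sum of \<open>Mform m\<close> and its transpose, satisfies J^2 =
  1. Alternating matrices are symmetric, so \<open>g\<close> preserves J, and then J times the
  transpose of \<open>g\<close> times J is a left inverse of \<open>g\<close>.\<close>

lemma preserves_form_GL:
  assumes "preserves_form m g"
  shows "g \<in> GL (2 * m + 2)"
proof -
  let ?N = "2 * m + 2" and ?M = "Mform m"
  have g: "g \<in> carrier_mat ?N ?N" using assms by (simp add: preserves_form_def)
  note dims = carrier_matD[OF g] carrier_matD[OF Mform_carrier[of m]] mat_dims
  let ?J = "?M + ?M\<^sup>T"
  have Jc: "?J \<in> carrier_mat ?N ?N" by (auto simp: dims)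
  have blkJ: "blk ?J i r j c = blk ?M i r j c + (blk ?M j c i r)\<^sup>T" if "i + r \<le> ?N" "j + c \<le> ?N" for i r j c
    using that by (subst blk_add[of _ ?N ?N]) (auto simp: blk_transpose[OF Mform_carrier])
  have eta: "delta_mat \<kappa> + (delta_mat \<kappa>)\<^sup>T = eta_mat" by (rule delta_add_transpose)
  have J: "?J * ?J = 1\<^sub>m ?N"
  proof (rule blk_ext[of _ m])
    fix i r j c assume "(i, r) \<in> {(0, m), (m, m), (2 * m, 2)}" "(j, c) \<in> {(0, m), (m, m), (2 * m, 2)}"
    moreover have one: "blk (1\<^sub>m ?N) i r i r = (1\<^sub>m r :: 'a mat)" if "i + r \<le> ?N" for i r
      using that by (intro eq_matI) auto
    moreover have zero: "blk (1\<^sub>m ?N) i r j c = (0\<^sub>m r c :: 'a mat)" if "i + r \<le> j \<or> j + c \<le> i" "i + r \<le> ?N" "j + c \<le> ?N" for i r j c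
      using that by (intro eq_matI) auto
    ultimately show "blk (?J * ?J) i r j c = blk (1\<^sub>m ?N) i r j c"
      by (elim insertE emptyE; simp add: blk_mult3[OF Jc Jc] blkJ eta eta_mat_square one zero)
  qed (use mult_carrier_mat[OF Jc Jc] in auto)
  have "(g\<^sup>T * ?M * g + ?M)\<^sup>T = g\<^sup>T * ?M * g + ?M"
    using assms by (simp add: preserves_form_def alternating_mat_def)
  moreover have "(g\<^sup>T * ?M * g + ?M)\<^sup>T = g\<^sup>T * ?M\<^sup>T * g + ?M\<^sup>T"
  proof -
    have "(g\<^sup>T * ?M * g + ?M)\<^sup>T = (g\<^sup>T * ?M * g)\<^sup>T + ?M\<^sup>T"
      by (rule transpose_add[of _ ?N ?N]) (auto simp: dims)
    then show ?thesis by (simp only: dims transpose_mult_dim mult_assoc_dim transpose_transpose)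
  qed
  ultimately have e: "g\<^sup>T * ?M\<^sup>T * g + ?M\<^sup>T = g\<^sup>T * ?M * g + ?M" by metis
  have e1: "g\<^sup>T * ?J * g = g\<^sup>T * ?M * g + g\<^sup>T * ?M\<^sup>T * g"
    by (simp only: dims mult_add_distrib_dim)
  have e2: "g\<^sup>T * ?M * g + g\<^sup>T * ?M\<^sup>T * g = ?J"
  proof (rule eq_matI)
    have swap: "u + x = v + y" if "x + y = u + v" for u v x y :: 'a
    proof -
      have "u + x = u + (x + y) + y" by (simp add: add.assoc)
      also have "\<dots> = v + y" unfolding that by simp
      finally show ?thesis .
    qed
    fix i j assume ij: "i < dim_row ?J" "j < dim_col ?J"
    have "(g\<^sup>T * ?M\<^sup>T * g + ?M\<^sup>T) $$ (i, j) = (g\<^sup>T * ?M * g + ?M) $$ (i, j)" using e by simp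
    then have "(g\<^sup>T * ?M\<^sup>T * g) $$ (i, j) + ?M\<^sup>T $$ (i, j) = (g\<^sup>T * ?M * g) $$ (i, j) + ?M $$ (i, j)"
      using ij by (simp add: dims del: index_mult_mat(1) index_transpose_mat(1) assoc_mult_mat)
    from swap[OF this] show "(g\<^sup>T * ?M * g + g\<^sup>T * ?M\<^sup>T * g) $$ (i, j) = ?J $$ (i, j)"
      using ij by (simp add: dims del: index_mult_mat(1) index_transpose_mat(1) assoc_mult_mat)
  qed (simp_all only: dims)
  have gJ: "g\<^sup>T * ?J * g = ?J" by (rule trans[OF e1 e2])
  have "K * g\<^sup>T * K * g = K * (g\<^sup>T * K * g)" if "K \<in> carrier_mat ?N ?N" for K
    by (simp only: mat_dims carrier_matD[OF g] carrier_matD[OF that] mult_assoc_dim)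
  from this[OF Jc] have 1: "?J * g\<^sup>T * ?J * g = 1\<^sub>m ?N" unfolding gJ J .
  have c: "?J * g\<^sup>T * ?J \<in> carrier_mat ?N ?N" using g Jc by (metis mult_carrier_mat transpose_carrier_mat)
  show ?thesis using mat_mult_left_right_inverse[OF c g 1] g c GL_I by blast
qed

lemma Qc_GL: "g \<in> Qc m \<Longrightarrow> g \<in> GL (2 * m + 2)"
  by (simp add: Qc_def preserves_form_GL)

text \<open>Finiteness replaces a computation of the inverse: left multiplication by
  \<open>g\<close> permutes \<open>Qc m\<close>, so first the identity and then the inverse lie in
  it.\<close>

lemma Qc_inv:
  assumes g: "g \<in> Qc m"
  shows "mat_inv g \<in> Qc m"
proof -
  note gG = Qc_GL[OF g]
  have "inj_on ((*) g) (Qc m)"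
    by (rule inj_onI) (rule GL_mult_cancel_left[OF gG Qc_carrier Qc_carrier])
  then have im: "(*) g ` Qc m = Qc m"
    by (intro endo_inj_surj finite_Qc) (auto simp: Qc_mult g)
  then obtain e where e: "e \<in> Qc m" "g * e = g" using g by (metis imageE)
  then have "e = 1\<^sub>m (2 * m + 2)"
    using GL_mult_cancel_left[OF gG Qc_carrier[OF e(1)] one_carrier_mat] Qc_carrier[OF g] by simp
  with e(1) im obtain h where h: "h \<in> Qc m" "g * h = 1\<^sub>m (2 * m + 2)" by (metis imageE)
  then show ?thesis using mat_inv_unique[OF Qc_carrier[OF g] Qc_carrier[OF h(1)]] by simp
qed

section \<open>Free parameters for Q\<close>

definition Alt :: "nat \<Rightarrow> 'a mat set" where
  "Alt m = {C \<in> carrier_mat m m. alternating_mat C}"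

text \<open>With this third argument of \<open>Q_unip\<close> the condition defining
  \<open>Q_minus\<close> says that the transpose of \<open>C\<close> is alternating, so the four
  parameters are independent of each other.\<close>

definition qmat :: "nat \<Rightarrow> 'a mat \<Rightarrow> 'a mat \<Rightarrow> 'a mat \<Rightarrow> 'a mat \<Rightarrow> 'a mat" where
  "qmat m A i h C = Q_levi m A i * Q_unip m i (C + h\<^sup>T * (delta_mat \<kappa>)\<^sup>T * h) h"

lemma blk_levi_unip:
  assumes A: "A \<in> GL m" and i: "i \<in> carrier_mat 2 2" and B: "B \<in> carrier_mat m m" and h: "h \<in> carrier_mat 2 m"
  defines "g \<equiv> Q_levi m A i * Q_unip m i B h"
  shows "g \<in> carrier_mat (2 * m + 2) (2 * m + 2)"
    "blk g 0 m 0 m = A" "blk g 0 m m m = A * B" "blk g 0 m (2 * m) 2 = A * (h\<^sup>T * i\<^sup>T * eta_mat * i)"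
    "blk g m m 0 m = 0\<^sub>m m m" "blk g m m m m = (mat_inv A)\<^sup>T" "blk g m m (2 * m) 2 = 0\<^sub>m m 2"
    "blk g (2 * m) 2 0 m = 0\<^sub>m 2 m" "blk g (2 * m) 2 m m = i * h" "blk g (2 * m) 2 (2 * m) 2 = i"
proof -
  define Y where "Y = h\<^sup>T * i\<^sup>T * eta_mat * i"
  have Y: "Y \<in> carrier_mat m 2" unfolding Y_def using h i by (auto intro!: carrier_matI)
  note Ac = GL_carrier[OF A] and Ai = mat_inv(1)[OF A]
  have L: "Q_levi m A i \<in> carrier_mat (2 * m + 2) (2 * m + 2)"
    unfolding Q_levi_def by (rule nine_block_carrier) (use Ac Ai i in auto)
  have U: "Q_unip m i B h \<in> carrier_mat (2 * m + 2) (2 * m + 2)"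
    unfolding Q_unip_def Y_def[symmetric] by (rule nine_block_carrier) (use B h Y in auto)
  show "g \<in> carrier_mat (2 * m + 2) (2 * m + 2)" unfolding g_def using L U by (rule mult_carrier_mat)
  have bL: "blk (Q_levi m A i) 0 m 0 m = A" "blk (Q_levi m A i) 0 m m m = 0\<^sub>m m m" "blk (Q_levi m A i) 0 m (2 * m) 2 = 0\<^sub>m m 2"
    "blk (Q_levi m A i) m m 0 m = 0\<^sub>m m m" "blk (Q_levi m A i) m m m m = (mat_inv A)\<^sup>T" "blk (Q_levi m A i) m m (2 * m) 2 = 0\<^sub>m m 2"
    "blk (Q_levi m A i) (2 * m) 2 0 m = 0\<^sub>m 2 m" "blk (Q_levi m A i) (2 * m) 2 m m = 0\<^sub>m 2 m" "blk (Q_levi m A i) (2 * m) 2 (2 * m) 2 = i"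
    unfolding Q_levi_def by (rule blk_nine_block; use Ac Ai i in simp)+
  have bU: "blk (Q_unip m i B h) 0 m 0 m = 1\<^sub>m m" "blk (Q_unip m i B h) 0 m m m = B" "blk (Q_unip m i B h) 0 m (2 * m) 2 = Y"
    "blk (Q_unip m i B h) m m 0 m = 0\<^sub>m m m" "blk (Q_unip m i B h) m m m m = 1\<^sub>m m" "blk (Q_unip m i B h) m m (2 * m) 2 = 0\<^sub>m m 2"
    "blk (Q_unip m i B h) (2 * m) 2 0 m = 0\<^sub>m 2 m" "blk (Q_unip m i B h) (2 * m) 2 m m = h" "blk (Q_unip m i B h) (2 * m) 2 (2 * m) 2 = 1\<^sub>m 2"
    unfolding Q_unip_def Y_def[symmetric] by (rule blk_nine_block; use B h Y in simp)+
  show "blk g 0 m 0 m = A" "blk g 0 m m m = A * B" "blk g 0 m (2 * m) 2 = A * (h\<^sup>T * i\<^sup>T * eta_mat * i)"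
    "blk g m m 0 m = 0\<^sub>m m m" "blk g m m m m = (mat_inv A)\<^sup>T" "blk g m m (2 * m) 2 = 0\<^sub>m m 2"
    "blk g (2 * m) 2 0 m = 0\<^sub>m 2 m" "blk g (2 * m) 2 m m = i * h" "blk g (2 * m) 2 (2 * m) 2 = i"
    unfolding g_def Y_def[symmetric] using Ac Ai B h Y i
    by (simp_all add: blk_mult3[OF L U] bL bU del: assoc_mult_mat)
qed

text \<open>Links the matrices given by generators to the intrinsic description, for which closure
  is already known.\<close>

lemma Qc_eq: "Qc m = Q_minus \<kappa> (Suc m)"
proof (intro equalityI subsetI)
  fix g assume "g \<in> Q_minus \<kappa> (Suc m)"
  then obtain A i B h where p: "A \<in> GL m" "i \<in> SO_minus_2 \<kappa>" "B \<in> carrier_mat m m" "h \<in> carrier_mat 2 m"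
    "alternating_mat (B\<^sup>T + h\<^sup>T * delta_mat \<kappa> * h)" and g: "g = Q_levi m A i * Q_unip m i B h"
    by (auto simp: Q_minus_def)
  note ic = SO_minus_2_carrier[OF p(2)]
  note b = blk_levi_unip[OF p(1) ic p(3,4), folded g]
  note dims = mat_dims GL_dim[OF p(1)] carrier_matD[OF ic] carrier_matD[OF p(3)] carrier_matD[OF p(4)] delta_mat_dim eta_mat_dim
  note AI = mat_inv[OF p(1)]
  have AT: "A\<^sup>T * (mat_inv A)\<^sup>T = 1\<^sub>m m"
    using transpose_mult[OF AI(1) GL_carrier[OF p(1)]] AI(3) by (metis transpose_one)
  have "(A * B)\<^sup>T * (mat_inv A)\<^sup>T = B\<^sup>T"
  proof -
    have "(A * B)\<^sup>T * (mat_inv A)\<^sup>T = B\<^sup>T * (A\<^sup>T * (mat_inv A)\<^sup>T)" by (simp only: dims transpose_mult_dim mult_assoc_dim)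
    then show ?thesis unfolding AT using p(3) by simp
  qed
  moreover have "(i * h)\<^sup>T * delta_mat \<kappa> * (i * h) = h\<^sup>T * delta_mat \<kappa> * h"
  proof -
    have "(i * h)\<^sup>T * delta_mat \<kappa> * (i * h) = h\<^sup>T * (i\<^sup>T * delta_mat \<kappa> * i) * h" by (simp only: dims transpose_mult_dim mult_assoc_dim)
    then show ?thesis unfolding SO_minus_2_delta[OF p(2)] .
  qed
  moreover have "(mat_inv A)\<^sup>T\<^sup>T * (A * (h\<^sup>T * i\<^sup>T * eta_mat * i)) = (i * h)\<^sup>T * eta_mat * i"
  proof -
    have "mat_inv A * (A * (h\<^sup>T * i\<^sup>T * eta_mat * i)) = h\<^sup>T * i\<^sup>T * eta_mat * i"
      by (rule mat_inv_mult_cancel(1)[OF p(1)]) (simp only: dims)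
    then show ?thesis by (simp only: dims transpose_mult_dim mult_assoc_dim transpose_transpose)
  qed
  ultimately have "preserves_form m g"
    using preserves_form_blk_iff[OF b(1) b(5) b(8) b(7)] p(2,5) AT unfolding b by simp
  then show "g \<in> Qc m" unfolding Qc_def using b p(2) by simp
next
  fix g assume g: "g \<in> Qc m"
  note gc = Qc_carrier[OF g]
  define A X Y D E i where d: "A = blk g 0 m 0 m" "X = blk g 0 m m m" "Y = blk g 0 m (2 * m) 2"
    "D = blk g m m m m" "E = blk g (2 * m) 2 m m" "i = blk g (2 * m) 2 (2 * m) 2"
  have z: "blk g m m 0 m = 0\<^sub>m m m" "blk g (2 * m) 2 0 m = 0\<^sub>m 2 m" "blk g m m (2 * m) 2 = 0\<^sub>m m 2"
    and i: "i \<in> SO_minus_2 \<kappa>" and pres: "preserves_form m g" using g by (auto simp: Qc_def d)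
  have c: "A \<in> carrier_mat m m" "X \<in> carrier_mat m m" "Y \<in> carrier_mat m 2" "D \<in> carrier_mat m m"
    "E \<in> carrier_mat 2 m" by (auto simp: d)
  note ic = SO_minus_2_carrier[OF i] and iG = SO_minus_2_GL[OF i]
  from preserves_form_blk_iff[OF gc z] i pres have
    eq: "A\<^sup>T * D = 1\<^sub>m m" "alternating_mat (X\<^sup>T * D + E\<^sup>T * delta_mat \<kappa> * E)" "D\<^sup>T * Y = E\<^sup>T * eta_mat * i"
    by (auto simp: d)
  have AT: "A\<^sup>T \<in> GL m" using GL_I[OF _ c(4) eq(1)] c by simp
  then have AG: "A \<in> GL m" using GL_transpose[OF AT] by simp
  note dims = mat_dims GL_dim[OF AG] GL_dim[OF iG] carrier_matD[OF c(2)] carrier_matD[OF c(3)] carrier_matD[OF c(4)]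
    carrier_matD[OF c(5)] delta_mat_dim eta_mat_dim
  have "A\<^sup>T * (mat_inv A)\<^sup>T = 1\<^sub>m m"
    using transpose_mult[OF mat_inv(1)[OF AG] c(1)] mat_inv(3)[OF AG] by (metis transpose_one)
  then have D: "D = (mat_inv A)\<^sup>T"
    using GL_mult_cancel_left[OF AT c(4), of "(mat_inv A)\<^sup>T"] eq(1) mat_inv(1)[OF AG] by simp
  \<comment> \<open>The blocks of the product are A B and i h, so \<open>B\<close> and
    \<open>h\<close> are recovered by dividing on the left.\<close>
  define B h where Bh: "B = mat_inv A * X" "h = mat_inv i * E"
  have Bhc: "B \<in> carrier_mat m m" "h \<in> carrier_mat 2 m" by (auto simp: Bh dims)
  have AB: "A * B = X" unfolding Bh by (rule mat_inv_mult_cancel(2)[OF AG]) (simp add: dims)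
  have ih: "i * h = E" unfolding Bh by (rule mat_inv_mult_cancel(2)[OF iG]) (simp add: dims)
  have XD: "X\<^sup>T * D = B\<^sup>T"
    unfolding D Bh by (simp only: dims transpose_mult_dim)
  have Eh: "E\<^sup>T * delta_mat \<kappa> * E = h\<^sup>T * delta_mat \<kappa> * h"
  proof -
    have "(i * h)\<^sup>T * delta_mat \<kappa> * (i * h) = h\<^sup>T * (i\<^sup>T * delta_mat \<kappa> * i) * h"
      by (simp only: dims carrier_matD[OF Bhc(2)] transpose_mult_dim mult_assoc_dim)
    then show ?thesis unfolding SO_minus_2_delta[OF i] ih .
  qed
  have Yeq: "A * (h\<^sup>T * i\<^sup>T * eta_mat * i) = Y"
  proof -
    have "h\<^sup>T * i\<^sup>T * eta_mat * i = (i * h)\<^sup>T * eta_mat * i"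
      by (simp only: dims carrier_matD[OF Bhc(2)] transpose_mult_dim mult_assoc_dim)
    also have "\<dots> = D\<^sup>T * Y" unfolding ih eq(3) ..
    also have "\<dots> = mat_inv A * Y" unfolding D by simp
    finally show ?thesis using mat_inv_mult_cancel(2)[OF AG] dims by metis
  qed
  note b = blk_levi_unip[OF AG ic Bhc]
  have "g = Q_levi m A i * Q_unip m i B h"
  proof (rule blk_ext[OF gc b(1)])
    fix k r j c assume "(k, r) \<in> {(0, m), (m, m), (2 * m, 2)}" "(j, c) \<in> {(0, m), (m, m), (2 * m, 2)}"
    then show "blk g k r j c = blk (Q_levi m A i * Q_unip m i B h) k r j c"
      by (elim insertE emptyE; clarify; unfold b AB ih Yeq D[symmetric]; simp add: d z)
  qed
  moreover have "alternating_mat (B\<^sup>T + h\<^sup>T * delta_mat \<kappa> * h)" using eq(2) unfolding XD Eh .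
  ultimately show "g \<in> Q_minus \<kappa> (Suc m)" unfolding Q_minus_def using AG i Bhc by auto
qed

lemma alternating_mat_transpose: "alternating_mat (A :: 'a mat) \<Longrightarrow> alternating_mat A\<^sup>T"
  by (auto simp: alternating_mat_def)

lemma bij_betw_qmat:
  "bij_betw (\<lambda>(A, i, h, C). qmat m A i h C) (GL m \<times> SO_minus_2 \<kappa> \<times> carrier_mat 2 m \<times> Alt m) (Qc m)"
  unfolding bij_betw_def
proof
  let ?d = "delta_mat \<kappa>" and ?P = "GL m \<times> SO_minus_2 \<kappa> \<times> carrier_mat 2 m \<times> Alt m"
  let ?B = "\<lambda>h C. C + h\<^sup>T * ?d\<^sup>T * h"
  have hdh: "h\<^sup>T * ?d\<^sup>T * h \<in> carrier_mat m m" if "h \<in> carrier_mat 2 m" for h using that by (auto intro!: carrier_matI)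
  have T: "(B\<^sup>T + h\<^sup>T * ?d * h)\<^sup>T = B + h\<^sup>T * ?d\<^sup>T * h" if "B \<in> carrier_mat m m" "h \<in> carrier_mat 2 m" for B h
  proof -
    have "(B\<^sup>T + h\<^sup>T * ?d * h)\<^sup>T = B\<^sup>T\<^sup>T + (h\<^sup>T * ?d * h)\<^sup>T" by (rule transpose_add[of _ m m]) (use that in \<open>auto intro!: carrier_matI\<close>)
    also have "\<dots> = B + h\<^sup>T * ?d\<^sup>T * h"
      by (simp only: mat_dims carrier_matD[OF that(2)] delta_mat_dim transpose_mult_dim mult_assoc_dim transpose_transpose)
    finally show ?thesis .
  qed
  show "inj_on (\<lambda>(A, i, h, C). qmat m A i h C) ?P"
  proof (rule inj_onI)
    fix u v assume uv: "u \<in> ?P" "v \<in> ?P" "(\<lambda>(A, i, h, C). qmat m A i h C) u = (\<lambda>(A, i, h, C). qmat m A i h C) v"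
    obtain A i h C where u: "u = (A, i, h, C)" by (cases u)
    obtain A' i' h' C' where v: "v = (A', i', h', C')" by (cases v)
    from uv have p: "A \<in> GL m" "i \<in> SO_minus_2 \<kappa>" "h \<in> carrier_mat 2 m" "C \<in> Alt m"
      and p': "A' \<in> GL m" "i' \<in> SO_minus_2 \<kappa>" "h' \<in> carrier_mat 2 m" "C' \<in> Alt m"
      and eq: "qmat m A i h C = qmat m A' i' h' C'" by (auto simp: u v)
    have Cc: "C \<in> carrier_mat m m" "C' \<in> carrier_mat m m" using p p' by (auto simp: Alt_def)
    have Bc: "?B h C \<in> carrier_mat m m" "?B h' C' \<in> carrier_mat m m" using hdh p p' Cc by auto
    note b = blk_levi_unip[OF p(1) SO_minus_2_carrier[OF p(2)] Bc(1) p(3), folded qmat_def]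
      and b' = blk_levi_unip[OF p'(1) SO_minus_2_carrier[OF p'(2)] Bc(2) p'(3), folded qmat_def]
    have A: "A = A'" and i: "i = i'" and AB: "A * ?B h C = A' * ?B h' C'" and ih: "i * h = i' * h'"
      using b b' eq by metis+
    have h: "h = h'" using GL_mult_cancel_left[OF SO_minus_2_GL[OF p(2)] p(3) p'(3)] ih i by simp
    have "?B h C = ?B h' C'" using GL_mult_cancel_left[OF p(1) Bc] AB A by simp
    then have "C = C'" unfolding h using mat_add_cancel(1)[OF _ hdh[OF p'(3)]] Cc by metis
    then show "u = v" using A i h by (simp add: u v)
  qed
  show "(\<lambda>(A, i, h, C). qmat m A i h C) ` ?P = Qc m"
  proof (intro equalityI subsetI)
    fix g assume "g \<in> (\<lambda>(A, i, h, C). qmat m A i h C) ` ?P"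
    then obtain A i h C where p: "A \<in> GL m" "i \<in> SO_minus_2 \<kappa>" "h \<in> carrier_mat 2 m" "C \<in> Alt m"
      and g: "g = qmat m A i h C" by auto
    have C: "C \<in> carrier_mat m m" "alternating_mat C" using p by (auto simp: Alt_def)
    have Bc: "?B h C \<in> carrier_mat m m" using C hdh[OF p(3)] by simp
    have "?B h C + h\<^sup>T * ?d\<^sup>T * h = C" using mat_add_cancel(1)[OF C(1) hdh[OF p(3)]] .
    then have "((?B h C)\<^sup>T + h\<^sup>T * ?d * h)\<^sup>T = C" using T[OF Bc p(3)] by simp
    then have "alternating_mat ((?B h C)\<^sup>T + h\<^sup>T * ?d * h)" using alternating_mat_transpose[OF C(2)] by (metis transpose_transpose)
    with p Bc show "g \<in> Qc m" unfolding Qc_eq Q_minus_def g qmat_def by auto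
  next
    fix g assume "g \<in> Qc m"
    then obtain A i B h where p: "A \<in> GL m" "i \<in> SO_minus_2 \<kappa>" "B \<in> carrier_mat m m" "h \<in> carrier_mat 2 m"
      "alternating_mat (B\<^sup>T + h\<^sup>T * delta_mat \<kappa> * h)" and g: "g = Q_levi m A i * Q_unip m i B h"
      unfolding Qc_eq by (auto simp: Q_minus_def)
    let ?C = "B + h\<^sup>T * ?d\<^sup>T * h"
    have "alternating_mat ?C" using alternating_mat_transpose[OF p(5)] unfolding T[OF p(3,4)] .
    then have C: "?C \<in> Alt m" using p hdh by (simp add: Alt_def)
    have "?C + h\<^sup>T * ?d\<^sup>T * h = B" using mat_add_cancel(1)[OF p(3) hdh[OF p(4)]] .
    then have "g = qmat m A i h ?C" unfolding g qmat_def by simp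
    with p C show "g \<in> (\<lambda>(A, i, h, C). qmat m A i h C) ` ?P" by (intro image_eqI[of _ _ "(A, i, h, ?C)"]) auto
  qed
qed

section \<open>The permutation matrices sigma\<close>

lemma sigma_perm_Suc: "sigma_perm (Suc m) s j = (if j < s then m + j else if m \<le> j \<and> j < m + s then j - m else j)"
  by (simp add: sigma_perm_def)

lemma sigma_perm_less: "s \<le> m \<Longrightarrow> j < 2 * m + 2 \<Longrightarrow> sigma_perm (Suc m) s j < 2 * m + 2"
  by (auto simp: sigma_perm_Suc)

lemma sigma_perm_involution: "s \<le> m \<Longrightarrow> sigma_perm (Suc m) s (sigma_perm (Suc m) s j) = j"
  by (auto simp: sigma_perm_Suc)

lemma sigma_mat_carrier [simp]: "sigma_mat (Suc m) s \<in> carrier_mat (2 * m + 2) (2 * m + 2)"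
  unfolding sigma_mat_def by (rule carrier_matI) auto

lemma sigma_mat_index:
  assumes "r < 2 * m + 2" "c < 2 * m + 2" "s \<le> m"
  shows "sigma_mat (Suc m) s $$ (r, c) = (if c = sigma_perm (Suc m) s r then 1 else 0)"
  using assms sigma_perm_involution[of s m] by (auto simp: sigma_mat_def)

lemma sigma_mult_index:
  assumes "x \<in> carrier_mat (2 * m + 2) p" "r < 2 * m + 2" "c < p" "s \<le> m"
  shows "(sigma_mat (Suc m) s * x) $$ (r, c) = (x :: 'a mat) $$ (sigma_perm (Suc m) s r, c)"
proof -
  have "(sigma_mat (Suc m) s * x) $$ (r, c) = (\<Sum>l<2 * m + 2. sigma_mat (Suc m) s $$ (r, l) * x $$ (l, c))"
    using assms by (intro mult_mat_index) auto
  also have "\<dots> = (\<Sum>l<2 * m + 2. if l = sigma_perm (Suc m) s r then x $$ (l, c) else 0)"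
    using assms by (intro sum.cong) (auto simp: sigma_mat_index)
  also have "\<dots> = x $$ (sigma_perm (Suc m) s r, c)" using sigma_perm_less[OF assms(4,2)] by simp
  finally show ?thesis .
qed

lemma mult_sigma_index:
  assumes "x \<in> carrier_mat p (2 * m + 2)" "r < p" "c < 2 * m + 2" "s \<le> m"
  shows "((x :: 'a mat) * sigma_mat (Suc m) s) $$ (r, c) = x $$ (r, sigma_perm (Suc m) s c)"
proof -
  have "(x * sigma_mat (Suc m) s) $$ (r, c) = (\<Sum>l<2 * m + 2. x $$ (r, l) * sigma_mat (Suc m) s $$ (l, c))"
    using assms by (intro mult_mat_index) auto
  also have "\<dots> = (\<Sum>l<2 * m + 2. if l = sigma_perm (Suc m) s c then x $$ (r, l) else 0)"
    using assms sigma_perm_involution[of s m] by (intro sum.cong) (auto simp: sigma_mat_index)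
  also have "\<dots> = x $$ (r, sigma_perm (Suc m) s c)" using sigma_perm_less[OF assms(4,3)] by simp
  finally show ?thesis .
qed

lemma sigma_conj_index:
  assumes "x \<in> carrier_mat (2 * m + 2) (2 * m + 2)" "r < 2 * m + 2" "c < 2 * m + 2" "s \<le> m"
  shows "(sigma_mat (Suc m) s * x * sigma_mat (Suc m) s) $$ (r, c) =
    (x :: 'a mat) $$ (sigma_perm (Suc m) s r, sigma_perm (Suc m) s c)"
proof -
  have "sigma_mat (Suc m) s * x \<in> carrier_mat (2 * m + 2) (2 * m + 2)"
    by (rule mult_carrier_mat[OF sigma_mat_carrier assms(1)])
  from mult_sigma_index[OF this assms(2,3,4)] show ?thesis
    using sigma_mult_index[OF assms(1,2) sigma_perm_less[OF assms(4,3)] assms(4)] by simp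
qed

lemma sigma_mat_square:
  assumes s: "s \<le> m"
  shows "sigma_mat (Suc m) s * sigma_mat (Suc m) s = (1\<^sub>m (2 * m + 2) :: 'a mat)"
proof (rule eq_matI)
  fix r c assume rc: "r < dim_row (1\<^sub>m (2 * m + 2) :: 'a mat)" "c < dim_col (1\<^sub>m (2 * m + 2) :: 'a mat)"
  then show "(sigma_mat (Suc m) s * sigma_mat (Suc m) s) $$ (r, c) = (1\<^sub>m (2 * m + 2) :: 'a mat) $$ (r, c)"
    using sigma_mult_index[OF sigma_mat_carrier, of r m c s s] sigma_perm_less[OF s, of r] s
    by (auto simp: sigma_mat_index sigma_perm_involution simp del: index_mult_mat(1))
qed (auto simp: carrier_matD[OF sigma_mat_carrier])

lemma sigma_mat_transpose: "s \<le> m \<Longrightarrow> (sigma_mat (Suc m) s)\<^sup>T = (sigma_mat (Suc m) s :: 'a mat)"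
  by (rule eq_matI)
    (auto simp: carrier_matD[OF sigma_mat_carrier] sigma_mat_index sigma_perm_involution)

lemma Mform_index:
  assumes "r < 2 * m + 2" "c < 2 * m + 2"
  shows "Mform m $$ (r, c) = (if r < m \<and> c = m + r then 1
     else if 2 * m \<le> r \<and> 2 * m \<le> c then delta_mat \<kappa> $$ (r - 2 * m, c - 2 * m) else 0)"
  using assms unfolding Mform_def nine_block_mat_def append_rows_def append_cols_def mult_2
  by (auto simp: add.commute)

text \<open>The permutation exchanges r and m + r for r < s and fixes every other index, so each
  hyperbolic pair is mapped to itself. Its two members may be swapped, which is why both orders
  appear.\<close>

lemma sigma_perm_partner:
  assumes "s \<le> m" "r < 2 * m" "c < 2 * m"
  defines "p \<equiv> sigma_perm (Suc m) s"
  shows "(p r < m \<and> p c = m + p r) \<or> (p c < m \<and> p r = m + p c) \<longleftrightarrow> (r < m \<and> c = m + r) \<or> (c < m \<and> r = m + c)"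
  using assms(1-3) unfolding p_def sigma_perm_Suc
  by (cases "r < s"; cases "c < s"; cases "m \<le> r \<and> r < m + s"; cases "m \<le> c \<and> c < m + s"; simp; linarith)

lemma preserves_form_sigma:
  assumes s: "s \<le> m"
  shows "preserves_form m (sigma_mat (Suc m) s)"
proof -
  let ?S = "sigma_mat (Suc m) s :: 'a mat" and ?p = "sigma_perm (Suc m) s"
  let ?Z = "?S * Mform m * ?S + Mform m"
  have Zi: "?Z $$ (r, c) = Mform m $$ (?p r, ?p c) + Mform m $$ (r, c)" if "r < 2 * m + 2" "c < 2 * m + 2" for r c
    using that sigma_conj_index[OF Mform_carrier that s]
    by (simp add: carrier_matD[OF Mform_carrier] del: index_mult_mat(1) assoc_mult_mat)
  \<comment> \<open>The symmetrized form and the diagonal are unchanged, which is what an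
    alternating difference requires.\<close>
  have sym: "Mform m $$ (?p r, ?p c) + Mform m $$ (?p c, ?p r) = Mform m $$ (r, c) + Mform m $$ (c, r)"
    "Mform m $$ (?p r, ?p r) = Mform m $$ (r, r)"
    if rc: "r < 2 * m + 2" "c < 2 * m + 2" for r c
  proof -
    note less = sigma_perm_less[OF s rc(1)] sigma_perm_less[OF s rc(2)]
    have J: "Mform m $$ (x, y) + Mform m $$ (y, x) =
      (if (x < m \<and> y = m + x) \<or> (y < m \<and> x = m + y) then 1 else 0)" if "x < 2 * m" "y < 2 * m" for x y
      using that by (auto simp: Mform_index)
    have out: "Mform m $$ (x, y) = 0" "Mform m $$ (y, x) = 0" if "2 * m \<le> x" "y < 2 * m" "x < 2 * m + 2" for x y
      using that by (auto simp: Mform_index)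
    have big: "?p x = x" if "2 * m \<le> x" for x using that s by (auto simp: sigma_perm_Suc)
    have small: "?p x < 2 * m" if "x < 2 * m" for x using that s by (auto simp: sigma_perm_Suc)
    show "Mform m $$ (?p r, ?p c) + Mform m $$ (?p c, ?p r) = Mform m $$ (r, c) + Mform m $$ (c, r)"
    proof (cases "r < 2 * m"; cases "c < 2 * m")
      assume "r < 2 * m" "c < 2 * m"
      then show ?thesis using sigma_perm_partner[OF s, of r c] by (simp only: J small)
    next
      assume "r < 2 * m" "\<not> c < 2 * m"
      then show ?thesis using out[of c r] out[of c "?p r"] small[of r] big[of c] rc by simp
    next
      assume "\<not> r < 2 * m" "c < 2 * m"
      then show ?thesis using out[of r c] out[of r "?p c"] small[of c] big[of r] rc by simp
    next
      assume "\<not> r < 2 * m" "\<not> c < 2 * m"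
      then show ?thesis by (simp add: big)
    qed
    show "Mform m $$ (?p r, ?p r) = Mform m $$ (r, r)"
    proof (cases "r < 2 * m")
      case True
      have "Mform m $$ (x, x) = 0" if "x < 2 * m" for x using that by (auto simp: Mform_index)
      with True small show ?thesis by simp
    qed (simp add: big)
  qed
  have "?Z $$ (r, c) = ?Z $$ (c, r)" if rc: "r < 2 * m + 2" "c < 2 * m + 2" for r c
  proof -
    have "x + y = z + w" if "x + z = y + w" for x y z w :: 'a
    proof -
      have "x + y = (x + z) + z + y" by (simp add: add.assoc)
      also have "\<dots> = z + w" unfolding that by (simp add: add_ac)
      finally show ?thesis .
    qed
    from this[OF sym(1)[OF rc]] show ?thesis unfolding Zi[OF rc] Zi[OF rc(2,1)] .
  qed
  moreover have "?Z $$ (r, r) = 0" if "r < 2 * m + 2" for r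
    unfolding Zi[OF that that] sym(2)[OF that that] by simp
  moreover have "?Z \<in> carrier_mat (2 * m + 2) (2 * m + 2)" by simp
  ultimately have "alternating_mat ?Z" using alternating_mat_iff by blast
  then show ?thesis by (simp add: preserves_form_def sigma_mat_transpose[OF s])
qed

lemma sum_blocks:
  fixes f :: "nat \<Rightarrow> 'b::comm_monoid_add"
  shows "(\<Sum>k<2 * (s + t) + 2. f k) = (\<Sum>k<s. f k) + (\<Sum>k<t. f (s + k)) + (\<Sum>k<s. f (s + t + k)) +
     (\<Sum>k<t. f (s + t + (s + k))) + (\<Sum>k<2. f (2 * (s + t) + k))"
proof -
  have "2 * (s + t) = s + t + (s + t)" by simp
  then show ?thesis by (simp only: sum_lessThan_add add.assoc)
qed

text \<open>Right multiplication by \<sigma> permutes columns, so the diagonal entries k and m + k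
  with k < s come from the off-diagonal blocks. On \<open>Q\<close> the lower of these blocks is
  zero and the upper one is A B; this is how the alternating parameter gets into the trace.\<close>

lemma mat_trace_mult_sigma:
  assumes x: "(x :: 'a mat) \<in> carrier_mat (2 * m + 2) (2 * m + 2)" and m: "m = s + t"
  shows "mat_trace (x * sigma_mat (Suc m) s) =
    (\<Sum>k<s. blk x 0 m m m $$ (k, k)) + (\<Sum>k<s. blk x m m 0 m $$ (k, k)) +
    (\<Sum>k<t. blk x 0 m 0 m $$ (s + k, s + k)) + (\<Sum>k<t. blk x m m m m $$ (s + k, s + k)) +
    mat_trace (blk x (2 * m) 2 (2 * m) 2)"
proof -
  have s: "s \<le> m" using m by simp
  have "mat_trace (x * sigma_mat (Suc m) s) = (\<Sum>k<2 * m + 2. (x * sigma_mat (Suc m) s) $$ (k, k))"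
    unfolding mat_trace_def using x by (simp add: carrier_matD[OF x])
  also have "\<dots> = (\<Sum>k<2 * m + 2. x $$ (k, sigma_perm (Suc m) s k))"
    using mult_sigma_index[OF x _ _ s] by (intro sum.cong) auto
  also have "\<dots> = (\<Sum>k<s. x $$ (k, m + k)) + (\<Sum>k<t. x $$ (s + k, s + k)) + (\<Sum>k<s. x $$ (m + k, k)) +
     (\<Sum>k<t. x $$ (m + (s + k), m + (s + k))) + (\<Sum>k<2. x $$ (2 * m + k, 2 * m + k))"
    unfolding m sum_blocks sigma_perm_Suc
    by (intro arg_cong2[of _ _ _ _ "(+)"] sum.cong) auto
  also have "\<dots> = (\<Sum>k<s. blk x 0 m m m $$ (k, k)) + (\<Sum>k<s. blk x m m 0 m $$ (k, k)) +
    (\<Sum>k<t. blk x 0 m 0 m $$ (s + k, s + k)) + (\<Sum>k<t. blk x m m m m $$ (s + k, s + k)) +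
    mat_trace (blk x (2 * m) 2 (2 * m) 2)"
    by (simp add: m mat_trace_def add_ac)
  finally show ?thesis .
qed

section \<open>The element rho and conjugation by it\<close>

definition rho2 :: "'a mat" where
  "rho2 = mat_of_rows_list 2 [[1, 1], [0, 1]]"

lemma rho2_carrier [simp]: "rho2 \<in> carrier_mat 2 2"
  and rho2_dim [simp]: "dim_row rho2 = 2" "dim_col rho2 = 2"
  and rho2_index: "rho2 $$ (0, 0) = 1" "rho2 $$ (0, Suc 0) = 1" "rho2 $$ (Suc 0, 0) = 0" "rho2 $$ (Suc 0, Suc 0) = 1"
  by (auto simp: rho2_def mat_of_rows_list_def numeral_2_eq_2)

lemma rho_mat_carrier [simp]: "(rho_mat (Suc m) :: 'a mat) \<in> carrier_mat (2 * m + 2) (2 * m + 2)"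
  unfolding rho_mat_def rho2_def[symmetric] by auto

lemma blk_rho:
  "blk (rho_mat (Suc m)) 0 m 0 m = (1\<^sub>m m :: 'a mat)" "blk (rho_mat (Suc m)) 0 m m m = (0\<^sub>m m m :: 'a mat)"
  "blk (rho_mat (Suc m)) 0 m (2 * m) 2 = (0\<^sub>m m 2 :: 'a mat)" "blk (rho_mat (Suc m)) m m 0 m = (0\<^sub>m m m :: 'a mat)"
  "blk (rho_mat (Suc m)) m m m m = (1\<^sub>m m :: 'a mat)" "blk (rho_mat (Suc m)) m m (2 * m) 2 = (0\<^sub>m m 2 :: 'a mat)"
  "blk (rho_mat (Suc m)) (2 * m) 2 0 m = (0\<^sub>m 2 m :: 'a mat)" "blk (rho_mat (Suc m)) (2 * m) 2 m m = (0\<^sub>m 2 m :: 'a mat)"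
  "blk (rho_mat (Suc m)) (2 * m) 2 (2 * m) 2 = rho2"
  unfolding rho_mat_def rho2_def[symmetric] by (auto intro!: eq_matI)

lemma rho2_square: "rho2 * rho2 = 1\<^sub>m 2"
  by (intro eq_matI) (auto simp: mult_2x2_index less_2_cases_iff rho2_index simp del: index_mult_mat(1))

text \<open>In terms of x + y \<omega> this is the Galois conjugation \<omega> -> \<omega> + 1 of
  the quadratic extension, which preserves the norm.\<close>

lemma rho2_conj_so2: "rho2 * so2 (x, y) * rho2 = so2 (x + y, y)"
proof (rule eq_matI)
  fix r c assume "r < dim_row (so2 (x + y, y))" "c < dim_col (so2 (x + y, y))"
  then have rc: "r < 2" "c < 2" by (auto simp: carrier_matD[OF so2_carrier])
  have "rho2 * so2 (x, y) \<in> carrier_mat 2 2" by (rule mult_carrier_mat[OF rho2_carrier so2_carrier])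
  with rc show "(rho2 * so2 (x, y) * rho2) $$ (r, c) = so2 (x + y, y) $$ (r, c)"
    by (auto simp: mult_2x2_index less_2_cases_iff rho2_index so2_index add_ac simp del: index_mult_mat(1) assoc_mult_mat)
qed (auto simp: carrier_matD[OF so2_carrier])

lemma rho2_conj_SO_minus_2: "i \<in> SO_minus_2 \<kappa> \<Longrightarrow> rho2 * i * rho2 \<in> SO_minus_2 \<kappa>"
proof -
  assume "i \<in> SO_minus_2 \<kappa>"
  then obtain x y where i: "i = so2 (x, y)" "theta (x, y) = 1" by (auto simp: SO_minus_2_eq)
  have "theta (x + y, y) = theta (x, y)" by (simp add: theta_def square_add power2_eq_square algebra_simps)
  then show ?thesis unfolding i rho2_conj_so2 SO_minus_2_iff using i by simp
qed

text \<open>Both diagonal entries of \<open>rho2 * so2 (x, y)\<close> are x + y.\<close>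

lemma mat_trace_rho2_SO: "i \<in> SO_minus_2 \<kappa> \<Longrightarrow> mat_trace (rho2 * i) = 0"
  by (auto simp: SO_minus_2_eq mat_trace_def numeral_2_eq_2 mult_2x2_index[unfolded numeral_2_eq_2] rho2_index so2_index
    carrier_matD[OF so2_carrier] add_ac rho2_carrier[unfolded numeral_2_eq_2] so2_carrier[unfolded numeral_2_eq_2]
    rho2_dim[unfolded numeral_2_eq_2] simp del: index_mult_mat(1))

lemma rho_mat_square: "rho_mat (Suc m) * rho_mat (Suc m) = (1\<^sub>m (2 * m + 2) :: 'a mat)"
proof (rule blk_ext[of _ m])
  fix i r j c assume "(i, r) \<in> {(0, m), (m, m), (2 * m, 2)}" "(j, c) \<in> {(0, m), (m, m), (2 * m, 2)}"
  moreover have one: "blk (1\<^sub>m (2 * m + 2)) i r i r = (1\<^sub>m r :: 'a mat)" if "i + r \<le> 2 * m + 2" for i r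
    using that by (intro eq_matI) auto
  moreover have zero: "blk (1\<^sub>m (2 * m + 2)) i r j c = (0\<^sub>m r c :: 'a mat)"
    if "i + r \<le> j \<or> j + c \<le> i" "i + r \<le> 2 * m + 2" "j + c \<le> 2 * m + 2" for i r j c
    using that by (intro eq_matI) auto
  ultimately show "blk (rho_mat (Suc m) * rho_mat (Suc m)) i r j c = blk (1\<^sub>m (2 * m + 2) :: 'a mat) i r j c"
    by (elim insertE emptyE; simp add: blk_mult3[OF rho_mat_carrier rho_mat_carrier] blk_rho rho2_square one zero)
qed (use mult_carrier_mat[OF rho_mat_carrier rho_mat_carrier] in auto)

lemma preserves_form_rho: "preserves_form m (rho_mat (Suc m))"
proof -
  let ?R = "rho_mat (Suc m) :: 'a mat"
  let ?Z = "?R\<^sup>T * Mform m * ?R + Mform m"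
  have gM: "?R\<^sup>T * Mform m * ?R \<in> carrier_mat (2 * m + 2) (2 * m + 2)"
    using rho_mat_carrier Mform_carrier by (metis mult_carrier_mat transpose_carrier_mat)
  then have Zc: "?Z \<in> carrier_mat (2 * m + 2) (2 * m + 2)" by simp
  have alt0: "alternating_mat (0\<^sub>m n n :: 'a mat)" for n by (simp add: alternating_mat_iff[of _ n])
  have rdc: "rho2\<^sup>T * delta_mat \<kappa> * rho2 \<in> carrier_mat 2 2" by (auto intro!: carrier_matI)
  \<comment> \<open>\<rho> preserves the quadratic form but not its matrix: \<delta> changes by the
    alternating matrix \<eta>.\<close>
  have rdr: "rho2\<^sup>T * delta_mat \<kappa> * rho2 + delta_mat \<kappa> = eta_mat"
  proof (rule eq_matI)
    fix r c assume "r < dim_row (eta_mat :: 'a mat)" "c < dim_col (eta_mat :: 'a mat)"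
    then have rc: "r < 2" "c < 2" by auto
    have "rho2\<^sup>T \<in> carrier_mat 2 2" by simp
    moreover have "rho2\<^sup>T * delta_mat \<kappa> \<in> carrier_mat 2 2" by (auto intro!: carrier_matI)
    ultimately show "(rho2\<^sup>T * delta_mat \<kappa> * rho2 + delta_mat \<kappa>) $$ (r, c) = eta_mat $$ (r, c)"
      using rc by (auto simp: mult_2x2_index less_2_cases_iff rho2_index delta_mat_index eta_mat_index add_ac
        simp del: index_mult_mat(1) assoc_mult_mat)
  qed auto
  have "alternating_mat (eta_mat :: 'a mat)"
    by (auto simp: alternating_mat_iff[of _ 2] less_2_cases_iff eta_mat_index)
  then have "alternating_mat ?Z"
    unfolding alternating_mat_blk_iff[OF Zc]
    by (simp add: blk_add[OF gM Mform_carrier] blk_form[OF rho_mat_carrier] blk_rho alt0 rdr left_add_zero_mat[OF rdc] del: assoc_mult_mat)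
  then show ?thesis by (simp add: preserves_form_def)
qed

lemma rho_conj_Qc:
  assumes x: "x \<in> Qc m"
  shows "rho_mat (Suc m) * x * rho_mat (Suc m) \<in> Qc m"
proof -
  let ?R = "rho_mat (Suc m) :: 'a mat"
  note xc = Qc_carrier[OF x]
  have Rx: "?R * x \<in> carrier_mat (2 * m + 2) (2 * m + 2)" by (rule mult_carrier_mat[OF rho_mat_carrier xc])
  note m1 = blk_mult3[OF Rx rho_mat_carrier] and m2 = blk_mult3[OF rho_mat_carrier xc]
  have z: "blk x m m 0 m = 0\<^sub>m m m" "blk x (2 * m) 2 0 m = 0\<^sub>m 2 m" "blk x m m (2 * m) 2 = 0\<^sub>m m 2"
    and i: "blk x (2 * m) 2 (2 * m) 2 \<in> SO_minus_2 \<kappa>" and pres: "preserves_form m x"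
    using x by (auto simp: Qc_def)
  have c1: "rho2 * blk x (2 * m) 2 (2 * m) 2 \<in> carrier_mat 2 2"
    and c2: "rho2 * blk x (2 * m) 2 (2 * m) 2 * rho2 \<in> carrier_mat 2 2" by (auto intro!: carrier_matI)
  have "preserves_form m (?R * x * ?R)" using pres preserves_form_rho by (intro preserves_form_mult)
  then show ?thesis
    using rho2_conj_SO_minus_2[OF i] unfolding Qc_def
    by (simp add: m1 m2 blk_rho z left_add_zero_mat[OF c1] left_add_zero_mat[OF c2] del: assoc_mult_mat)
qed

end

section \<open>The stabilizer of a double coset\<close>

lemma bij_betw_split_cols:
  "bij_betw (\<lambda>h. (blk h 0 n 0 s, blk h 0 n s t)) (carrier_mat n (s + t)) (carrier_mat n s \<times> carrier_mat n t)"
proof (rule bij_betwI[where g = "\<lambda>(a, b). mat n (s + t) (\<lambda>(i, j). if j < s then a $$ (i, j) else b $$ (i, j - s))"])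
  fix h :: "'a mat" assume "h \<in> carrier_mat n (s + t)"
  then show "(case (blk h 0 n 0 s, blk h 0 n s t) of (a, b) \<Rightarrow>
      mat n (s + t) (\<lambda>(i, j). if j < s then a $$ (i, j) else b $$ (i, j - s))) = h"
    by (auto intro!: eq_matI)
qed (auto intro!: eq_matI)

lemma sum_split_cols:
  fixes f :: "'a::finite mat \<Rightarrow> 'b::comm_semiring_1"
  shows "(\<Sum>h\<in>carrier_mat n (s + t). f (blk h 0 n 0 s)) = of_nat (CARD('a) ^ (n * t)) * (\<Sum>h\<in>carrier_mat n s. f h)"
proof -
  have "(\<Sum>h\<in>carrier_mat n (s + t). f (blk h 0 n 0 s)) = (\<Sum>p\<in>carrier_mat n s \<times> (carrier_mat n t :: 'a mat set). f (fst p))"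
    using sum.reindex_bij_betw[OF bij_betw_split_cols[where 'a = 'a], of "\<lambda>p. f (fst p)" n s t] by simp
  also have "\<dots> = (\<Sum>h\<in>carrier_mat n s. \<Sum>h'\<in>(carrier_mat n t :: 'a mat set). f h)"
    by (subst sum.cartesian_product) (simp add: case_prod_beta)
  also have "\<dots> = of_nat (CARD('a) ^ (n * t)) * (\<Sum>h\<in>carrier_mat n s. f h)"
    by (simp add: card_carrier_mat sum_distrib_left)
  finally show ?thesis .
qed

lemma card_lower_block_GL:
  "card {A \<in> GL (s + t) :: 'a::{field,finite} mat set. \<forall>i<s. \<forall>j\<in>{s..<s + t}. A $$ (i, j) = 0} =
    card (GL s :: 'a mat set) * CARD('a) ^ (t * s) * card (GL t :: 'a mat set)"
  using sum_lower_block_GL[where f = "\<lambda>_ :: 'a mat. 1 :: nat" and s = s and t = t] by (simp add: card_carrier_mat mult.assoc)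

context char2_character
begin

section \<open>Counting alternating matrices\<close>

lemma Alt_carrier: "C \<in> Alt m \<Longrightarrow> C \<in> carrier_mat m m"
  by (simp add: Alt_def)

lemma finite_Alt [simp]: "finite (Alt m)"
  by (rule finite_subset[OF _ finite_carrier_mat[of m m]]) (auto simp: Alt_def)

text \<open>\<open>P\<close> lists the positions above the diagonal whose entries are free; the
  diagonal is zero and the lower half is the mirror image. All positions give \<open>Alt m\<close>,
  and those in columns from \<open>s\<close> on give the matrices with zero corner.\<close>

lemma card_Alt_support:
  assumes P: "P \<subseteq> {(i, j). i < j \<and> j < m}"
  shows "card {C \<in> Alt m. \<forall>i j. i < j \<and> j < m \<and> (i, j) \<notin> P \<longrightarrow> C $$ (i, j) = 0} = q ^ card P"
proof -
  let ?L = "{C \<in> Alt m. \<forall>i j. i < j \<and> j < m \<and> (i, j) \<notin> P \<longrightarrow> C $$ (i, j) = 0}"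
  let ?F = "\<lambda>f. mat m m (\<lambda>(i, j). if (i, j) \<in> P then f (i, j) else if (j, i) \<in> P then f (j, i) else (0 :: 'a))"
  have finP: "finite P" by (rule finite_subset[OF P], rule finite_subset[of _ "{..<m} \<times> {..<m}"]) auto
  have P': "i < j" "j < m" if "(i, j) \<in> P" for i j using P that by auto
  have "bij_betw ?F (PiE P (\<lambda>_. UNIV)) ?L"
  proof (rule bij_betwI[where g = "\<lambda>C. restrict (\<lambda>p. C $$ p) P"])
    have asym: "(j, i) \<notin> P" if "(i, j) \<in> P" for i j using P'[OF that] P'(1)[of j i] by auto
    have irr: "(i, i) \<notin> P" for i using P'(1)[of i i] by blast
    show "?F \<in> PiE P (\<lambda>_. UNIV) \<rightarrow> ?L"
    proof
      fix f :: "nat \<times> nat \<Rightarrow> 'a"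
      have "alternating_mat (?F f)" using asym irr by (auto simp: alternating_mat_iff[of _ m])
      moreover have "?F f $$ (i, j) = 0" if "i < j" "j < m" "(i, j) \<notin> P" for i j
      proof -
        have "(j, i) \<notin> P" using P'(1)[of j i] that by auto
        with that show ?thesis by simp
      qed
      ultimately show "?F f \<in> ?L" unfolding Alt_def by simp
    qed
    show "(\<lambda>C. restrict (\<lambda>p. C $$ p) P) \<in> ?L \<rightarrow> PiE P (\<lambda>_. UNIV)" by auto
    show "restrict (\<lambda>p. ?F f $$ p) P = f" if "f \<in> PiE P (\<lambda>_. UNIV)" for f
    proof
      fix p show "restrict (\<lambda>p. ?F f $$ p) P p = f p"
        using that P'[of "fst p" "snd p"] by (cases p; cases "p \<in> P") (auto simp: PiE_def extensional_def)
    qed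
    show "?F (restrict (\<lambda>p. C $$ p) P) = C" if C: "C \<in> ?L" for C
    proof (rule eq_matI)
      have Cc: "C \<in> carrier_mat m m" using C by (auto simp: Alt_def)
      fix i j assume "i < dim_row C" "j < dim_col C"
      then have ij: "i < m" "j < m" using Cc by auto
      have sym: "C $$ (i, j) = C $$ (j, i)" "C $$ (i, i) = 0" using C ij by (auto simp: Alt_def alternating_mat_iff[of _ m])
      have nz: "C $$ (a, b) = 0" if "a < b" "b < m" "(a, b) \<notin> P" for a b using C that by auto
      show "?F (restrict (\<lambda>p. C $$ p) P) $$ (i, j) = C $$ (i, j)"
        using ij sym nz[of i j] nz[of j i] asym irr by (cases i j rule: linorder_cases) auto
    qed (use C in \<open>auto simp: Alt_def\<close>)
  qed
  from bij_betw_same_card[OF this] show ?thesis using finP by (simp add: card_PiE)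
qed

lemma card_upper_pairs: "card {(i, j). i < j \<and> s \<le> j \<and> j < m} = (\<Sum>j\<in>{s..<m}. j)" for s m :: nat
proof -
  have "{(i, j). i < j \<and> s \<le> j \<and> j < m} = (\<lambda>(j, i). (i, j)) ` (SIGMA j : {s..<m}. {..<j})" by force
  then have "card {(i, j). i < j \<and> s \<le> j \<and> j < m} = card (SIGMA j : {s..<m}. {..<j})"
    by (simp add: card_image inj_on_def)
  then show ?thesis by simp
qed

lemma card_Alt: "card (Alt m) = q ^ (\<Sum>j<m. j)"
proof -
  let ?P = "{(i, j). i < j \<and> j < m}"
  have "{C \<in> Alt m. \<forall>i j. i < j \<and> j < m \<and> (i, j) \<notin> ?P \<longrightarrow> C $$ (i, j) = 0} = Alt m" by auto
  then show ?thesis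
    using card_Alt_support[of ?P m] card_upper_pairs[of 0 m] by (simp add: lessThan_atLeast0)
qed

lemma card_Alt_zero_corner:
  assumes "s \<le> m"
  shows "q ^ (\<Sum>j<s. j) * card {C \<in> Alt m. \<forall>j<s. \<forall>k<s. C $$ (j, k) = 0} = card (Alt m)"
proof -
  let ?P = "{(i, j). i < j \<and> s \<le> j \<and> j < m}"
  have "{C \<in> Alt m. \<forall>j<s. \<forall>k<s. C $$ (j, k) = 0} = {C \<in> Alt m. \<forall>i j. i < j \<and> j < m \<and> (i, j) \<notin> ?P \<longrightarrow> C $$ (i, j) = 0}"
  proof (intro Collect_cong conj_cong refl)
    fix C assume C: "C \<in> Alt m"
    have sym: "C $$ (i, j) = C $$ (j, i)" "C $$ (i, i) = 0" if "i < m" "j < m" for i j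
      using C that by (auto simp: Alt_def alternating_mat_iff[of _ m])
    show "(\<forall>j<s. \<forall>k<s. C $$ (j, k) = 0) \<longleftrightarrow> (\<forall>i j. i < j \<and> j < m \<and> (i, j) \<notin> ?P \<longrightarrow> C $$ (i, j) = 0)"
    proof
      assume R: "\<forall>i j. i < j \<and> j < m \<and> (i, j) \<notin> ?P \<longrightarrow> C $$ (i, j) = 0"
      show "\<forall>j<s. \<forall>k<s. C $$ (j, k) = 0"
      proof (intro allI impI)
        fix j k assume "j < s" "k < s"
        then show "C $$ (j, k) = 0"
          using R[rule_format, of j k] R[rule_format, of k j] sym[of j k] assms by (cases j k rule: linorder_cases) auto
      qed
    qed auto
  qed
  then have "card {C \<in> Alt m. \<forall>j<s. \<forall>k<s. C $$ (j, k) = 0} = q ^ (\<Sum>j\<in>{s..<m}. j)"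
    using card_Alt_support[of ?P m] card_upper_pairs[of s m] by auto
  moreover have "(\<Sum>j<s. j) + (\<Sum>j\<in>{s..<m}. j) = (\<Sum>j<m. j)"
    using assms by (simp add: lessThan_atLeast0 sum.atLeastLessThan_concat)
  ultimately show ?thesis by (simp add: card_Alt flip: power_add)
qed

text \<open>Conjugation by \<sigma> preserves the form and fixes the lower right block, so only the
  three zero blocks have to be tested; their entries are entries of \<open>x\<close> at permuted
  indices.\<close>

lemma sigma_conj_Qc_iff:
  assumes x: "x \<in> Qc m" and s: "s \<le> m"
  shows "sigma_mat (Suc m) s * x * sigma_mat (Suc m) s \<in> Qc m \<longleftrightarrow>
    (\<forall>k<m. \<forall>l<m. x $$ (if k < s then k else m + k, if l < s then m + l else l) = 0) \<and>
    (\<forall>e<2. \<forall>l<m. x $$ (2 * m + e, if l < s then m + l else l) = 0) \<and>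
    (\<forall>k<m. \<forall>e<2. x $$ (if k < s then k else m + k, 2 * m + e) = 0)"
proof -
  let ?y = "sigma_mat (Suc m) s * x * sigma_mat (Suc m) s"
  have xc: "x \<in> carrier_mat (2 * m + 2) (2 * m + 2)" using x by (rule Qc_carrier)
  have pres: "preserves_form m ?y"
    using x s by (auto simp: Qc_def intro!: preserves_form_mult preserves_form_sigma)
  have y: "?y $$ (r, c) = x $$ (sigma_perm (Suc m) s r, sigma_perm (Suc m) s c)" if "r < 2 * m + 2" "c < 2 * m + 2" for r c
    using sigma_conj_index[OF xc that s] .
  have p: "sigma_perm (Suc m) s (m + k) = (if k < s then k else m + k)" "sigma_perm (Suc m) s k = (if k < s then m + k else k)"
    if "k < m" for k using that s by (auto simp: sigma_perm_Suc)
  have p2: "sigma_perm (Suc m) s (2 * m + e) = 2 * m + e" for e using s by (auto simp: sigma_perm_Suc)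
  have z: "blk g a b c d = 0\<^sub>m b d \<longleftrightarrow> (\<forall>k<b. \<forall>l<d. g $$ (a + k, c + l) = 0)" for g :: "'a mat" and a b c d
  proof
    assume eq: "blk g a b c d = 0\<^sub>m b d"
    show "\<forall>k<b. \<forall>l<d. g $$ (a + k, c + l) = 0"
    proof (intro allI impI)
      fix k l assume kl: "k < b" "l < d"
      have "blk g a b c d $$ (k, l) = 0\<^sub>m b d $$ (k, l)" using eq by simp
      then show "g $$ (a + k, c + l) = 0" using kl by simp
    qed
  qed (auto intro!: eq_matI)
  have "blk ?y (2 * m) 2 (2 * m) 2 = blk x (2 * m) 2 (2 * m) 2"
    by (intro eq_matI) (auto simp: y p2 simp del: index_mult_mat(1) assoc_mult_mat)
  then have "?y \<in> Qc m \<longleftrightarrow> blk ?y m m 0 m = 0\<^sub>m m m \<and> blk ?y (2 * m) 2 0 m = 0\<^sub>m 2 m \<and> blk ?y m m (2 * m) 2 = 0\<^sub>m m 2"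
    using pres x by (simp add: Qc_def del: assoc_mult_mat)
  then show ?thesis unfolding z using y p p2 by simp
qed

lemma blk_eq_index: "blk g a b c d = M \<Longrightarrow> k < b \<Longrightarrow> l < d \<Longrightarrow> g $$ (a + k, c + l) = M $$ (k, l)"
  by auto

lemma qmat_in_Qc:
  "A \<in> GL m \<Longrightarrow> i \<in> SO_minus_2 \<kappa> \<Longrightarrow> h \<in> carrier_mat 2 m \<Longrightarrow> C \<in> Alt m \<Longrightarrow> qmat m A i h C \<in> Qc m"
  using bij_betwE[OF bij_betw_qmat, rule_format, of "(A, i, h, C)" m] by simp

text \<open>The conditions come out in this order: the upper right block of \<open>A\<close>; the
  first columns of i h and hence of \<open>h\<close>; finally the corner of A B, from which the
  invertible corner of \<open>A\<close> is cancelled.\<close>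

lemma qmat_stabilizer_iff:
  assumes m: "m = s + t" and A: "A \<in> GL m" and i: "i \<in> SO_minus_2 \<kappa>" and h: "h \<in> carrier_mat 2 m" and C: "C \<in> Alt m"
  shows "sigma_mat (Suc m) s * qmat m A i h C * sigma_mat (Suc m) s \<in> Qc m \<longleftrightarrow>
    (\<forall>i<s. \<forall>j\<in>{s..<s + t}. A $$ (i, j) = 0) \<and> (\<forall>e<2. \<forall>k<s. h $$ (e, k) = 0) \<and> (\<forall>j<s. \<forall>k<s. C $$ (j, k) = 0)"
    (is "?L \<longleftrightarrow> ?RA \<and> ?Rh \<and> ?RC")
proof -
  let ?d = "delta_mat \<kappa>"
  define B where "B = C + h\<^sup>T * ?d\<^sup>T * h"
  have s: "s \<le> m" using m by simp
  have Cc: "C \<in> carrier_mat m m" using C by (rule Alt_carrier)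
  have hc: "h\<^sup>T * ?d\<^sup>T * h \<in> carrier_mat m m" using h by (auto intro!: carrier_matI)
  have Bc: "B \<in> carrier_mat m m" unfolding B_def using Cc hc by simp
  define x where "x = qmat m A i h C"
  have xQ: "x \<in> Qc m" unfolding x_def using A i h C by (rule qmat_in_Qc)
  have xeq: "x = Q_levi m A i * Q_unip m i B h" by (simp add: x_def qmat_def B_def)
  note b = blk_levi_unip[OF A SO_minus_2_carrier[OF i] Bc h, folded xeq]
  note ic = SO_minus_2_carrier[OF i]
  have x11: "x $$ (k, l) = A $$ (k, l)" if "k < m" "l < m" for k l using blk_eq_index[OF b(2) that] by simp
  have x12: "x $$ (k, m + l) = (A * B) $$ (k, l)" if "k < m" "l < m" for k l using blk_eq_index[OF b(3) that] by simp
  have x13: "x $$ (k, 2 * m + e) = (A * (h\<^sup>T * i\<^sup>T * eta_mat * i)) $$ (k, e)" if "k < m" "e < 2" for k e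
    using blk_eq_index[OF b(4) that] by simp
  have x21: "x $$ (m + k, l) = 0" if "k < m" "l < m" for k l using blk_eq_index[OF b(5) that] that by simp
  have x22: "x $$ (m + k, m + l) = mat_inv A $$ (l, k)" if "k < m" "l < m" for k l
    using blk_eq_index[OF b(6) that] that mat_inv(1)[OF A] by simp
  have x23: "x $$ (m + k, 2 * m + e) = 0" if "k < m" "e < 2" for k e using blk_eq_index[OF b(7) that] that by simp
  have x31: "x $$ (2 * m + e, l) = 0" if "e < 2" "l < m" for e l using blk_eq_index[OF b(8) that] that by simp
  have x32: "x $$ (2 * m + e, m + l) = (i * h) $$ (e, l)" if "e < 2" "l < m" for e l using blk_eq_index[OF b(9) that] by simp
  note iff = sigma_conj_Qc_iff[OF xQ s]
  \<comment> \<open>Once the first \<open>s\<close> columns of \<open>h\<close> vanish,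
    \<open>B\<close> and \<open>C\<close> agree in these columns.\<close>
  have Bindex: "B $$ (j, k) = C $$ (j, k)" if "?Rh" "j < m" "k < s" for j k
  proof -
    have "(h\<^sup>T * ?d\<^sup>T * h) $$ (j, k) = (\<Sum>i<2. \<Sum>l<2. h $$ (l, j) * ?d\<^sup>T $$ (l, i) * h $$ (i, k))"
      using that s h by (intro congruence_index[of _ 2 h m]) auto
    also have "\<dots> = 0" using that by (intro sum.neutral ballI) auto
    finally show ?thesis unfolding B_def using that s carrier_matD[OF hc]
      by (subst index_add_mat(1)) (auto simp del: index_mult_mat(1) assoc_mult_mat)
  qed
  have Ac: "A \<in> carrier_mat (s + t) (s + t)" using GL_carrier[OF A] m by simp
  \<comment> \<open>A block lower triangular \<open>A\<close> has an invertible corner and a block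
    lower triangular inverse. The second fact settles the block of \<open>x\<close> that holds the
    inverse transpose of \<open>A\<close>.\<close>
  have corner: "blk A 0 s 0 s \<in> GL s" and invA: "\<And>c r. c < s \<Longrightarrow> s \<le> r \<Longrightarrow> r < m \<Longrightarrow> mat_inv A $$ (c, r) = 0" if RA: ?RA
  proof -
    obtain A1 A2 A3 A4 where c: "A1 \<in> carrier_mat s s" "A2 \<in> carrier_mat s t" "A3 \<in> carrier_mat t s" "A4 \<in> carrier_mat t t"
      and eq: "A = four_block_mat A1 A2 A3 A4" using four_block_mat_exhaust[OF Ac] .
    have "A2 = 0\<^sub>m s t"
    proof (rule eq_matI)
      fix k l assume kl: "k < dim_row (0\<^sub>m s t)" "l < dim_col (0\<^sub>m s t)"
      then have "A $$ (k, s + l) = 0" using RA by simp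
      then show "A2 $$ (k, l) = 0\<^sub>m s t $$ (k, l)" using kl c unfolding eq by simp
    qed (use c in auto)
    with eq have eq: "A = four_block_mat A1 (0\<^sub>m s t) A3 A4" by simp
    have G: "A1 \<in> GL s" "A4 \<in> GL t" using A lower_block_GL_iff[OF c(1,3,4)] unfolding eq m by auto
    have "blk A 0 s 0 s = A1" unfolding eq using c by (intro eq_matI) auto
    with G show "blk A 0 s 0 s \<in> GL s" by simp
    show "mat_inv A $$ (c, r) = 0" if "c < s" "s \<le> r" "r < m" for c r
      unfolding eq mat_inv_lower_block[OF G(1) c(3) G(2)] using that GL_dim[OF G(1)] GL_dim[OF G(2)] m by simp
  qed
  have AB: "blk (A * B) 0 s 0 s = blk A 0 s 0 s * blk B 0 s 0 s" if RA: ?RA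
  proof -
    have "blk A 0 s s t = 0\<^sub>m s t" using RA by (intro eq_matI) auto
    moreover have "B \<in> carrier_mat (s + t) (s + t)" using Bc m by simp
    ultimately show ?thesis using blk_mult2[OF Ac, of B "s + t" 0 s 0 s]
      by (simp add: right_add_zero_mat[OF mult_carrier_mat[OF blk_carrier blk_carrier]])
  qed
  show ?thesis
  proof
    assume ?L
    then have L1: "\<And>k l. k < m \<Longrightarrow> l < m \<Longrightarrow> x $$ (if k < s then k else m + k, if l < s then m + l else l) = 0"
      and L2: "\<And>e l. e < 2 \<Longrightarrow> l < m \<Longrightarrow> x $$ (2 * m + e, if l < s then m + l else l) = 0"
      using iff by (auto simp: x_def)
    have RA: ?RA
    proof (intro allI ballI impI)
      fix k j assume "k < s" "j \<in> {s..<s + t}"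
      then show "A $$ (k, j) = 0" using L1[of k j] x11[of k j] m by simp
    qed
    have Rh: ?Rh
    proof (intro allI impI)
      fix e k :: nat assume ek: "e < 2" "k < s"
      have ih: "(i * h) $$ (e', k) = 0" if "e' < 2" for e' :: nat using L2[of e' k] x32[of e' k] that ek s by simp
      have iG: "i \<in> GL 2" using i by (rule SO_minus_2_GL)
      have "h $$ (e, k) = (mat_inv i * (i * h)) $$ (e, k)" using mat_inv_mult_cancel(1)[OF iG, of h] h by simp
      also have "\<dots> = (\<Sum>l<2. mat_inv i $$ (e, l) * (i * h) $$ (l, k))"
        using ek s by (intro mult_mat_index[OF mat_inv(1)[OF iG] mult_carrier_mat[OF ic h]]) auto
      also have "\<dots> = 0" using ih by (intro sum.neutral) auto
      finally show "h $$ (e, k) = 0" .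
    qed
    have "blk (A * B) 0 s 0 s = 0\<^sub>m s s"
    proof (rule eq_matI)
      fix j k assume "j < dim_row (0\<^sub>m s s)" "k < dim_col (0\<^sub>m s s)"
      then have jk: "j < s" "k < s" by auto
      then show "blk (A * B) 0 s 0 s $$ (j, k) = 0\<^sub>m s s $$ (j, k)" using L1[of j k] x12[of j k] s by simp
    qed auto
    then have "blk A 0 s 0 s * blk B 0 s 0 s = blk A 0 s 0 s * 0\<^sub>m s s" using AB[OF RA] by simp
    from GL_mult_cancel_left[OF corner[OF RA] blk_carrier zero_carrier_mat this] have B0: "blk B 0 s 0 s = 0\<^sub>m s s" .
    have ?RC
    proof (intro allI impI)
      fix j k assume jk: "j < s" "k < s"
      have "blk B 0 s 0 s $$ (j, k) = 0" unfolding B0 using jk by simp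
      then show "C $$ (j, k) = 0" using Bindex[OF Rh, of j k] jk s by simp
    qed
    with RA Rh show "?RA \<and> ?Rh \<and> ?RC" by blast
  next
    assume R: "?RA \<and> ?Rh \<and> ?RC"
    then have RA: ?RA and Rh: ?Rh and RC: ?RC by auto
    have B0: "blk B 0 s 0 s = 0\<^sub>m s s" using Bindex[OF Rh] RC s by (intro eq_matI) auto
    have AB0: "(A * B) $$ (j, k) = 0" if "j < s" "k < s" for j k
    proof -
      have "blk (A * B) 0 s 0 s $$ (j, k) = 0" unfolding AB[OF RA] B0 using that by simp
      then show ?thesis using that by simp
    qed
    have ih0: "(i * h) $$ (e, k) = 0" if "e < 2" "k < s" for e k
    proof -
      have "(i * h) $$ (e, k) = (\<Sum>l<2. i $$ (e, l) * h $$ (l, k))" using that s by (intro mult_mat_index[OF ic h]) auto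
      also have "\<dots> = 0" using that Rh by (intro sum.neutral) auto
      finally show ?thesis .
    qed
    \<comment> \<open>Each summand vanishes: for l < s by the zero rows of the transpose of
      \<open>h\<close>, otherwise by the zero block of \<open>A\<close>.\<close>
    have Y0: "(A * (h\<^sup>T * i\<^sup>T * eta_mat * i)) $$ (k, e) = 0" if "k < s" "e < 2" for k e
    proof -
      have ie: "i\<^sup>T * eta_mat * i \<in> carrier_mat 2 2" using ic by (auto intro!: carrier_matI)
      have as: "h\<^sup>T * i\<^sup>T * eta_mat * i = h\<^sup>T * (i\<^sup>T * eta_mat * i)"
        by (simp only: mult_assoc_dim mat_dims carrier_matD[OF h] carrier_matD[OF ic] eta_mat_dim)
      have hT: "h\<^sup>T \<in> carrier_mat m 2" using h by simp
      have "(A * (h\<^sup>T * i\<^sup>T * eta_mat * i)) $$ (k, e) = (\<Sum>l<m. A $$ (k, l) * (h\<^sup>T * (i\<^sup>T * eta_mat * i)) $$ (l, e))"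
        unfolding as using that s by (intro mult_mat_index[OF GL_carrier[OF A] mult_carrier_mat[OF hT ie]]) auto
      also have "\<dots> = 0"
      proof (intro sum.neutral ballI)
        fix l assume l: "l \<in> {..<m}"
        show "A $$ (k, l) * (h\<^sup>T * (i\<^sup>T * eta_mat * i)) $$ (l, e) = 0"
        proof (cases "l < s")
          case True
          have "(h\<^sup>T * (i\<^sup>T * eta_mat * i)) $$ (l, e) = (\<Sum>a<2. h\<^sup>T $$ (l, a) * (i\<^sup>T * eta_mat * i) $$ (a, e))"
            using l that by (intro mult_mat_index[OF hT ie]) auto
          also have "\<dots> = 0" using True Rh l h by (intro sum.neutral) auto
          finally show ?thesis by simp
        next
          case False
          then show ?thesis using RA that l m by auto
        qed
      qed
      finally show ?thesis .
    qed
    have RAm: "A $$ (k, l) = 0" if "k < s" "\<not> l < s" "l < m" for k l using RA that m by simp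
    show ?L
      unfolding x_def[symmetric] iff
      using s RAm AB0 ih0 Y0 invA[OF RA]
      by (auto simp: x11 x12 x13 x21 x22 x23 x31 x32 simp del: index_mult_mat(1))
  qed
qed

lemma stabilizer_eq:
  assumes m: "m = s + t"
  shows "{x \<in> Qc m. sigma_mat (Suc m) s * x * sigma_mat (Suc m) s \<in> Qc m} =
    (\<lambda>(A, i, h, C). qmat m A i h C) ` ({A \<in> GL m. \<forall>i<s. \<forall>j\<in>{s..<s + t}. A $$ (i, j) = 0} \<times> SO_minus_2 \<kappa> \<times>
      {h \<in> carrier_mat 2 m. \<forall>e<2. \<forall>k<s. h $$ (e, k) = 0} \<times> {C \<in> Alt m. \<forall>j<s. \<forall>k<s. C $$ (j, k) = 0})"
    (is "?L = ?R")
proof (intro equalityI subsetI)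
  fix x assume x: "x \<in> ?L"
  then have "x \<in> (\<lambda>(A, i, h, C). qmat m A i h C) ` (GL m \<times> SO_minus_2 \<kappa> \<times> carrier_mat 2 m \<times> Alt m)"
    unfolding bij_betw_imp_surj_on[OF bij_betw_qmat[of m]] by blast
  then obtain A i h C where p: "A \<in> GL m" "i \<in> SO_minus_2 \<kappa>" "h \<in> carrier_mat 2 m" "C \<in> Alt m" "x = qmat m A i h C"
    by auto
  with x qmat_stabilizer_iff[OF m p(1-4)] show "x \<in> ?R"
    by (intro image_eqI[of _ _ "(A, i, h, C)"]) auto
next
  fix x assume "x \<in> ?R"
  then obtain A i h C where p: "A \<in> GL m" "i \<in> SO_minus_2 \<kappa>" "h \<in> carrier_mat 2 m" "C \<in> Alt m"
    and x: "x = qmat m A i h C" and r: "\<forall>i<s. \<forall>j\<in>{s..<s + t}. A $$ (i, j) = 0" "\<forall>e<2. \<forall>k<s. h $$ (e, k) = 0"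
      "\<forall>j<s. \<forall>k<s. C $$ (j, k) = 0"
    by auto
  have "x \<in> Qc m" unfolding x using p by (rule qmat_in_Qc)
  with qmat_stabilizer_iff[OF m p] r x show "x \<in> ?L" by blast
qed

lemma card_Qc: "card (Qc m) = card (GL m :: 'a mat set) * (q + 1) * q ^ (2 * m) * q ^ (\<Sum>j<m. j)"
  using bij_betw_same_card[OF bij_betw_qmat[of m]]
  by (simp only: card_cartesian_product card_SO_minus_2 card_carrier_mat card_Alt card_field mult.assoc)

text \<open>The zero corner of \<open>C\<close> costs a factor \<open>card (Alt s)\<close>. It
  stands on the left so that exponents need not be subtracted.\<close>

lemma card_stabilizer:
  assumes m: "m = s + t"
  shows "card {x \<in> Qc m. sigma_mat (Suc m) s * x * sigma_mat (Suc m) s \<in> Qc m} * q ^ (\<Sum>j<s. j) =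
    card (GL s :: 'a mat set) * q ^ (t * s) * card (GL t :: 'a mat set) * (q + 1) * q ^ (2 * t) * q ^ (\<Sum>j<m. j)"
proof -
  let ?GA = "{A \<in> GL m :: 'a mat set. \<forall>i<s. \<forall>j\<in>{s..<s + t}. A $$ (i, j) = 0}"
  let ?H = "{h \<in> carrier_mat 2 m :: 'a mat set. \<forall>e<2. \<forall>k<s. h $$ (e, k) = 0}"
  let ?C = "{C \<in> Alt m. \<forall>j<s. \<forall>k<s. C $$ (j, k) = 0}"
  have inj: "inj_on (\<lambda>(A, i, h, C). qmat m A i h C) (?GA \<times> SO_minus_2 \<kappa> \<times> ?H \<times> ?C)"
    using bij_betw_qmat[of m] by (auto simp: bij_betw_def intro: inj_on_subset)
  have H: "card ?H = q ^ (2 * t)"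
  proof -
    have "?H = {h \<in> carrier_mat 2 m. blk h 0 2 0 s = 0\<^sub>m 2 s}"
    proof (intro Collect_cong conj_cong refl)
      fix h :: "'a mat"
      show "(\<forall>e<2. \<forall>k<s. h $$ (e, k) = 0) \<longleftrightarrow> blk h 0 2 0 s = 0\<^sub>m 2 s"
      proof
        assume eq: "blk h 0 2 0 s = 0\<^sub>m 2 s"
        show "\<forall>e<2. \<forall>k<s. h $$ (e, k) = 0"
        proof (intro allI impI)
          fix e k :: nat assume "e < 2" "k < s"
          with blk_eq_index[OF eq this] show "h $$ (e, k) = 0" by simp
        qed
      qed (auto intro!: eq_matI)
    qed
    then have "card ?H = (\<Sum>h\<in>carrier_mat 2 m. if blk h 0 2 0 s = (0\<^sub>m 2 s :: 'a mat) then 1 else 0)"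
      by (simp add: sum.If_cases Int_def)
    also have "\<dots> = q ^ (2 * t)" unfolding m
      by (subst sum_split_cols[of "\<lambda>h. if h = (0\<^sub>m 2 s :: 'a mat) then 1 else 0"]) simp
    finally show ?thesis .
  qed
  have "card {x \<in> Qc m. sigma_mat (Suc m) s * x * sigma_mat (Suc m) s \<in> Qc m} = card ?GA * ((q + 1) * (card ?H * card ?C))"
    unfolding stabilizer_eq[OF m] card_image[OF inj] by (simp only: card_cartesian_product card_SO_minus_2)
  then have "card {x \<in> Qc m. sigma_mat (Suc m) s * x * sigma_mat (Suc m) s \<in> Qc m} * q ^ (\<Sum>j<s. j) =
      card ?GA * (q + 1) * card ?H * (card ?C * q ^ (\<Sum>j<s. j))" by (simp only: mult.assoc)
  also have "card ?GA = card (GL s :: 'a mat set) * q ^ (t * s) * card (GL t :: 'a mat set)"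
    unfolding m using card_lower_block_GL[where 'a = 'a, of s t] by simp
  also have "card ?C * q ^ (\<Sum>j<s. j) = q ^ (\<Sum>j<m. j)"
    using card_Alt_zero_corner[of s m] m by (simp add: card_Alt mult.commute)
  finally show ?thesis unfolding H .
qed

end

section \<open>Quadratic Gauss sums\<close>

context char2_character
begin

lemma so2_add: "so2 (x, y) + so2 (x', y') = so2 (x + x', y + y')"
  by (rule eq_matI) (auto simp: less_2_cases_iff so2_index algebra_simps carrier_matD[OF so2_carrier])

text \<open>An element times its conjugate is its norm. Since \<open>theta\<close> is anisotropic,
  every nonzero \<open>so2 d\<close> is therefore invertible.\<close>

lemma so2_mult_conj: "so2 (x + y, y) * so2 (x, y) = so2 (theta (x, y), 0)"
proof -
  have "(x + y) * x + \<kappa> * y * y = theta (x, y)" by (simp add: theta_def power2_eq_square algebra_simps)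
  moreover have "y * x + (x + y) * y + y * y = 0" by (simp add: algebra_simps)
  ultimately show ?thesis unfolding so2_mult by simp
qed

lemma so2_scalar_mult:
  assumes h: "h \<in> carrier_mat 2 s"
  shows "so2 (t, 0) * h = t \<cdot>\<^sub>m h"
proof (rule eq_matI)
  fix r c assume "r < dim_row (t \<cdot>\<^sub>m h)" "c < dim_col (t \<cdot>\<^sub>m h)"
  then have rc: "r < 2" "c < s" using h by auto
  have "(so2 (t, 0) * h) $$ (r, c) = (\<Sum>l<2. so2 (t, 0) $$ (r, l) * h $$ (l, c))"
    by (rule mult_mat_index[OF so2_carrier h rc])
  also have "\<dots> = t * h $$ (r, c)" using rc by (auto simp: numeral_2_eq_2 less_Suc_eq so2_index)
  finally show "(so2 (t, 0) * h) $$ (r, c) = (t \<cdot>\<^sub>m h) $$ (r, c)" using rc h by simp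
qed (use h in \<open>auto simp: carrier_matD[OF so2_carrier]\<close>)

lemma so2_mult_eq_0D:
  assumes h: "h \<in> carrier_mat 2 s" "h \<noteq> 0\<^sub>m 2 s" and eq: "so2 d * h = 0\<^sub>m 2 s"
  shows "d = (0, 0)"
proof (rule ccontr)
  assume "d \<noteq> (0, 0)"
  then have t: "theta d \<noteq> 0" by (simp add: theta_eq_0_iff)
  obtain x y where d: "d = (x, y)" by force
  have "theta d \<cdot>\<^sub>m h = so2 (x + y, y) * so2 (x, y) * h" by (simp add: so2_mult_conj so2_scalar_mult[OF h(1)] d)
  also have "\<dots> = so2 (x + y, y) * (so2 (x, y) * h)" by (rule assoc_mult_mat[OF so2_carrier so2_carrier h(1)])
  also have "\<dots> = 0\<^sub>m 2 s" using eq by (simp add: d right_mult_zero_mat[OF so2_carrier])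
  finally have eq0: "theta d \<cdot>\<^sub>m h = 0\<^sub>m 2 s" .
  have "h = 0\<^sub>m 2 s"
  proof (rule eq_matI)
    fix r c assume rc: "r < dim_row (0\<^sub>m 2 s)" "c < dim_col (0\<^sub>m 2 s)"
    have "(theta d \<cdot>\<^sub>m h) $$ (r, c) = 0" unfolding eq0 using rc by simp
    then show "h $$ (r, c) = 0\<^sub>m 2 s $$ (r, c)" using rc h t by simp
  qed (use h in auto)
  with h show False by simp
qed

lemma SO_minus_2_inv:
  assumes "i \<in> SO_minus_2 \<kappa>"
  obtains j where "j \<in> SO_minus_2 \<kappa>" "j * i = 1\<^sub>m 2"
proof -
  obtain x y where i: "i = so2 (x, y)" "theta (x, y) = 1" using assms by (auto simp: SO_minus_2_eq)
  have "theta (x + y, y) = theta (x, y)" by (simp add: theta_def square_add power2_eq_square algebra_simps)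
  then have "so2 (x + y, y) \<in> SO_minus_2 \<kappa>" using i by (simp add: SO_minus_2_iff)
  moreover have "so2 (x + y, y) * i = 1\<^sub>m 2"
    unfolding i so2_mult_conj by (rule eq_matI) (auto simp: i less_2_cases_iff so2_index carrier_matD[OF so2_carrier])
  ultimately show ?thesis by (rule that)
qed

text \<open>\<open>P\<close> is a union of orbits. The matrices \<open>so2 d\<close> form a field,
  so the difference of two distinct group elements is invertible and cannot kill a nonzero
  \<open>h\<close>; hence every orbit has q + 1 elements.\<close>

lemma card_dvd_SO_invariant:
  assumes P: "P \<subseteq> carrier_mat 2 s - {0\<^sub>m 2 s}" and inv: "\<And>i h. i \<in> SO_minus_2 \<kappa> \<Longrightarrow> h \<in> P \<Longrightarrow> i * h \<in> P"
  shows "(q + 1) dvd card P"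
proof -
  let ?O = "\<lambda>h. (\<lambda>i. i * h) ` SO_minus_2 \<kappa>"
  have fin: "finite P" using P by (rule finite_subset) simp
  have hc: "h \<in> carrier_mat 2 s" if "h \<in> P" for h using P that by auto
  have card: "card (?O h) = q + 1" if h: "h \<in> P" for h
  proof -
    have "inj_on (\<lambda>i. i * h) (SO_minus_2 \<kappa>)"
    proof (rule inj_onI)
      fix i j assume "i \<in> SO_minus_2 \<kappa>" "j \<in> SO_minus_2 \<kappa>" and eq: "i * h = j * h"
      then obtain x y x' y' where ij: "i = so2 (x, y)" "j = so2 (x', y')" by (auto simp: SO_minus_2_eq)
      \<comment> \<open>In characteristic 2 the sum of \<open>i\<close> and \<open>j\<close> is
        their difference.\<close>
      have "so2 (x + x', y + y') * h = i * h + j * h"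
        unfolding ij so2_add[symmetric] by (rule add_mult_distrib_mat[OF so2_carrier so2_carrier hc[OF h]])
      also have "\<dots> = 0\<^sub>m 2 s" unfolding eq using mat_add_self[of "j * h" 2 s] mult_carrier_mat[OF so2_carrier hc[OF h]] ij by simp
      finally have "(x + x', y + y') = (0, 0)" using so2_mult_eq_0D[OF hc[OF h]] P h by blast
      then show "i = j" unfolding ij by (simp add: add_eq_0_iff_eq)
    qed
    then show ?thesis by (simp add: card_image card_SO_minus_2)
  qed
  have sub: "?O (i * h) \<subseteq> ?O h" if "h \<in> P" "i \<in> SO_minus_2 \<kappa>" for h i
  proof clarify
    fix j assume j: "j \<in> SO_minus_2 \<kappa>"
    have "j * (i * h) = (j * i) * h"
      using assoc_mult_mat[OF SO_minus_2_carrier[OF j] SO_minus_2_carrier[OF that(2)] hc[OF that(1)]] by simp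
    then show "j * (i * h) \<in> ?O h" using SO_minus_2_mult[OF j that(2)] by auto
  qed
  have mem_orbit: "h \<in> ?O (i * h)" if h: "h \<in> P" and i: "i \<in> SO_minus_2 \<kappa>" for h i
  proof -
    obtain j where j: "j \<in> SO_minus_2 \<kappa>" "j * i = 1\<^sub>m 2" using SO_minus_2_inv[OF i] .
    have "j * (i * h) = h"
      using assoc_mult_mat[OF SO_minus_2_carrier[OF j(1)] SO_minus_2_carrier[OF i] hc[OF h]] j(2) hc[OF h] by simp
    then show ?thesis using j(1) by (intro image_eqI[of _ _ j]) simp_all
  qed
  have eqO: "?O (i * h) = ?O h" if hi: "h \<in> P" "i \<in> SO_minus_2 \<kappa>" for h i
  proof
    obtain j where j: "j \<in> SO_minus_2 \<kappa>" "h = j * (i * h)" using mem_orbit[OF hi] by blast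
    show "?O h \<subseteq> ?O (i * h)" using sub[OF inv[OF hi(2,1)] j(1)] unfolding j(2)[symmetric] .
  qed (rule sub[OF hi])
  have Un: "\<Union> (?O ` P) = P"
  proof
    show "P \<subseteq> \<Union> (?O ` P)"
    proof
      fix h assume h: "h \<in> P"
      have "card (SO_minus_2 \<kappa>) > 0" by (simp add: card_SO_minus_2)
      then obtain i where "i \<in> SO_minus_2 \<kappa>" by (metis card_gt_0_iff ex_in_conv)
      then have "h \<in> ?O (i * h)" "i * h \<in> P" using mem_orbit h inv by blast+
      then show "h \<in> \<Union> (?O ` P)" by blast
    qed
  qed (use inv in auto)
  have "(q + 1) * card (?O ` P) = card (\<Union> (?O ` P))"
  proof (rule card_partition)
    fix a b assume "a \<in> ?O ` P" "b \<in> ?O ` P" "a \<noteq> b"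
    then obtain h h' where hh: "h \<in> P" "h' \<in> P" "a = ?O h" "b = ?O h'" by auto
    show "a \<inter> b = {}"
    proof (rule ccontr)
      assume "a \<inter> b \<noteq> {}"
      then obtain i j where "i \<in> SO_minus_2 \<kappa>" "j \<in> SO_minus_2 \<kappa>" "i * h = j * h'" using hh by auto
      then have "a = b" using eqO[of h i] eqO[of h' j] hh by simp
      with \<open>a \<noteq> b\<close> show False by simp
    qed
  qed (use fin card Un in auto)
  then show ?thesis unfolding Un by (metis dvd_triv_left)
qed

text \<open>With \<open>h\<close> outermost, left multiplication of \<open>h\<close> by an element
  of \<open>SO_minus_2 \<kappa>\<close> can be shifted onto \<delta> by cyclicity, and the
  polarization of the form can be read off.\<close>

lemma mat_trace_minus_form:
  assumes S: "S \<in> carrier_mat s s" and h: "(h :: 'a mat) \<in> carrier_mat 2 s"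
  shows "mat_trace (S * (h\<^sup>T * (delta_mat \<kappa>)\<^sup>T * h)) = mat_trace (h * S * h\<^sup>T * (delta_mat \<kappa>)\<^sup>T)"
proof -
  note dims = mat_dims carrier_matD[OF S] carrier_matD[OF h] delta_mat_dim
  have "S * (h\<^sup>T * (delta_mat \<kappa>)\<^sup>T * h) = S * h\<^sup>T * (delta_mat \<kappa>)\<^sup>T * h" by (simp only: dims mult_assoc_dim)
  also have "mat_trace \<dots> = mat_trace (h * (S * h\<^sup>T * (delta_mat \<kappa>)\<^sup>T))"
    by (rule mat_trace_mult_comm[of _ s 2]) (use S h in \<open>auto intro!: carrier_matI\<close>)
  also have "h * (S * h\<^sup>T * (delta_mat \<kappa>)\<^sup>T) = h * S * h\<^sup>T * (delta_mat \<kappa>)\<^sup>T" by (simp only: dims mult_assoc_dim)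
  finally show ?thesis .
qed

lemma sum_psi_trace_mult:
  assumes V: "V \<in> carrier_mat s 2" "V \<noteq> 0\<^sub>m s 2"
  shows "(\<Sum>h\<in>carrier_mat 2 s. \<psi> (mat_trace (h * V))) = 0"
proof -
  obtain a b where ab: "a < s" "b < 2" "V $$ (a, b) \<noteq> 0"
  proof (rule ccontr)
    assume "\<not> thesis"
    then have "V = 0\<^sub>m s 2" using V that by (intro eq_matI) auto
    with V show False by simp
  qed
  obtain x where x: "\<psi> (V $$ (a, b) * x) \<noteq> 1" using exists_psi_mult_neq_1[OF ab(3)] by blast
  define e where "e = mat 2 s (\<lambda>(i, j). if i = b \<and> j = a then x else 0)"
  have e: "e \<in> carrier_mat 2 s" by (simp add: e_def)
  have "mat_trace (e * V) = (\<Sum>i<2. \<Sum>j<s. e $$ (i, j) * V $$ (j, i))"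
    unfolding mat_trace_def using mult_mat_index[OF e V(1)] e by (auto intro!: sum.cong)
  also have "\<dots> = (\<Sum>i<2. \<Sum>j<s. if j = a then (if i = b then x * V $$ (a, b) else 0) else 0)"
    by (intro sum.cong refl) (auto simp: e_def)
  also have "\<dots> = V $$ (a, b) * x" using ab by (simp add: mult.commute)
  finally have tr: "mat_trace (e * V) = V $$ (a, b) * x" .
  have add: "mat_trace ((e + h) * V) = mat_trace (e * V) + mat_trace (h * V)" if "h \<in> carrier_mat 2 s" for h
    using add_mult_distrib_mat[OF e that V(1)] mat_trace_add[OF mult_carrier_mat[OF e V(1)] mult_carrier_mat[OF that V(1)]] by simp
  show ?thesis
  proof (rule sum_eq_0_by_translation[where g = "\<lambda>h. e + h" and z = "\<psi> (V $$ (a, b) * x)"])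
    show "bij_betw (\<lambda>h. e + h) (carrier_mat 2 s) (carrier_mat 2 s)"
      by (rule bij_betwI[where g = "\<lambda>h. e + h"]) (use e mat_add_cancel(2) in auto)
  qed (use x add tr in \<open>auto simp: psi_add\<close>)
qed

definition gauss :: "nat \<Rightarrow> 'a mat \<Rightarrow> complex" where
  "gauss s S = (\<Sum>h\<in>carrier_mat 2 s. \<psi> (mat_trace (S * (h\<^sup>T * (delta_mat \<kappa>)\<^sup>T * h))))"

text \<open>The values being 1 and -1, this is a squared absolute value. Substituting h + k for k
  and polarizing leaves a sum over \<open>h\<close> of a character that is nontrivial unless k = 0,
  because \<open>S\<close> and \<eta> are invertible.\<close>

lemma gauss_square:
  assumes S: "S \<in> sym_GL s"
  shows "gauss s S * gauss s S = of_nat q ^ (2 * s)"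
proof -
  let ?d = "delta_mat \<kappa>"
  have SG: "S \<in> GL s" and Sc: "S \<in> carrier_mat s s" and ST: "S\<^sup>T = S" using S by (auto simp: sym_GL_def GL_carrier)
  define F where "F h = mat_trace (h * S * h\<^sup>T * ?d\<^sup>T)" for h
  have F: "gauss s S = (\<Sum>h\<in>carrier_mat 2 s. \<psi> (F h))"
    unfolding gauss_def F_def using mat_trace_minus_form[OF Sc] by (intro sum.cong) auto
  have b: "F (h + k) = F h + F k + mat_trace (h * (S * k\<^sup>T * eta_mat))" if h: "h \<in> carrier_mat 2 s" and k: "k \<in> carrier_mat 2 s" for h k
  proof -
    note dims = mat_dims carrier_matD[OF Sc] carrier_matD[OF h] carrier_matD[OF k] delta_mat_dim eta_mat_dim
    let ?T = "\<lambda>u v. u * S * v\<^sup>T * ?d\<^sup>T"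
    have c: "?T u v \<in> carrier_mat 2 2" if "u \<in> carrier_mat 2 s" "v \<in> carrier_mat 2 s" for u v
      using that Sc by (auto intro!: carrier_matI)
    have hk: "(h + k)\<^sup>T = h\<^sup>T + k\<^sup>T" by (rule transpose_add[OF h k])
    have "(h + k) * S * (h + k)\<^sup>T * ?d\<^sup>T = (?T h h + ?T k h) + (?T h k + ?T k k)"
      unfolding hk by (simp only: dims mult_add_distrib_dim)
    then have "F (h + k) = (F h + mat_trace (?T k h)) + (mat_trace (?T h k) + F k)"
      using c h k by (simp add: F_def mat_trace_add[of _ 2] del: assoc_mult_mat)
    \<comment> \<open>Transposing brings the two cross terms to one shape, by the symmetry of
      \<open>S\<close>; they then add up to \<eta>.\<close>
    also have "mat_trace (?T k h) = mat_trace (h * S * k\<^sup>T * ?d)"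
    proof -
      have "mat_trace (?T k h) = mat_trace (?T k h)\<^sup>T" using mat_trace_transpose[OF c[OF k h]] by simp
      also have "(?T k h)\<^sup>T = ?d * (h * S * k\<^sup>T)"
        by (simp only: dims transpose_mult_dim transpose_transpose ST mult_assoc_dim)
      also have "mat_trace \<dots> = mat_trace (h * S * k\<^sup>T * ?d)"
        by (rule mat_trace_mult_comm[of _ 2 2]) (auto simp: dims)
      finally show ?thesis .
    qed
    also have "F h + mat_trace (h * S * k\<^sup>T * ?d) + (mat_trace (?T h k) + F k) =
        F h + F k + (mat_trace (h * S * k\<^sup>T * ?d) + mat_trace (?T h k))" by (simp add: add_ac)
    also have "mat_trace (h * S * k\<^sup>T * ?d) + mat_trace (?T h k) = mat_trace (h * S * k\<^sup>T * ?d + ?T h k)"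
      by (rule mat_trace_add[symmetric, of _ 2]) (auto simp: dims)
    also have "h * S * k\<^sup>T * ?d + ?T h k = h * S * k\<^sup>T * (?d + ?d\<^sup>T)" by (simp only: dims mult_add_distrib_dim)
    also have "\<dots> = h * (S * k\<^sup>T * eta_mat)" unfolding delta_add_transpose by (simp only: dims mult_assoc_dim)
    finally show ?thesis .
  qed
  have nz: "S * k\<^sup>T * eta_mat \<noteq> 0\<^sub>m s 2" if k: "k \<in> carrier_mat 2 s" "k \<noteq> 0\<^sub>m 2 s" for k
  proof
    note dims = mat_dims carrier_matD[OF Sc] carrier_matD[OF k(1)] eta_mat_dim
    assume z: "S * k\<^sup>T * eta_mat = 0\<^sub>m s 2"
    have "S * k\<^sup>T * eta_mat * eta_mat = S * (k\<^sup>T * (eta_mat * eta_mat))" by (simp only: dims mult_assoc_dim)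
    also have "\<dots> = S * k\<^sup>T" unfolding eta_mat_square using k by simp
    finally have "0\<^sub>m s 2 * eta_mat = S * k\<^sup>T" unfolding z .
    then have "S * k\<^sup>T = S * 0\<^sub>m s 2"
      unfolding left_mult_zero_mat[OF eta_mat_carrier] right_mult_zero_mat[OF Sc] by simp
    from GL_mult_cancel_left[OF SG _ _ this] have "k\<^sup>T = 0\<^sub>m s 2" using k by simp
    then have "k\<^sup>T\<^sup>T = 0\<^sub>m 2 s" by simp
    with k show False by simp
  qed
  have "gauss s S * gauss s S = (\<Sum>h\<in>carrier_mat 2 s. \<Sum>k\<in>carrier_mat 2 s. \<psi> (F h) * \<psi> (F k))"
    unfolding F by (rule sum_product)
  also have "\<dots> = (\<Sum>h\<in>carrier_mat 2 s. \<Sum>k\<in>carrier_mat 2 s. \<psi> (F h) * \<psi> (F (h + k)))"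
  proof (rule sum.cong[OF refl])
    fix h :: "'a mat" assume h: "h \<in> carrier_mat 2 s"
    show "(\<Sum>k\<in>carrier_mat 2 s. \<psi> (F h) * \<psi> (F k)) = (\<Sum>k\<in>carrier_mat 2 s. \<psi> (F h) * \<psi> (F (h + k)))"
      by (rule sum.reindex_bij_witness[where i = "\<lambda>k. h + k" and j = "\<lambda>k. h + k"]) (use h mat_add_cancel(2) in auto)
  qed
  also have "\<dots> = (\<Sum>h\<in>carrier_mat 2 s. \<Sum>k\<in>carrier_mat 2 s. \<psi> (F k) * \<psi> (mat_trace (h * (S * k\<^sup>T * eta_mat))))"
  proof (intro sum.cong refl)
    fix h k :: "'a mat" assume hk: "h \<in> carrier_mat 2 s" "k \<in> carrier_mat 2 s"
    have "\<psi> (F h) * (\<psi> (F h) * x) = x" for x using psi_square[of "F h"] by (simp flip: mult.assoc)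
    then show "\<psi> (F h) * \<psi> (F (h + k)) = \<psi> (F k) * \<psi> (mat_trace (h * (S * k\<^sup>T * eta_mat)))"
      unfolding b[OF hk] by (simp add: psi_add mult.assoc)
  qed
  also have "\<dots> = (\<Sum>k\<in>carrier_mat 2 s. \<psi> (F k) * (\<Sum>h\<in>carrier_mat 2 s. \<psi> (mat_trace (h * (S * k\<^sup>T * eta_mat)))))"
    by (subst sum.swap) (simp add: sum_distrib_left)
  also have "\<dots> = (\<Sum>k\<in>carrier_mat 2 s. if k = (0\<^sub>m 2 s :: 'a mat) then of_nat q ^ (2 * s) else 0)"
  proof (intro sum.cong refl)
    fix k :: "'a mat" assume k: "k \<in> carrier_mat 2 s"
    have Vc: "S * k\<^sup>T * eta_mat \<in> carrier_mat s 2" using Sc k by (auto intro!: carrier_matI)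
    show "\<psi> (F k) * (\<Sum>h\<in>carrier_mat 2 s. \<psi> (mat_trace (h * (S * k\<^sup>T * eta_mat)))) = (if k = 0\<^sub>m 2 s then of_nat q ^ (2 * s) else 0)"
    proof (cases "k = 0\<^sub>m 2 s")
      case True
      have z: "S * k\<^sup>T * eta_mat = 0\<^sub>m s 2" unfolding True using Sc by simp
      have "mat_trace (h * (S * k\<^sup>T * eta_mat)) = 0" if "h \<in> carrier_mat 2 s" for h
        unfolding z using that by (simp add: mat_trace_def)
      moreover have "F k = 0" unfolding F_def True using Sc by (simp add: mat_trace_def)
      ultimately show ?thesis using True by (simp add: card_carrier_mat)
    next
      case False
      then show ?thesis using sum_psi_trace_mult[OF Vc nz[OF k False]] by simp
    qed
  qed
  also have "\<dots> = of_nat q ^ (2 * s)" by simp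
  finally show ?thesis .
qed

lemma gauss_eq:
  assumes S: "S \<in> sym_GL s"
  shows "gauss s S = (- of_nat q) ^ s"
proof -
  let ?d = "delta_mat \<kappa>"
  have Sc: "S \<in> carrier_mat s s" using S by (rule sym_GL_carrier)
  define F where "F h = mat_trace (h * S * h\<^sup>T * ?d\<^sup>T)" for h
  \<comment> \<open>Cyclicity carries \<open>i\<close> around to \<delta>, which it
    preserves.\<close>
  have inv: "F (i * h) = F h" if i: "i \<in> SO_minus_2 \<kappa>" and h: "h \<in> carrier_mat 2 s" for i h
  proof -
    note ic = SO_minus_2_carrier[OF i]
    note dims = mat_dims carrier_matD[OF Sc] carrier_matD[OF h] carrier_matD[OF ic] delta_mat_dim
    have "(i * h) * S * (i * h)\<^sup>T * ?d\<^sup>T = i * (h * S * h\<^sup>T * (i\<^sup>T * ?d\<^sup>T))"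
      by (simp only: dims transpose_mult_dim mult_assoc_dim)
    then have "F (i * h) = mat_trace (i * (h * S * h\<^sup>T * (i\<^sup>T * ?d\<^sup>T)))" unfolding F_def by simp
    also have "\<dots> = mat_trace (h * S * h\<^sup>T * (i\<^sup>T * ?d\<^sup>T) * i)"
      by (rule mat_trace_mult_comm[of _ 2 2]) (use ic in \<open>auto simp: dims\<close>)
    also have "h * S * h\<^sup>T * (i\<^sup>T * ?d\<^sup>T) * i = h * S * h\<^sup>T * (i\<^sup>T * ?d * i)\<^sup>T"
      by (simp only: dims transpose_mult_dim mult_assoc_dim transpose_transpose)
    finally show ?thesis unfolding SO_minus_2_delta[OF i] F_def .
  qed
  \<comment> \<open>Each level set of the sign is a union of free orbits, so the sum over nonzero
    \<open>h\<close> is divisible by q + 1.\<close>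
  let ?P = "\<lambda>c. {h \<in> carrier_mat 2 s - {0\<^sub>m 2 s}. \<psi> (F h) = c}"
  have dvd: "(q + 1) dvd card (?P c)" for c
  proof (rule card_dvd_SO_invariant[of _ s])
    fix i h assume i: "i \<in> SO_minus_2 \<kappa>" and h: "h \<in> ?P c"
    then have hc: "h \<in> carrier_mat 2 s" "h \<noteq> 0\<^sub>m 2 s" by auto
    have "i * h \<noteq> 0\<^sub>m 2 s"
    proof
      assume "i * h = 0\<^sub>m 2 s"
      moreover obtain d where "i = so2 d" "theta d = 1" using i by (auto simp: SO_minus_2_eq)
      ultimately show False using so2_mult_eq_0D[OF hc] theta_eq_0_iff[of d] by auto
    qed
    then show "i * h \<in> ?P c" using inv[OF i hc(1)] h mult_carrier_mat[OF SO_minus_2_carrier[OF i] hc(1)] by auto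
  qed auto
  have F0: "F (0\<^sub>m 2 s) = 0" unfolding F_def using Sc by (simp add: mat_trace_def)
  have "gauss s S = (\<Sum>h\<in>carrier_mat 2 s. \<psi> (F h))"
    unfolding gauss_def F_def using mat_trace_minus_form[OF Sc] by (intro sum.cong) auto
  also have "\<dots> = 1 + (\<Sum>h\<in>carrier_mat 2 s - {0\<^sub>m 2 s}. \<psi> (F h))"
    by (subst sum.remove[of _ "0\<^sub>m 2 s"]) (auto simp: F0)
  also have "carrier_mat 2 s - {0\<^sub>m 2 s} = ?P 1 \<union> ?P (- 1)" using psi_cases by auto
  also have "(\<Sum>h\<in>?P 1 \<union> ?P (- 1). \<psi> (F h)) = (\<Sum>h\<in>?P 1. \<psi> (F h)) + (\<Sum>h\<in>?P (- 1). \<psi> (F h))"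
    by (rule sum.union_disjoint) auto
  also have "\<dots> = of_nat (card (?P 1)) - of_nat (card (?P (- 1)))" by simp
  finally have g: "gauss s S = of_int (1 + (int (card (?P 1)) - int (card (?P (- 1)))))" by simp
  define z where "z = 1 + (int (card (?P 1)) - int (card (?P (- 1))))"
  have "int (q + 1) dvd int (card (?P c))" for c using dvd[of c] by (simp only: int_dvd_int_iff)
  then have zdvd: "int (q + 1) dvd z - 1" unfolding z_def by (simp add: dvd_diff)
  have "(of_int (z * z) :: complex) = of_int (int q ^ (2 * s))"
    using gauss_square[OF S] unfolding g z_def[symmetric] by simp
  then have "z * z = int q ^ s * int q ^ s" by (simp only: of_int_eq_iff mult_2 power_add)
  then have zz: "z = int q ^ s \<or> z = - (int q ^ s)" by (simp add: square_eq_iff)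
  have pdvd: "int (q + 1) dvd (- int q) ^ s - 1"
  proof (induction s)
    case (Suc s)
    have "(- int q) ^ Suc s - 1 = (- int q) * ((- int q) ^ s - 1) - int (q + 1)" by (simp add: algebra_simps)
    with Suc show ?case by (simp only: dvd_diff dvd_mult dvd_refl)
  qed simp
  \<comment> \<open>With the other sign q + 1 would divide both z - 1 and -z - 1, hence 2, which q
    \<ge> 2 excludes.\<close>
  have "z = (- int q) ^ s"
  proof (rule ccontr)
    assume "z \<noteq> (- int q) ^ s"
    then have "z = - ((- int q) ^ s)" using zz by (cases "even s") auto
    then have "- 2 = (z - 1) + ((- int q) ^ s - 1)" by simp
    then have "int (q + 1) dvd - 2" using zdvd pdvd by (metis dvd_add)
    then have "int (q + 1) \<le> 2" by (simp add: zdvd_imp_le)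
    with q_ge_2 show False by simp
  qed
  then show ?thesis unfolding g z_def[symmetric] by simp
qed

end

section \<open>The character sum over \<open>Q\<^sup>-(2n,q)\<close>\<close>

context char2_character
begin

text \<open>The summand is a character of the additive group \<open>Alt m\<close>. The coefficient
  of the free entry at (l, k) and (k, l) with k < s is A_kl + A_lk if l < s, and A_kl otherwise; the
  diagonal of \<open>A\<close> is never seen.\<close>

lemma sum_psi_Alt:
  assumes A: "A \<in> carrier_mat m m" and m: "m = s + t"
  shows "(\<Sum>C\<in>Alt m. \<psi> (\<Sum>k<s. (A * C) $$ (k, k))) =
    (if (\<forall>i<s. \<forall>j\<in>{s..<s + t}. A $$ (i, j) = 0) \<and> (\<forall>i<s. \<forall>j<s. A $$ (i, j) = A $$ (j, i))
     then of_nat q ^ (\<Sum>j<m. j) else 0)"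
proof -
  define F where "F C = (\<Sum>k<s. \<Sum>l<m. A $$ (k, l) * C $$ (l, k))" for C
  have s: "s \<le> m" using m by simp
  have F: "(\<Sum>k<s. (A * C) $$ (k, k)) = F C" if "C \<in> carrier_mat m m" for C
    unfolding F_def using s mult_mat_index[OF A that] by (intro sum.cong) auto
  have "(\<Sum>C\<in>Alt m. \<psi> (\<Sum>k<s. (A * C) $$ (k, k))) = (\<Sum>C\<in>Alt m. \<psi> (F C))"
    using F Alt_carrier by (intro sum.cong) auto
  also have "\<dots> = (if (\<forall>i<s. \<forall>j\<in>{s..<s + t}. A $$ (i, j) = 0) \<and> (\<forall>i<s. \<forall>j<s. A $$ (i, j) = A $$ (j, i))
     then of_nat q ^ (\<Sum>j<m. j) else 0)" (is "_ = (if ?good then _ else _)")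
  proof (cases ?good)
    case True
    have "F C = 0" if C: "C \<in> Alt m" for C
    proof -
      have sym: "C $$ (i, j) = C $$ (j, i)" "C $$ (i, i) = 0" if "i < m" "j < m" for i j
        using C that by (auto simp: Alt_def alternating_mat_iff[of _ m])
      have "F C = (\<Sum>k<s. \<Sum>l<s. A $$ (k, l) * C $$ (l, k))"
        unfolding F_def m sum_lessThan_add using True by (simp add: m)
      also have "\<dots> = 0"
      proof (rule sum_symmetric_zero_diagonal)
        fix i j assume ij: "i < s" "j < s"
        have "A $$ (i, j) = A $$ (j, i)" using True ij by blast
        moreover have "C $$ (j, i) = C $$ (i, j)" using sym(1)[of j i] ij s by simp
        ultimately show "A $$ (i, j) * C $$ (j, i) = A $$ (j, i) * C $$ (i, j)" by (simp only:)
      next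
        fix i assume "i < s"
        then show "A $$ (i, i) * C $$ (i, i) = 0" using sym(2)[of i i] s by simp
      qed
      finally show ?thesis .
    qed
    then have "(\<Sum>C\<in>Alt m. \<psi> (F C)) = of_nat (card (Alt m))" by simp
    with True show ?thesis by (simp add: card_Alt)
  next
    case False
    have "\<exists>k l. k < s \<and> l < m \<and> k \<noteq> l \<and> A $$ (k, l) + (if l < s then A $$ (l, k) else 0) \<noteq> 0"
    proof (cases "\<forall>i<s. \<forall>j\<in>{s..<s + t}. A $$ (i, j) = 0")
      case True
      with False obtain i j where "i < s" "j < s" "A $$ (i, j) \<noteq> A $$ (j, i)" by auto
      then show ?thesis using s by (intro exI[of _ i] exI[of _ j]) (auto simp: add_eq_0_iff_eq)
    next
      case False
      then obtain i j where "i < s" "j \<in> {s..<s + t}" "A $$ (i, j) \<noteq> 0" by auto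
      then show ?thesis using m by (intro exI[of _ i] exI[of _ j]) auto
    qed
    then obtain k l where kl: "k < s" "l < m" "k \<noteq> l" and a: "A $$ (k, l) + (if l < s then A $$ (l, k) else 0) \<noteq> 0" by blast
    obtain x where x: "\<psi> ((A $$ (k, l) + (if l < s then A $$ (l, k) else 0)) * x) \<noteq> 1" using exists_psi_mult_neq_1[OF a] by blast
    \<comment> \<open>The elementary alternating matrix that isolates the nonzero coefficient,
      scaled so that \<psi> does not take the value 1.\<close>
    define E where "E = mat m m (\<lambda>(i, j). if (i = l \<and> j = k) \<or> (i = k \<and> j = l) then x else 0)"
    have Ec: "E \<in> carrier_mat m m" by (simp add: E_def)
    have EA: "E \<in> Alt m" using kl by (auto simp: Alt_def alternating_mat_iff[of _ m] E_def)
    have "F E = (\<Sum>i<s. \<Sum>j<m. (if j = l then (if i = k then A $$ (k, l) * x else 0) else 0) + (if j = k then (if i = l then A $$ (l, k) * x else 0) else 0))"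
      unfolding F_def using kl s by (intro sum.cong refl) (auto simp: E_def)
    also have "\<dots> = (A $$ (k, l) + (if l < s then A $$ (l, k) else 0)) * x"
      using kl s by (simp add: sum.distrib distrib_right)
    finally have FE: "F E = (A $$ (k, l) + (if l < s then A $$ (l, k) else 0)) * x" .
    have add: "F (E + C) = F E + F C" if "C \<in> Alt m" for C
    proof -
      have "(E + C) $$ (b, a) = E $$ (b, a) + C $$ (b, a)" if "a < m" "b < m" for a b
        using that Alt_carrier[OF \<open>C \<in> Alt m\<close>] by simp
      then show ?thesis unfolding F_def using s by (simp add: distrib_left sum.distrib)
    qed
    have "(\<Sum>C\<in>Alt m. \<psi> (F C)) = 0"
    proof (rule sum_eq_0_by_translation[where g = "\<lambda>C. E + C" and z = "\<psi> (F E)"])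
      show "bij_betw (\<lambda>C. E + C) (Alt m) (Alt m)"
        by (rule bij_betwI[where g = "\<lambda>C. E + C"])
          (use EA Ec mat_add_cancel(2) alternating_mat_add[of E m] in \<open>auto simp: Alt_def\<close>)
    qed (use x FE add in \<open>auto simp: psi_add\<close>)
    with False show ?thesis by (simp only: if_False)
  qed
  finally show ?thesis .
qed

text \<open>The zero block of \<open>A\<close> cuts the product down to its corner, which involves
  only the corner of \<open>A\<close> and the first \<open>s\<close> columns of
  \<open>h\<close>.\<close>

lemma sum_trace_product_lower_block:
  assumes A: "A \<in> carrier_mat m m" and m: "m = s + t" and low: "\<forall>i<s. \<forall>j\<in>{s..<s + t}. A $$ (i, j) = 0" and h: "h \<in> carrier_mat 2 m"
  shows "(\<Sum>k<s. (A * (h\<^sup>T * (delta_mat \<kappa>)\<^sup>T * h)) $$ (k, k)) =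
    mat_trace (blk A 0 s 0 s * ((blk h 0 2 0 s)\<^sup>T * (delta_mat \<kappa>)\<^sup>T * blk h 0 2 0 s))"
proof -
  let ?D = "h\<^sup>T * (delta_mat \<kappa>)\<^sup>T * h"
  have Ac: "A \<in> carrier_mat (s + t) (s + t)" and hc: "h \<in> carrier_mat 2 (s + t)" using A h m by auto
  have Dc: "?D \<in> carrier_mat (s + t) (s + t)" using hc by (auto intro!: carrier_matI)
  have "blk A 0 s s t = 0\<^sub>m s t" using low by (intro eq_matI) auto
  then have "blk (A * ?D) 0 s 0 s = blk A 0 s 0 s * blk ?D 0 s 0 s"
    using blk_mult2[OF Ac Dc, of 0 s 0 s] by (simp add: right_add_zero_mat[OF mult_carrier_mat[OF blk_carrier blk_carrier]])
  moreover have "blk ?D 0 s 0 s = (blk h 0 2 0 s)\<^sup>T * (delta_mat \<kappa>)\<^sup>T * blk h 0 2 0 s"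
  proof (rule eq_matI)
    fix r c assume "r < dim_row ((blk h 0 2 0 s)\<^sup>T * (delta_mat \<kappa>)\<^sup>T * blk h 0 2 0 s)"
      "c < dim_col ((blk h 0 2 0 s)\<^sup>T * (delta_mat \<kappa>)\<^sup>T * blk h 0 2 0 s)"
    then have rc: "r < s" "c < s" by auto
    have "blk ?D 0 s 0 s $$ (r, c) = ?D $$ (r, c)" using rc by simp
    also have "\<dots> = (\<Sum>i<2. \<Sum>j<2. h $$ (j, r) * (delta_mat \<kappa>)\<^sup>T $$ (j, i) * h $$ (i, c))"
      using rc hc by (intro congruence_index[of _ 2 h "s + t"]) auto
    also have "\<dots> = (\<Sum>i<2. \<Sum>j<2. blk h 0 2 0 s $$ (j, r) * (delta_mat \<kappa>)\<^sup>T $$ (j, i) * blk h 0 2 0 s $$ (i, c))"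
      using rc by (intro sum.cong refl) auto
    also have "\<dots> = ((blk h 0 2 0 s)\<^sup>T * (delta_mat \<kappa>)\<^sup>T * blk h 0 2 0 s) $$ (r, c)"
      using rc by (intro congruence_index[of _ 2 _ s, symmetric]) auto
    finally show "blk ?D 0 s 0 s $$ (r, c) = ((blk h 0 2 0 s)\<^sup>T * (delta_mat \<kappa>)\<^sup>T * blk h 0 2 0 s) $$ (r, c)" .
  qed auto
  moreover have "(\<Sum>k<s. (A * ?D) $$ (k, k)) = mat_trace (blk (A * ?D) 0 s 0 s)" by (simp add: mat_trace_def)
  ultimately show ?thesis by simp
qed

text \<open>Stated for an abstract \<open>T\<close> and an abstract contribution
  \<open>\<tau>\<close> of the block \<open>i\<close>, so that the left factors 1 and \<rho> are
  covered at once.\<close>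

lemma sum_psi_trace_Qc:
  assumes m: "m = s + t"
    and trace: "\<And>A i h C. A \<in> GL m \<Longrightarrow> i \<in> SO_minus_2 \<kappa> \<Longrightarrow> h \<in> carrier_mat 2 m \<Longrightarrow> C \<in> Alt m \<Longrightarrow>
      T (qmat m A i h C) = (\<Sum>k<s. (A * (C + h\<^sup>T * (delta_mat \<kappa>)\<^sup>T * h)) $$ (k, k)) +
        ((\<Sum>k<t. A $$ (s + k, s + k)) + (\<Sum>k<t. mat_inv A $$ (s + k, s + k))) + \<tau> i"
  shows "(\<Sum>x\<in>Qc m. \<psi> (T x)) = (\<Sum>i\<in>SO_minus_2 \<kappa>. \<psi> (\<tau> i)) * of_nat q ^ (\<Sum>j<m. j) * (- of_nat q) ^ s *
    of_nat q ^ (2 * t) * of_nat (card (sym_GL s :: 'a mat set)) * of_nat q ^ (t * s) * kloosterman_GL t \<psi> 1"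
proof -
  let ?D = "\<lambda>h. h\<^sup>T * (delta_mat \<kappa>)\<^sup>T * h"
  let ?low = "\<lambda>A :: 'a mat. \<forall>i<s. \<forall>j\<in>{s..<s + t}. A $$ (i, j) = 0"
  let ?sym = "\<lambda>A :: 'a mat. \<forall>i<s. \<forall>j<s. A $$ (i, j) = A $$ (j, i)"
  let ?a = "\<lambda>A. (\<Sum>k<t. A $$ (s + k, s + k)) + (\<Sum>k<t. mat_inv A $$ (s + k, s + k)) :: 'a"
  let ?S = "\<Sum>i\<in>SO_minus_2 \<kappa>. \<psi> (\<tau> i)"
  have split: "\<psi> (T (qmat m A i h C)) = \<psi> (?a A) * (\<psi> (\<tau> i) * (\<psi> (\<Sum>k<s. (A * ?D h) $$ (k, k)) * \<psi> (\<Sum>k<s. (A * C) $$ (k, k))))"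
    if p: "A \<in> GL m" "i \<in> SO_minus_2 \<kappa>" "h \<in> carrier_mat 2 m" "C \<in> Alt m" for A i h C
  proof -
    have c: "A \<in> carrier_mat m m" "C \<in> carrier_mat m m" "?D h \<in> carrier_mat m m"
      using p by (auto simp: GL_carrier Alt_carrier intro!: carrier_matI)
    have "A * (C + ?D h) = A * C + A * ?D h" using mult_add_distrib_mat[OF c] .
    then have "(\<Sum>k<s. (A * (C + ?D h)) $$ (k, k)) = (\<Sum>k<s. (A * C) $$ (k, k)) + (\<Sum>k<s. (A * ?D h) $$ (k, k))"
      using carrier_matD[OF mult_carrier_mat[OF c(1) c(3)]] m
      by (simp add: sum.distrib del: index_mult_mat(1))
    then show ?thesis unfolding trace[OF p] by (simp add: psi_add mult_ac)
  qed
  have inner: "(\<Sum>h\<in>carrier_mat 2 m. \<psi> (\<Sum>k<s. (A * ?D h) $$ (k, k))) = of_nat q ^ (2 * t) * gauss s (blk A 0 s 0 s)"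
    if "A \<in> GL m" "?low A" for A
  proof -
    have "(\<Sum>h\<in>carrier_mat 2 m. \<psi> (\<Sum>k<s. (A * ?D h) $$ (k, k))) =
        (\<Sum>h\<in>carrier_mat 2 (s + t). (\<lambda>h. \<psi> (mat_trace (blk A 0 s 0 s * (h\<^sup>T * (delta_mat \<kappa>)\<^sup>T * h)))) (blk h 0 2 0 s))"
      unfolding m[symmetric] using sum_trace_product_lower_block[OF GL_carrier[OF that(1)] m that(2)] by (intro sum.cong) auto
    also have "\<dots> = of_nat q ^ (2 * t) * gauss s (blk A 0 s 0 s)"
      using sum_split_cols[where n = 2 and s = s and t = t and
          f = "\<lambda>h. \<psi> (mat_trace (blk A 0 s 0 s * (h\<^sup>T * (delta_mat \<kappa>)\<^sup>T * h)))"]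
      unfolding gauss_def by simp
    finally show ?thesis .
  qed
  \<comment> \<open>Allows the sum over \<open>h\<close> to be evaluated under the assumption that
    \<open>A\<close> is block lower triangular; for any other \<open>A\<close> the sum over
    \<open>C\<close> is already zero.\<close>
  have gen: "x * (S * (y * (if L \<and> M then c else 0))) = (if L then if M then x * (S * (z * c)) else 0 else 0)"
    if "L \<Longrightarrow> y = z" for L M and x S y z c :: complex using that by auto
  let ?c = "of_nat q ^ (\<Sum>j<m. j) :: complex"
  let ?g = "\<lambda>A. if ?sym A then \<psi> (?a A) * (?S * (of_nat q ^ (2 * t) * gauss s (blk A 0 s 0 s) * ?c)) else 0"
  have "(\<Sum>x\<in>Qc m. \<psi> (T x)) = (\<Sum>(A, i, h, C)\<in>GL m \<times> SO_minus_2 \<kappa> \<times> carrier_mat 2 m \<times> Alt m. \<psi> (T (qmat m A i h C)))"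
  proof -
    have "(\<Sum>x\<in>Qc m. \<psi> (T x)) = (\<Sum>p\<in>GL m \<times> SO_minus_2 \<kappa> \<times> carrier_mat 2 m \<times> Alt m.
        \<psi> (T ((\<lambda>(A, i, h, C). qmat m A i h C) p)))"
      by (rule sum.reindex_bij_betw[OF bij_betw_qmat[of m], symmetric])
    also have "\<dots> = (\<Sum>(A, i, h, C)\<in>GL m \<times> SO_minus_2 \<kappa> \<times> carrier_mat 2 m \<times> Alt m. \<psi> (T (qmat m A i h C)))"
      by (rule sum.cong[OF refl]) (simp only: case_prod_unfold)
    finally show ?thesis .
  qed
  also have "\<dots> = (\<Sum>(A, i, h, C)\<in>GL m \<times> SO_minus_2 \<kappa> \<times> carrier_mat 2 m \<times> Alt m.
      \<psi> (?a A) * (\<psi> (\<tau> i) * (\<psi> (\<Sum>k<s. (A * ?D h) $$ (k, k)) * \<psi> (\<Sum>k<s. (A * C) $$ (k, k)))))"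
    by (intro sum.cong refl) (auto simp: split simp del: index_mult_mat(1))
  also have "\<dots> = (\<Sum>A\<in>GL m. \<Sum>i\<in>SO_minus_2 \<kappa>. \<Sum>h\<in>carrier_mat 2 m. \<Sum>C\<in>Alt m.
      \<psi> (?a A) * (\<psi> (\<tau> i) * (\<psi> (\<Sum>k<s. (A * ?D h) $$ (k, k)) * \<psi> (\<Sum>k<s. (A * C) $$ (k, k)))))"
    by (simp only: sum.cartesian_product)
  also have "\<dots> = (\<Sum>A\<in>GL m. \<psi> (?a A) * (?S * ((\<Sum>h\<in>carrier_mat 2 m. \<psi> (\<Sum>k<s. (A * ?D h) $$ (k, k))) *
      (\<Sum>C\<in>Alt m. \<psi> (\<Sum>k<s. (A * C) $$ (k, k))))))"
    by (simp only: sum_distrib_left[symmetric] sum_distrib_right[symmetric])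
  also have "\<dots> = (\<Sum>A\<in>GL m. if ?low A then ?g A else 0)"
  proof (intro sum.cong refl)
    fix A :: "'a mat" assume A: "A \<in> GL m"
    show "\<psi> (?a A) * (?S * ((\<Sum>h\<in>carrier_mat 2 m. \<psi> (\<Sum>k<s. (A * ?D h) $$ (k, k))) *
      (\<Sum>C\<in>Alt m. \<psi> (\<Sum>k<s. (A * C) $$ (k, k))))) = (if ?low A then ?g A else 0)"
      unfolding sum_psi_Alt[OF GL_carrier[OF A] m]
      by (rule gen) (rule inner[OF A])
  qed
  also have "\<dots> = (\<Sum>A\<in>{A \<in> GL (s + t). ?low A}. ?g A)"
    unfolding m by (rule sum.inter_filter[symmetric]) simp
  also have "\<dots> = (\<Sum>S\<in>GL s. \<Sum>X\<in>carrier_mat t s. \<Sum>D\<in>GL t. ?g (four_block_mat S (0\<^sub>m s t) X D))"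
    by (rule sum_lower_block_GL)
  also have "\<dots> = (\<Sum>S\<in>(GL s :: 'a mat set). \<Sum>X\<in>(carrier_mat t s :: 'a mat set). \<Sum>D\<in>GL t. if S\<^sup>T = S then
      \<psi> (mat_trace D + mat_trace (mat_inv D)) * (?S * (of_nat q ^ (2 * t) * (- of_nat q) ^ s * ?c)) else 0)"
  proof (intro sum.cong refl)
    fix S X D :: "'a mat" assume S: "S \<in> GL s" and X: "X \<in> carrier_mat t s" and D: "D \<in> GL t"
    let ?A = "four_block_mat S (0\<^sub>m s t) X D"
    note c = GL_carrier[OF S] GL_carrier[OF D]
    have sym: "?sym ?A \<longleftrightarrow> S\<^sup>T = S"
    proof -
      have "?sym ?A \<longleftrightarrow> (\<forall>i<s. \<forall>j<s. S $$ (i, j) = S $$ (j, i))" using c by auto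
      also have "\<dots> \<longleftrightarrow> S\<^sup>T = S"
      proof
        assume "S\<^sup>T = S"
        then show "\<forall>i<s. \<forall>j<s. S $$ (i, j) = S $$ (j, i)" using c by (metis carrier_matD index_transpose_mat(1))
      qed (use c in \<open>auto intro!: eq_matI\<close>)
      finally show ?thesis .
    qed
    have blk: "blk ?A 0 s 0 s = S" using c by (intro eq_matI) auto
    have a: "?a ?A = mat_trace D + mat_trace (mat_inv D)"
      unfolding mat_inv_lower_block[OF S X D] mat_trace_def using c GL_dim[OF S] GL_dim[OF D] by simp
    show "?g ?A = (if S\<^sup>T = S then
      \<psi> (mat_trace D + mat_trace (mat_inv D)) * (?S * (of_nat q ^ (2 * t) * (- of_nat q) ^ s * ?c)) else 0)"
      unfolding sym blk a using gauss_eq[of S s] S by (simp add: sym_GL_def)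
  qed
  \<comment> \<open>The lower left block is free, and the lower right one carries the Kloosterman
    sum.\<close>
  also have "\<dots> = (\<Sum>S\<in>(GL s :: 'a mat set). if S\<^sup>T = S then of_nat q ^ (t * s) * (kloosterman_GL t \<psi> 1 * (?S * (of_nat q ^ (2 * t) * (- of_nat q) ^ s * ?c))) else 0)"
  proof (intro sum.cong refl)
    fix S :: "'a mat"
    show "(\<Sum>X\<in>(carrier_mat t s :: 'a mat set). \<Sum>D\<in>GL t. if S\<^sup>T = S then
      \<psi> (mat_trace D + mat_trace (mat_inv D)) * (?S * (of_nat q ^ (2 * t) * (- of_nat q) ^ s * ?c)) else 0) =
      (if S\<^sup>T = S then of_nat q ^ (t * s) * (kloosterman_GL t \<psi> 1 * (?S * (of_nat q ^ (2 * t) * (- of_nat q) ^ s * ?c))) else 0)"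
      by (cases "S\<^sup>T = S") (simp_all add: kloosterman_GL_def card_carrier_mat flip: sum_distrib_right)
  qed
  also have "\<dots> = (\<Sum>S\<in>(sym_GL s :: 'a mat set). of_nat q ^ (t * s) * (kloosterman_GL t \<psi> 1 * (?S * (of_nat q ^ (2 * t) * (- of_nat q) ^ s * ?c))))"
    unfolding sym_GL_def by (rule sum.inter_filter[symmetric]) simp
  also have "\<dots> = ?S * ?c * (- of_nat q) ^ s *
    of_nat q ^ (2 * t) * of_nat (card (sym_GL s :: 'a mat set)) * of_nat q ^ (t * s) * kloosterman_GL t \<psi> 1"
    by (simp add: mult_ac)
  finally show ?thesis .
qed

text \<open>\<rho> acts on the last two rows only, so of the blocks that enter the trace it changes
  \<open>i\<close> alone.\<close>

lemma trace_qmat_sigma: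
  assumes m: "m = s + t" and A: "A \<in> GL m" and i: "i \<in> SO_minus_2 \<kappa>" and h: "h \<in> carrier_mat 2 m" and C: "C \<in> Alt m"
  shows "mat_trace (1\<^sub>m (2 * m + 2) * qmat m A i h C * sigma_mat (Suc m) s) =
      (\<Sum>k<s. (A * (C + h\<^sup>T * (delta_mat \<kappa>)\<^sup>T * h)) $$ (k, k)) +
        ((\<Sum>k<t. A $$ (s + k, s + k)) + (\<Sum>k<t. mat_inv A $$ (s + k, s + k))) + mat_trace i" (is ?one)
    and "mat_trace (rho_mat (Suc m) * qmat m A i h C * sigma_mat (Suc m) s) =
      (\<Sum>k<s. (A * (C + h\<^sup>T * (delta_mat \<kappa>)\<^sup>T * h)) $$ (k, k)) +
        ((\<Sum>k<t. A $$ (s + k, s + k)) + (\<Sum>k<t. mat_inv A $$ (s + k, s + k))) + mat_trace (rho2 * i)" (is ?rho)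
proof -
  have Bc: "C + h\<^sup>T * (delta_mat \<kappa>)\<^sup>T * h \<in> carrier_mat m m"
    using h Alt_carrier[OF C] by (auto intro!: carrier_matI)
  let ?x = "qmat m A i h C"
  note b = blk_levi_unip[OF A SO_minus_2_carrier[OF i] Bc h, folded qmat_def]
  have inv: "(\<Sum>k<t. (mat_inv A)\<^sup>T $$ (s + k, s + k)) = (\<Sum>k<t. mat_inv A $$ (s + k, s + k))"
    using GL_dim[OF A] m by (intro sum.cong) auto
  have zero: "(\<Sum>k<s. (0\<^sub>m m m :: 'a mat) $$ (k, k)) = 0" using m by (intro sum.neutral) auto
  show ?one unfolding left_mult_one_mat[OF b(1)] mat_trace_mult_sigma[OF b(1) m] b inv zero by (simp add: add_ac)
  note mult = blk_mult3[OF rho_mat_carrier b(1)]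
  have Rx: "rho_mat (Suc m) * ?x \<in> carrier_mat (2 * m + 2) (2 * m + 2)" by (rule mult_carrier_mat[OF rho_mat_carrier b(1)])
  have AB: "A * (C + h\<^sup>T * (delta_mat \<kappa>)\<^sup>T * h) \<in> carrier_mat m m" using mult_carrier_mat[OF GL_carrier[OF A] Bc] .
  have ri: "rho2 * i \<in> carrier_mat 2 2" using mult_carrier_mat[OF rho2_carrier SO_minus_2_carrier[OF i]] .
  have rb: "blk (rho_mat (Suc m) * ?x) 0 m 0 m = A" "blk (rho_mat (Suc m) * ?x) 0 m m m = A * (C + h\<^sup>T * (delta_mat \<kappa>)\<^sup>T * h)"
    "blk (rho_mat (Suc m) * ?x) m m 0 m = 0\<^sub>m m m" "blk (rho_mat (Suc m) * ?x) m m m m = (mat_inv A)\<^sup>T"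
    "blk (rho_mat (Suc m) * ?x) (2 * m) 2 (2 * m) 2 = rho2 * i"
  proof -
    show "blk (rho_mat (Suc m) * ?x) 0 m m m = A * (C + h\<^sup>T * (delta_mat \<kappa>)\<^sup>T * h)"
    proof -
      have ih: "i * h \<in> carrier_mat 2 m" by (rule mult_carrier_mat[OF SO_minus_2_carrier[OF i] h])
      then show ?thesis using mat_inv(1)[OF A]
        by (simp add: mult blk_rho b left_mult_one_mat[OF AB] left_mult_zero_mat[OF ih] right_add_zero_mat[OF AB] del: assoc_mult_mat)
    qed
  qed (use GL_carrier[OF A] mat_inv(1)[OF A] ri h SO_minus_2_carrier[OF i] mult_carrier_mat[OF SO_minus_2_carrier[OF i] h] in
      \<open>simp_all add: mult blk_rho b left_add_zero_mat[OF ri] del: assoc_mult_mat\<close>)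
  show ?rho unfolding mat_trace_mult_sigma[OF Rx m] rb inv zero by (simp add: add_ac)
qed

text \<open>The counts for \<open>Q\<close> and the stabilizer are inserted and the nonzero common
  factor is cancelled. The orders of the general linear groups stay unevaluated, since their ratio
  takes its final form only for a given t.\<close>

lemma double_coset_identity:
  assumes m: "m = s + t"
    and R: "R = 1\<^sub>m (2 * m + 2) \<and> \<tau> = mat_trace \<or> R = rho_mat (Suc m) \<and> \<tau> = (\<lambda>i. mat_trace (rho2 * i))"
  defines "W \<equiv> \<Sum>w\<in>{R * x * sigma_mat (Suc m) s * y | x y. x \<in> Q_minus \<kappa> (Suc m) \<and> y \<in> Q_minus \<kappa> (Suc m)}. \<psi> (mat_trace w)"
  shows "W * of_nat (card (GL s :: 'a mat set)) * of_nat (card (GL t :: 'a mat set)) =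
    of_nat (card (GL m :: 'a mat set)) * of_nat q ^ (2 * m + (\<Sum>j<s. j) + (\<Sum>j<m. j) + s) * (- 1) ^ s *
    of_nat (card (sym_GL s :: 'a mat set)) * kloosterman_GL t \<psi> 1 * (\<Sum>i\<in>SO_minus_2 \<kappa>. \<psi> (\<tau> i))"
proof -
  let ?N = "2 * m + 2" and ?S = "sigma_mat (Suc m) s :: 'a mat"
  have s: "s \<le> m" using m by simp
  have Rc: "R \<in> carrier_mat ?N ?N" "R * R = 1\<^sub>m ?N" "\<And>x. x \<in> Qc m \<Longrightarrow> R * x * R \<in> Qc m"
  proof -
    show "R \<in> carrier_mat ?N ?N" using R by auto
    show "R * R = 1\<^sub>m ?N" using R rho_mat_square by auto
    show "R * x * R \<in> Qc m" if "x \<in> Qc m" for x using R rho_conj_Qc[OF that] Qc_carrier[OF that] that by auto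
  qed
  have dc: "of_nat (card {x \<in> Qc m. ?S * x * ?S \<in> Qc m}) * W = of_nat (card (Qc m)) * (\<Sum>x\<in>Qc m. \<psi> (mat_trace (R * x * ?S)))"
    unfolding W_def Qc_eq[symmetric]
  proof (rule sum_double_coset[where n = ?N and f = "\<lambda>w. \<psi> (mat_trace w)"])
    show "Qc m \<subseteq> GL ?N" using Qc_GL by blast
    show "x * y \<in> Qc m" if "x \<in> Qc m" "y \<in> Qc m" for x y using that by (rule Qc_mult)
    show "mat_inv x \<in> Qc m" if "x \<in> Qc m" for x using that by (rule Qc_inv)
    show "?S \<in> carrier_mat ?N ?N" by simp
    show "?S * ?S = 1\<^sub>m ?N" by (rule sigma_mat_square[OF s])
    show "\<psi> (mat_trace (x * y)) = \<psi> (mat_trace (y * x))" if "x \<in> carrier_mat ?N ?N" "y \<in> carrier_mat ?N ?N" for x y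
      using mat_trace_mult_comm[OF that] by simp
  qed (use Rc in auto)
  define X where "X = (\<Sum>x\<in>Qc m. \<psi> (mat_trace (R * x * ?S)))"
  define c where "c = (\<Sum>i\<in>SO_minus_2 \<kappa>. \<psi> (\<tau> i))"
  define K where "K = kloosterman_GL t \<psi> 1"
  define Ns where "Ns = (of_nat (card (sym_GL s :: 'a mat set)) :: complex)"
  define gs gt gm where "gs = (of_nat (card (GL s :: 'a mat set)) :: complex)" and "gt = (of_nat (card (GL t :: 'a mat set)) :: complex)"
    and "gm = (of_nat (card (GL m :: 'a mat set)) :: complex)"
  define Q where "Q = (of_nat q :: complex)"
  define Ts Tm where "Ts = (\<Sum>j<s. j)" and "Tm = (\<Sum>j<m. j)"
  have X: "X = c * Q ^ Tm * (- Q) ^ s * Q ^ (2 * t) * Ns * Q ^ (t * s) * K"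
    unfolding X_def c_def Q_def Tm_def Ns_def K_def using R
  proof
    assume "R = 1\<^sub>m (2 * m + 2) \<and> \<tau> = mat_trace"
    then show "(\<Sum>x\<in>Qc m. \<psi> (mat_trace (R * x * ?S))) = (\<Sum>i\<in>SO_minus_2 \<kappa>. \<psi> (\<tau> i)) * of_nat q ^ (\<Sum>j<m. j) * (- of_nat q) ^ s *
      of_nat q ^ (2 * t) * of_nat (card (sym_GL s :: 'a mat set)) * of_nat q ^ (t * s) * kloosterman_GL t \<psi> 1"
      by (intro sum_psi_trace_Qc[OF m]) (simp only: trace_qmat_sigma(1)[OF m])
  next
    assume "R = rho_mat (Suc m) \<and> \<tau> = (\<lambda>i. mat_trace (rho2 * i))"
    then show "(\<Sum>x\<in>Qc m. \<psi> (mat_trace (R * x * ?S))) = (\<Sum>i\<in>SO_minus_2 \<kappa>. \<psi> (\<tau> i)) * of_nat q ^ (\<Sum>j<m. j) * (- of_nat q) ^ s *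
      of_nat q ^ (2 * t) * of_nat (card (sym_GL s :: 'a mat set)) * of_nat q ^ (t * s) * kloosterman_GL t \<psi> 1"
      by (intro sum_psi_trace_Qc[OF m]) (simp only: trace_qmat_sigma(2)[OF m])
  qed
  define B where "B = (of_nat (card {x \<in> Qc m. ?S * x * ?S \<in> Qc m}) :: complex)"
  have B: "B * Q ^ Ts = gs * Q ^ (t * s) * gt * (Q + 1) * Q ^ (2 * t) * Q ^ Tm"
    using arg_cong[OF card_stabilizer[OF m], of "of_nat :: nat \<Rightarrow> complex"]
    unfolding B_def Q_def gs_def gt_def Ts_def Tm_def of_nat_mult of_nat_power of_nat_add of_nat_1 .
  have Qm: "of_nat (card (Qc m)) = gm * (Q + 1) * Q ^ (2 * m) * Q ^ Tm"
    unfolding card_Qc Q_def gm_def Tm_def of_nat_mult of_nat_power of_nat_add of_nat_1 ..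
  have dc': "B * W = gm * (Q + 1) * Q ^ (2 * m) * Q ^ Tm * X" using dc unfolding B_def X_def Qm .
  define Z where "Z = (Q + 1) * Q ^ Tm * Q ^ (t * s) * Q ^ (2 * t)"
  have "Q + 1 \<noteq> 0"
  proof -
    have "of_nat (q + 1) \<noteq> (0 :: complex)" by (simp only: of_nat_eq_0_iff)
    then show ?thesis by (simp add: Q_def add.commute)
  qed
  then have Z: "Z \<noteq> 0" unfolding Z_def Q_def using q_ge_2 by simp
  have "Z * (W * gs * gt) = (B * Q ^ Ts) * W" unfolding B Z_def by (simp only: mult_ac)
  also have "\<dots> = (B * W) * Q ^ Ts" by (simp only: mult_ac)
  also have "\<dots> = Z * (gm * (Q ^ (2 * m) * Q ^ Ts * Q ^ Tm * Q ^ s) * (- 1) ^ s * Ns * K * c)"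
    unfolding dc' X Z_def power_minus[of Q s] by (simp only: mult_ac)
  finally have "W * gs * gt = gm * (Q ^ (2 * m) * Q ^ Ts * Q ^ Tm * Q ^ s) * (- 1) ^ s * Ns * K * c" using Z by simp
  then show ?thesis
    unfolding gs_def gt_def gm_def Ns_def K_def c_def Q_def Ts_def Tm_def power_add .
qed

end

section \<open>Evaluation of the double coset sums\<close>

lemma GL_nonempty: "GL n \<noteq> {}"
  using one_GL[of n] by blast

text \<open>The triangular number k (2k - 1), stated without subtraction.\<close>

lemma sum_lessThan_even: "(\<Sum>j<2 * k. j) + k = 2 * (k * k)" for k :: nat
  by (induction k) (auto simp: add_2_eq_Suc)

lemma sum_lessThan_odd: "(\<Sum>j<2 * k + 1. j) = 2 * (k * k) + k" for k :: nat
  using sum_lessThan_even[of k] by simp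

context char2_character
begin

section \<open>The double coset sums for t = 0, 1, 2\<close>

abbreviation Tri :: "nat \<Rightarrow> nat" where "Tri s \<equiv> \<Sum>j<s. j"

text \<open>\<open>twist R m \<tau>\<close> pairs the left factor \<open>R\<close> of a double coset with the trace \<open>\<tau>\<close> of its lower right block.\<close>

definition twist :: "'a mat \<Rightarrow> nat \<Rightarrow> ('a mat \<Rightarrow> 'a) \<Rightarrow> bool" where
  "twist R m \<tau> \<longleftrightarrow> R = 1\<^sub>m (2 * m + 2) \<and> \<tau> = mat_trace \<or> R = rho_mat (Suc m) \<and> \<tau> = (\<lambda>i. mat_trace (rho2 * i))"

definition dc_sum :: "'a mat \<Rightarrow> nat \<Rightarrow> nat \<Rightarrow> complex" where
  "dc_sum R m s = (\<Sum>w\<in>{R * x * sigma_mat (Suc m) s * y | x y. x \<in> Q_minus \<kappa> (Suc m) \<and> y \<in> Q_minus \<kappa> (Suc m)}. \<psi> (mat_trace w))"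

definition so_sum :: "('a mat \<Rightarrow> 'a) \<Rightarrow> complex" where
  "so_sum \<tau> = (\<Sum>i\<in>SO_minus_2 \<kappa>. \<psi> (\<tau> i))"

lemma dc_sum_identity:
  assumes "twist R (s + t) \<tau>"
  shows "dc_sum R (s + t) s * of_nat (card (GL s :: 'a mat set)) * of_nat (card (GL t :: 'a mat set)) =
    of_nat (card (GL (s + t) :: 'a mat set)) * of_nat q ^ (2 * (s + t) + Tri s + Tri (s + t) + s) * (- 1) ^ s *
    of_real (real (card (sym_GL s :: 'a mat set))) * kloosterman_GL t \<psi> 1 * so_sum \<tau>"
  unfolding dc_sum_def so_sum_def of_real_of_nat_eq
  by (rule double_coset_identity[OF refl]) (use assms in \<open>simp add: twist_def\<close>)

lemma of_nat_card_GL_Suc: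
  "of_nat (card (GL (Suc k) :: 'a mat set)) = (of_nat q ^ Suc k - 1) * of_nat q ^ k * (of_nat (card (GL k :: 'a mat set)) :: complex)"
proof -
  have "q ^ Suc k \<ge> 1" using q_ge_2 by (intro one_le_power) simp
  then show ?thesis unfolding card_GL_Suc card_field by (simp add: of_nat_diff del: power_Suc)
qed

lemma q_power_neq_1: "k > 0 \<Longrightarrow> (of_nat q :: complex) ^ k - 1 \<noteq> 0"
proof -
  assume "k > 0"
  then have "q ^ k > 1" using q_ge_2 by (intro one_less_power) auto
  then have "of_nat (q ^ k) \<noteq> (of_nat 1 :: complex)" by (simp only: of_nat_eq_iff)
  then show ?thesis by simp
qed

text \<open>The suffix is t = m - s. For t = 0 the orders of the general linear groups
  cancel.\<close>

lemma dc_sum_0: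
  assumes "twist R m \<tau>"
  shows "dc_sum R m m = of_real (real q ^ (3 * m + 2 * Tri m) * real (card (sym_GL m :: 'a mat set))) * (- 1) ^ m * so_sum \<tau>"
proof -
  let ?g = "of_nat (card (GL m :: 'a mat set)) :: complex"
  have g: "?g \<noteq> 0" using GL_nonempty[of m, where 'a = 'a] by simp
  have "?g * dc_sum R m m = ?g * (of_nat q ^ (2 * m + Tri m + Tri m + m) * (- 1) ^ m * of_real (real (card (sym_GL m :: 'a mat set))) * so_sum \<tau>)"
    using dc_sum_identity[of R m 0 \<tau>] assms by (simp add: card_GL_0 kloosterman_GL_0 mult_ac)
  moreover have "2 * m + Tri m + Tri m + m = 3 * m + 2 * Tri m" by simp
  ultimately show ?thesis using g by (simp add: mult_ac)
qed

text \<open>The order of GL(s + 1) divided by those of GL(s) and GL(1) is q^s times a Gaussian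
  binomial coefficient, which raises 3s + 2 in the exponent to 4s + 2.\<close>

lemma dc_sum_1:
  assumes "twist R (Suc s) \<tau>"
  shows "dc_sum R (Suc s) s = of_real (q_binomial q (Suc s) 1 * real q ^ (4 * s + 2 + Tri s + Tri (Suc s)) * real (card (sym_GL s :: 'a mat set))) * (- 1) ^ s *
    kloosterman \<psi> 1 * so_sum \<tau>"
proof -
  let ?g = "of_nat (card (GL s :: 'a mat set)) :: complex" and ?q = "of_nat q :: complex"
  let ?E = "?q ^ (4 * s + 2 + Tri s + Tri (Suc s))"
  let ?X = "(- 1) ^ s * of_real (real (card (sym_GL s :: 'a mat set))) * kloosterman \<psi> 1 * so_sum \<tau>"
  have solve: "w = a / d * e * x" if "w * g * d = a * g * e * x" "g \<noteq> 0" "d \<noteq> 0" for w g d a e x :: complex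
    using that by (simp add: field_simps)
  have g: "?g * (?q - 1) \<noteq> 0" using GL_nonempty[of s, where 'a = 'a] q_power_neq_1[of 1] by simp
  have "dc_sum R (Suc s) s * ?g * (?q - 1) = (?q ^ Suc s - 1) * ?q ^ s * ?g * ?q ^ (2 * Suc s + Tri s + Tri (Suc s) + s) * ?X"
    using dc_sum_identity[of R s 1 \<tau>] assms
    unfolding kloosterman_GL_1 of_nat_card_GL_Suc[of 0, simplified One_nat_def[symmetric]] card_GL_0 Suc_eq_plus1[symmetric] of_nat_card_GL_Suc[of s]
    by (simp only: power_one_right power_0 of_nat_1 mult_1_right mult.assoc)
  also have "\<dots> = (?q ^ Suc s - 1) * ?g * (?q ^ s * ?q ^ (2 * Suc s + Tri s + Tri (Suc s) + s)) * ?X" by (simp only: mult_ac)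
  also have "?q ^ s * ?q ^ (2 * Suc s + Tri s + Tri (Suc s) + s) = ?E"
    unfolding power_add[symmetric] by (rule arg_cong[of _ _ "power ?q"]) simp
  finally have "dc_sum R (Suc s) s = (?q ^ Suc s - 1) / (?q - 1) * ?E * ?X" by (rule solve) (use g in auto)
  moreover have "of_real (q_binomial q (Suc s) 1) = (?q ^ Suc s - 1) / (?q - 1)" by (simp add: q_binomial_def)
  ultimately show ?thesis by (simp add: mult_ac)
qed

text \<open>The order of GL(s + 2) divided by those of GL(s) and GL(2) is q^(2s) times a Gaussian
  binomial coefficient, which raises 3s + 4 in the exponent to 5s + 4.\<close>

lemma dc_sum_2:
  assumes "twist R (Suc (Suc s)) \<tau>"
  shows "dc_sum R (Suc (Suc s)) s = of_real (q_binomial q (Suc (Suc s)) 2 * real q ^ (5 * s + 4 + Tri s + Tri (Suc (Suc s))) * real (card (sym_GL s :: 'a mat set))) * (- 1) ^ s *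
    kloosterman_GL 2 \<psi> 1 * so_sum \<tau>"
proof -
  let ?g = "of_nat (card (GL s :: 'a mat set)) :: complex" and ?q = "of_nat q :: complex"
  let ?E = "?q ^ (5 * s + 4 + Tri s + Tri (Suc (Suc s)))"
  let ?X = "(- 1) ^ s * of_real (real (card (sym_GL s :: 'a mat set))) * kloosterman_GL 2 \<psi> 1 * so_sum \<tau>"
  let ?a = "?q ^ Suc (Suc s) - 1" and ?b = "?q ^ Suc s - 1" and ?c = "?q ^ 2 - 1" and ?d = "?q - 1"
  have cd: "?c \<noteq> 0" "?d \<noteq> 0" using q_power_neq_1[of 2] q_power_neq_1[of 1] by auto
  have g: "?g \<noteq> 0" using GL_nonempty[of s, where 'a = 'a] by simp
  have q0: "?q \<noteq> 0" using q_ge_2 by simp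
  have G2: "(of_nat (card (GL 2 :: 'a mat set)) :: complex) = ?c * ?q * ?d"
    using of_nat_card_GL_Suc[of 1] of_nat_card_GL_Suc[of 0] by (simp add: card_GL_0 numeral_2_eq_2)
  have Gs: "(of_nat (card (GL (s + 2) :: 'a mat set)) :: complex) = ?a * ?q ^ Suc s * (?b * ?q ^ s * ?g)"
    unfolding add_2_eq_Suc' of_nat_card_GL_Suc[of "Suc s"] of_nat_card_GL_Suc[of s] ..
  have solve: "w = a / c * (b / d) * e * x" if "w * g * (c * y * d) = y * (g * a * b * e * x)" "g \<noteq> 0" "c \<noteq> 0" "d \<noteq> 0" "y \<noteq> 0"
    for w g c y d a b e x :: complex
  proof -
    have "(y * g) * (w * (c * d)) = (y * g) * (a * b * e * x)" using that(1) by (simp only: mult_ac)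
    then have "w * (c * d) = a * b * e * x" using that by (subst (asm) mult_left_cancel) auto
    then have "w = (a * b * e * x) / (c * d)" using that by (simp add: eq_divide_eq)
    then show ?thesis by simp
  qed
  have assms': "twist R (s + 2) \<tau>" using assms by (simp add: add_2_eq_Suc')
  have "dc_sum R (s + 2) s * ?g * (?c * ?q * ?d) = ?a * ?q ^ Suc s * (?b * ?q ^ s * ?g) * ?q ^ (2 * (s + 2) + Tri s + Tri (s + 2) + s) * ?X"
    using dc_sum_identity[OF assms'] unfolding Gs G2 by (simp only: mult.assoc)
  also have "\<dots> = ?q * (?g * ?a * ?b * (?q ^ s * ?q ^ s * ?q ^ (2 * (s + 2) + Tri s + Tri (s + 2) + s)) * ?X)" by (simp only: power_Suc mult_ac)
  also have "?q ^ s * ?q ^ s * ?q ^ (2 * (s + 2) + Tri s + Tri (s + 2) + s) = ?E"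
    unfolding power_add[symmetric] add_2_eq_Suc' by (rule arg_cong[of _ _ "power ?q"]) simp
  finally have "dc_sum R (s + 2) s = ?a / ?c * (?b / ?d) * ?E * ?X" by (rule solve) (use g cd q0 in auto)
  moreover have "of_real (q_binomial q (Suc (Suc s)) 2) = ?a / ?c * (?b / ?d)"
    by (simp add: q_binomial_def numeral_2_eq_2)
  ultimately show ?thesis unfolding add_2_eq_Suc' by (simp add: mult_ac)
qed

lemma twist_one: "twist (1\<^sub>m (2 * m + 2)) m mat_trace"
  and twist_rho: "twist (rho_mat (Suc m)) m (\<lambda>i. mat_trace (rho2 * i))"
  by (simp_all add: twist_def)

lemma so_sum_one: "so_sum mat_trace = - kloosterman \<psi> 1"
  unfolding so_sum_def by (rule sum_psi_trace_SO_minus_2)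

lemma so_sum_rho: "so_sum (\<lambda>i. mat_trace (rho2 * i)) = of_real (real q + 1)"
  unfolding so_sum_def using mat_trace_rho2_SO card_SO_minus_2 by simp

lemma dc_sum_one: "dc_sum (1\<^sub>m (2 * m + 2)) m s =
  (\<Sum>w\<in>{x * sigma_mat (Suc m) s * y | x y. x \<in> Q_minus \<kappa> (Suc m) \<and> y \<in> Q_minus \<kappa> (Suc m)}. \<psi> (mat_trace w))"
proof -
  have "1\<^sub>m (2 * m + 2) * x = x" if "x \<in> Q_minus \<kappa> (Suc m)" for x
    using Qc_carrier[of x m] that by (simp add: Qc_eq)
  then have "{1\<^sub>m (2 * m + 2) * x * sigma_mat (Suc m) s * y | x y. x \<in> Q_minus \<kappa> (Suc m) \<and> y \<in> Q_minus \<kappa> (Suc m)} =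
      {x * sigma_mat (Suc m) s * y | x y. x \<in> Q_minus \<kappa> (Suc m) \<and> y \<in> Q_minus \<kappa> (Suc m)}"
    by (intro Collect_cong) metis
  then show ?thesis unfolding dc_sum_def by simp
qed

lemma sum_DC1: "(\<Sum>w\<in>DC1 \<kappa> (Suc m). \<psi> (mat_trace w)) =
    - of_real (real q ^ (3 * m + 2 * Tri m) * real (card (sym_GL m :: 'a mat set))) * (- 1) ^ m * kloosterman \<psi> 1"
proof -
  have "(\<Sum>w\<in>DC1 \<kappa> (Suc m). \<psi> (mat_trace w)) = dc_sum (1\<^sub>m (2 * m + 2)) m m"
    unfolding dc_sum_one DC1_def by simp
  then show ?thesis using dc_sum_0[OF twist_one, of m] by (simp add: so_sum_one)
qed

lemma sum_DC2: "(\<Sum>w\<in>DC2 \<kappa> (Suc (Suc s)). \<psi> (mat_trace w)) =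
    - of_real (q_binomial q (Suc s) 1 * real q ^ (4 * s + 2 + Tri s + Tri (Suc s)) * real (card (sym_GL s :: 'a mat set))) * (- 1) ^ s * (kloosterman \<psi> 1)\<^sup>2"
proof -
  have "(\<Sum>w\<in>DC2 \<kappa> (Suc (Suc s)). \<psi> (mat_trace w)) = dc_sum (1\<^sub>m (2 * Suc s + 2)) (Suc s) s"
    unfolding dc_sum_one DC2_def by simp
  also have "\<dots> = of_real (q_binomial q (Suc s) 1 * real q ^ (4 * s + 2 + Tri s + Tri (Suc s)) * real (card (sym_GL s :: 'a mat set))) * (- 1) ^ s *
    kloosterman \<psi> 1 * (- kloosterman \<psi> 1)"
    unfolding dc_sum_1[OF twist_one] so_sum_one ..
  finally show ?thesis by (simp add: power2_eq_square mult_ac)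
qed

lemma sum_DC3: "(\<Sum>w\<in>DC3 \<kappa> (Suc (Suc s)). \<psi> (mat_trace w)) =
    of_real ((real q + 1) * (q_binomial q (Suc s) 1 * real q ^ (4 * s + 2 + Tri s + Tri (Suc s)) * real (card (sym_GL s :: 'a mat set)))) * (- 1) ^ s * kloosterman \<psi> 1"
proof -
  have "(\<Sum>w\<in>DC3 \<kappa> (Suc (Suc s)). \<psi> (mat_trace w)) = dc_sum (rho_mat (Suc (Suc s))) (Suc s) s"
    unfolding dc_sum_def DC3_def by simp
  also have "\<dots> = of_real (q_binomial q (Suc s) 1 * real q ^ (4 * s + 2 + Tri s + Tri (Suc s)) * real (card (sym_GL s :: 'a mat set))) * (- 1) ^ s *
    kloosterman \<psi> 1 * of_real (real q + 1)"
    unfolding dc_sum_1[OF twist_rho] so_sum_rho ..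
  finally show ?thesis unfolding of_real_mult[of "real q + 1"] by (simp only: mult_ac)
qed

lemma sum_DC4: "(\<Sum>w\<in>DC4 \<kappa> (Suc (Suc (Suc s))). \<psi> (mat_trace w)) =
    of_real ((real q + 1) * (q_binomial q (Suc (Suc s)) 2 * real q ^ (5 * s + 4 + Tri s + Tri (Suc (Suc s))) * real (card (sym_GL s :: 'a mat set)))) * (- 1) ^ s * kloosterman_GL 2 \<psi> 1"
proof -
  have "(\<Sum>w\<in>DC4 \<kappa> (Suc (Suc (Suc s))). \<psi> (mat_trace w)) = dc_sum (rho_mat (Suc (Suc (Suc s)))) (Suc (Suc s)) s"
    unfolding dc_sum_def DC4_def by (simp add: numeral_3_eq_3)
  also have "\<dots> = of_real (q_binomial q (Suc (Suc s)) 2 * real q ^ (5 * s + 4 + Tri s + Tri (Suc (Suc s))) * real (card (sym_GL s :: 'a mat set))) * (- 1) ^ s *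
    kloosterman_GL 2 \<psi> 1 * of_real (real q + 1)"
    unfolding dc_sum_2[OF twist_rho] so_sum_rho ..
  finally show ?thesis unfolding of_real_mult[of "real q + 1"] by (simp only: mult_ac)
qed

section \<open>Comparison with the constants\<close>

lemma Nsym_even: "real (card (sym_GL (2 * k) :: 'a mat set)) = real q ^ (k * (k + 1)) * odd_prod q k"
  and Nsym_odd: "real (card (sym_GL (2 * k + 1) :: 'a mat set)) = real q ^ (k * (k + 1)) * odd_prod q (k + 1)"
  using card_sym_GL[where 'a = 'a, of k] by simp_all

lemma nat_div_4_eqI: "a = 4 * b \<Longrightarrow> a div 4 = (b :: nat)"
  by simp

lemma inverse_q_kloosterman_GL_2:
  "inverse (of_nat q) * kloosterman_GL 2 \<psi> 1 = (kloosterman \<psi> 1)\<^sup>2 + (of_nat q)\<^sup>2 - of_nat q"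
proof -
  have "(of_nat q :: complex) \<noteq> 0" using q_ge_2 by simp
  then show ?thesis unfolding kloosterman_GL_2 by (simp add: field_simps power2_eq_square power3_eq_cube)
qed

text \<open>For n = 2k + 2 the corner has odd size 2k + 1, and the last factor of its
  \<open>odd_prod\<close> is the separate factor q^(n-1) - 1 of the constant.\<close>

lemma A1_plus_eq: "A1_plus (Suc (2 * k + 1)) q = real q ^ (3 * (2 * k + 1) + 2 * Tri (2 * k + 1)) * real (card (sym_GL (2 * k + 1) :: 'a mat set))"
proof -
  have e: "(5 * (Suc (2 * k + 1))\<^sup>2 - 2 * Suc (2 * k + 1) - 4) div 4 = (3 * (2 * k + 1) + 2 * Tri (2 * k + 1)) + k * (k + 1)"
    by (rule nat_div_4_eqI, unfold sum_lessThan_odd) (simp add: power2_eq_square algebra_simps)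
  have "Suc (2 * k + 1) - 1 = 2 * k + 1" "(Suc (2 * k + 1) - 2) div 2 = k" by auto
  then show ?thesis
    unfolding A1_plus_def Nsym_odd Suc_eq_plus1[symmetric, of k] odd_prod_Suc e power_add[of _ "3 * (2 * k + 1) + 2 * Tri (2 * k + 1)"]
    by (simp only: mult_ac)
qed

lemma A2_plus_eq: "A2_plus (Suc (Suc (2 * k))) q = q_binomial q (Suc (2 * k)) 1 *
    real q ^ (4 * (2 * k) + 2 + Tri (2 * k) + Tri (Suc (2 * k))) * real (card (sym_GL (2 * k) :: 'a mat set))"
proof -
  let ?e = "4 * (2 * k) + 2 + Tri (2 * k) + Tri (Suc (2 * k))"
  have e: "(5 * (Suc (Suc (2 * k)))\<^sup>2 - 2 * Suc (Suc (2 * k)) - 8) div 4 = ?e + k * (k + 1)"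
    by (rule nat_div_4_eqI) (use sum_lessThan_even[of k] in \<open>simp add: power2_eq_square algebra_simps\<close>)
  have "Suc (Suc (2 * k)) - 1 = Suc (2 * k)" "(Suc (Suc (2 * k)) - 2) div 2 = k" by auto
  then show ?thesis unfolding A2_plus_def Nsym_even e power_add[of _ ?e] by (simp only: mult_ac)
qed

text \<open>The exponent in \<open>A4_plus\<close> exceeds that of the double coset sum by one. The
  difference is the factor q between \<open>kloosterman_GL 2 \<psi> 1\<close> and K^2 + q^2 - q,
  where K is \<open>kloosterman \<psi> 1\<close>.\<close>

lemma A4_plus_eq: "inverse (real q) * A4_plus (Suc (Suc (Suc (2 * k + 1)))) q = (real q + 1) * (q_binomial q (Suc (Suc (2 * k + 1))) 2 *
    real q ^ (5 * (2 * k + 1) + 4 + Tri (2 * k + 1) + Tri (Suc (Suc (2 * k + 1)))) * real (card (sym_GL (2 * k + 1) :: 'a mat set)))"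
proof -
  \<comment> \<open>Common value of both exponents for n = 2k + 4, after one factor q has been
    removed from the constant.\<close>
  let ?e = "5 * (k * k) + 17 * k + 12"
  have e1: "(5 * (Suc (Suc (Suc (2 * k + 1))))\<^sup>2 - 6 * Suc (Suc (Suc (2 * k + 1))) - 4) div 4 = Suc ?e"
    by (rule nat_div_4_eqI) (simp add: power2_eq_square algebra_simps)
  have e2: "5 * (2 * k + 1) + 4 + Tri (2 * k + 1) + Tri (Suc (Suc (2 * k + 1))) + k * (k + 1) = ?e"
    using sum_lessThan_odd[of k] sum_lessThan_odd[of "k + 1"] by (simp add: algebra_simps)
  have e3: "Suc (Suc (Suc (2 * k + 1))) - 1 = Suc (Suc (2 * k + 1))" "(Suc (Suc (Suc (2 * k + 1))) - 2) div 2 = k + 1" by auto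
  have "real q \<noteq> 0" using q_ge_2 by simp
  then have alg: "inverse (real q) * (y * (real q * z) * b * p) = y * z * b * p" for y z b p by (simp add: field_simps)
  have "inverse (real q) * A4_plus (Suc (Suc (Suc (2 * k + 1)))) q = (real q + 1) * real q ^ ?e *
      q_binomial q (Suc (Suc (2 * k + 1))) 2 * odd_prod q (k + 1)"
    unfolding A4_plus_def e1 e3 power_Suc by (rule alg)
  also have "real q ^ ?e = real q ^ (5 * (2 * k + 1) + 4 + Tri (2 * k + 1) + Tri (Suc (Suc (2 * k + 1)))) * real q ^ (k * (k + 1))"
    unfolding power_add[symmetric] e2 ..
  finally show ?thesis unfolding Nsym_odd by (simp only: mult_ac)
qed

lemma A1_minus_eq: "A1_minus (Suc (2 * k)) q = real q ^ (3 * (2 * k) + 2 * Tri (2 * k)) * real (card (sym_GL (2 * k) :: 'a mat set))"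
proof -
  have e: "5 * ((Suc (2 * k))\<^sup>2 - 1) div 4 = (3 * (2 * k) + 2 * Tri (2 * k)) + k * (k + 1)"
    by (rule nat_div_4_eqI) (use sum_lessThan_even[of k] in \<open>simp add: power2_eq_square algebra_simps\<close>)
  have "(Suc (2 * k) - 1) div 2 = k" by simp
  then show ?thesis unfolding A1_minus_def Nsym_even e power_add[of _ "3 * (2 * k) + 2 * Tri (2 * k)"] by (simp only: mult_ac)
qed

lemma A2_minus_eq: "A2_minus (Suc (Suc (2 * k + 1))) q = q_binomial q (Suc (2 * k + 1)) 1 *
    real q ^ (4 * (2 * k + 1) + 2 + Tri (2 * k + 1) + Tri (Suc (2 * k + 1))) * real (card (sym_GL (2 * k + 1) :: 'a mat set))"
proof -
  let ?e = "4 * (2 * k + 1) + 2 + Tri (2 * k + 1) + Tri (Suc (2 * k + 1))"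
  have e: "(5 * (Suc (Suc (2 * k + 1)))\<^sup>2 - 4 * Suc (Suc (2 * k + 1)) - 5) div 4 = ?e + k * (k + 1)"
    by (rule nat_div_4_eqI) (use sum_lessThan_even[of k] in \<open>simp add: power2_eq_square algebra_simps\<close>)
  have "Suc (Suc (2 * k + 1)) - 1 = Suc (2 * k + 1)" "(Suc (Suc (2 * k + 1)) - 1) div 2 = k + 1" by auto
  then show ?thesis unfolding A2_minus_def Nsym_odd e power_add[of _ ?e] by (simp only: mult_ac)
qed

lemma A4_minus_eq: "inverse (real q) * A4_minus (Suc (Suc (Suc (2 * k)))) q = (real q + 1) * (q_binomial q (Suc (Suc (2 * k))) 2 *
    real q ^ (5 * (2 * k) + 4 + Tri (2 * k) + Tri (Suc (Suc (2 * k)))) * real (card (sym_GL (2 * k) :: 'a mat set)))"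
proof -
  \<comment> \<open>The corresponding exponent for n = 2k + 3.\<close>
  let ?e = "5 * (k * k) + 13 * k + 5"
  have e1: "(5 * (Suc (Suc (Suc (2 * k))))\<^sup>2 - 4 * Suc (Suc (Suc (2 * k))) - 9) div 4 = Suc ?e"
    by (rule nat_div_4_eqI) (simp add: power2_eq_square algebra_simps)
  have e2: "5 * (2 * k) + 4 + Tri (2 * k) + Tri (Suc (Suc (2 * k))) + k * (k + 1) = ?e"
    using sum_lessThan_even[of k] by (simp add: algebra_simps)
  have e3: "Suc (Suc (Suc (2 * k))) - 1 = Suc (Suc (2 * k))" "(Suc (Suc (Suc (2 * k))) - 3) div 2 = k" by auto
  have "real q \<noteq> 0" using q_ge_2 by simp
  then have alg: "inverse (real q) * (y * (real q * z) * b * p) = y * z * b * p" for y z b p by (simp add: field_simps)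
  have "inverse (real q) * A4_minus (Suc (Suc (Suc (2 * k)))) q = (real q + 1) * real q ^ ?e *
      q_binomial q (Suc (Suc (2 * k))) 2 * odd_prod q k"
    unfolding A4_minus_def e1 e3 power_Suc by (rule alg)
  also have "real q ^ ?e = real q ^ (5 * (2 * k) + 4 + Tri (2 * k) + Tri (Suc (Suc (2 * k)))) * real q ^ (k * (k + 1))"
    unfolding power_add[symmetric] e2 ..
  finally show ?thesis unfolding Nsym_even by (simp only: mult_ac)
qed

end

text \<open>Adding 1 permutes the field, so the sum of all elements equals itself plus
  \<open>of_nat CARD('a)\<close>.\<close>

lemma of_nat_CARD_eq_0: "of_nat CARD('a) = (0 :: 'a::{field,finite})"
proof -
  have "(\<Sum>x\<in>UNIV. x) = (\<Sum>x\<in>UNIV. x + 1 :: 'a)"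
    by (rule sum.reindex_bij_witness[where i = "\<lambda>x. x + 1" and j = "\<lambda>x. x - 1"]) auto
  also have "\<dots> = (\<Sum>x\<in>UNIV. x) + of_nat CARD('a)" by (simp add: sum.distrib)
  finally show ?thesis by simp
qed

theorem theorem6:
  fixes \<psi> :: "'a::{field,finite} \<Rightarrow> complex" and \<kappa> :: 'a and q r n :: nat
  assumes "q = 2 ^ r" and "CARD('a) = q"
    and "irreducible [:\<kappa>, 1, 1:]"
    and "nontrivial_additive_character \<psi>"
  shows
    "(even n \<and> n \<ge> 2 \<longrightarrow>
        (\<Sum>w\<in>DC1 \<kappa> n. \<psi> (mat_trace w)) = of_real (A1_plus n q) * kloosterman \<psi> 1 \<and>
        (\<Sum>w\<in>DC2 \<kappa> n. \<psi> (mat_trace w)) = - of_real (A2_plus n q) * (kloosterman \<psi> 1)\<^sup>2 \<and>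
        (\<Sum>w\<in>DC3 \<kappa> n. \<psi> (mat_trace w)) = of_real (A3_plus n q) * kloosterman \<psi> 1) \<and>
     (even n \<and> n \<ge> 4 \<longrightarrow>
        (\<Sum>w\<in>DC4 \<kappa> n. \<psi> (mat_trace w)) =
          - inverse (of_nat q) * of_real (A4_plus n q) * kloosterman_GL 2 \<psi> 1 \<and>
        - inverse (of_nat q) * of_real (A4_plus n q) * kloosterman_GL 2 \<psi> 1 =
          - of_real (A4_plus n q) * ((kloosterman \<psi> 1)\<^sup>2 + (of_nat q)\<^sup>2 - of_nat q)) \<and>
     (odd n \<and> n \<ge> 1 \<longrightarrow>
        (\<Sum>w\<in>DC1 \<kappa> n. \<psi> (mat_trace w)) = - of_real (A1_minus n q) * kloosterman \<psi> 1) \<and>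
     (odd n \<and> n \<ge> 3 \<longrightarrow>
        (\<Sum>w\<in>DC2 \<kappa> n. \<psi> (mat_trace w)) = of_real (A2_minus n q) * (kloosterman \<psi> 1)\<^sup>2 \<and>
        (\<Sum>w\<in>DC3 \<kappa> n. \<psi> (mat_trace w)) = - of_real (A3_minus n q) * kloosterman \<psi> 1 \<and>
        (\<Sum>w\<in>DC4 \<kappa> n. \<psi> (mat_trace w)) =
          inverse (of_nat q) * of_real (A4_minus n q) * kloosterman_GL 2 \<psi> 1 \<and>
        inverse (of_nat q) * of_real (A4_minus n q) * kloosterman_GL 2 \<psi> 1 =
          of_real (A4_minus n q) * ((kloosterman \<psi> 1)\<^sup>2 + (of_nat q)\<^sup>2 - of_nat q))"
proof -
  have "z\<^sup>2 + z + \<kappa> \<noteq> 0" for z :: 'a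
  proof
    assume "z\<^sup>2 + z + \<kappa> = 0"
    then have "poly [:\<kappa>, 1, 1:] z = 0" by (simp add: power2_eq_square algebra_simps)
    then obtain p where p: "[:\<kappa>, 1, 1:] = [:- z, 1:] * p" unfolding poly_eq_0_iff_dvd by (elim dvdE)
    have "p \<noteq> 0"
    proof
      assume "p = 0"
      with p have "[:\<kappa>, 1, 1:] = 0" by simp
      then show False by simp
    qed
    \<comment> \<open>The cofactor of the linear factor has degree 1 as well, so neither factor is a
      unit.\<close>
    then have "degree ([:- z, 1:] * p) = 1 + degree p" by (subst degree_mult_eq) auto
    then have "degree p = 1" unfolding p[symmetric] by simp
    then have "\<not> is_unit [:- z, 1:]" "\<not> is_unit p" by (auto simp: is_unit_iff_degree \<open>p \<noteq> 0\<close>)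
    with irreducibleD[OF assms(3) p] show False by blast
  qed
  moreover have "(1 :: 'a) + 1 = 0"
  proof -
    \<comment> \<open>The number q = 2^r vanishes in the field, hence so does 2.\<close>
    have "(2 :: 'a) ^ r = 0" using of_nat_CARD_eq_0[where 'a = 'a] assms(1,2) by simp
    then show ?thesis by simp
  qed
  ultimately interpret char2_character \<psi> \<kappa> q
    using assms by unfold_locales auto
  let ?K = "kloosterman \<psi> 1" and ?K2 = "kloosterman_GL 2 \<psi> 1"
  have iq: "of_real (inverse (real q) * x) = inverse (of_nat q) * (of_real x :: complex)" for x by simp
  have K2: "inverse (of_nat q) * x * ?K2 = x * (?K\<^sup>2 + (of_nat q)\<^sup>2 - of_nat q)" for x
    unfolding inverse_q_kloosterman_GL_2[symmetric] by (simp only: mult_ac)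
  have even2: "(\<Sum>w\<in>DC1 \<kappa> n. \<psi> (mat_trace w)) = of_real (A1_plus n q) * ?K \<and>
      (\<Sum>w\<in>DC2 \<kappa> n. \<psi> (mat_trace w)) = - of_real (A2_plus n q) * ?K\<^sup>2 \<and>
      (\<Sum>w\<in>DC3 \<kappa> n. \<psi> (mat_trace w)) = of_real (A3_plus n q) * ?K" if n: "even n" "n \<ge> 2"
  proof -
    obtain j where j: "n = 2 * j" using n by auto
    define k where "k = j - 1"
    \<comment> \<open>\<open>DC1\<close> needs n as \<open>Suc m\<close> with m = 2k + 1, while
      \<open>DC2\<close> and \<open>DC3\<close> need it as \<open>Suc (Suc s)\<close> with s =
      2k.\<close>
    have k: "n = Suc (2 * k + 1)" "n = Suc (Suc (2 * k))" using j n by (auto simp: k_def)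
    have "(\<Sum>w\<in>DC1 \<kappa> n. \<psi> (mat_trace w)) = of_real (A1_plus n q) * ?K"
      unfolding k(1) sum_DC1 A1_plus_eq by simp
    moreover have "(\<Sum>w\<in>DC2 \<kappa> n. \<psi> (mat_trace w)) = - of_real (A2_plus n q) * ?K\<^sup>2"
      unfolding k(2) sum_DC2 A2_plus_eq by simp
    moreover have "(\<Sum>w\<in>DC3 \<kappa> n. \<psi> (mat_trace w)) = of_real (A3_plus n q) * ?K"
      unfolding k(2) sum_DC3 A3_plus_def A2_plus_eq by simp
    ultimately show ?thesis by blast
  qed
  have even4: "(\<Sum>w\<in>DC4 \<kappa> n. \<psi> (mat_trace w)) = - inverse (of_nat q) * of_real (A4_plus n q) * ?K2" if n: "even n" "n \<ge> 4"
  proof -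
    obtain j where j: "n = 2 * j" using n by auto
    define k where "k = j - 2"
    have k: "n = Suc (Suc (Suc (2 * k + 1)))" using j n by (simp add: k_def)
    show ?thesis unfolding k sum_DC4 mult_minus_left iq[symmetric] A4_plus_eq by simp
  qed
  have odd1: "(\<Sum>w\<in>DC1 \<kappa> n. \<psi> (mat_trace w)) = - of_real (A1_minus n q) * ?K" if n: "odd n"
  proof -
    obtain k where k: "n = Suc (2 * k)" using n by (auto elim!: oddE)
    show ?thesis unfolding k sum_DC1 A1_minus_eq by simp
  qed
  have odd3: "(\<Sum>w\<in>DC2 \<kappa> n. \<psi> (mat_trace w)) = of_real (A2_minus n q) * ?K\<^sup>2 \<and>
      (\<Sum>w\<in>DC3 \<kappa> n. \<psi> (mat_trace w)) = - of_real (A3_minus n q) * ?K \<and>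
      (\<Sum>w\<in>DC4 \<kappa> n. \<psi> (mat_trace w)) = inverse (of_nat q) * of_real (A4_minus n q) * ?K2" if n: "odd n" "n \<ge> 3"
  proof -
    obtain j where j: "n = 2 * j + 1" using n by (auto elim!: oddE)
    define k where "k = j - 1"
    \<comment> \<open>For n = 2k + 3 the corner has the odd size 2k + 1 in \<open>DC2\<close> and
      \<open>DC3\<close> and the even size 2k in \<open>DC4\<close>.\<close>
    have k: "n = Suc (Suc (2 * k + 1))" "n = Suc (Suc (Suc (2 * k)))" using j n by (auto simp: k_def)
    have "(\<Sum>w\<in>DC2 \<kappa> n. \<psi> (mat_trace w)) = of_real (A2_minus n q) * ?K\<^sup>2"
      unfolding k(1) sum_DC2 A2_minus_eq by simp
    moreover have "(\<Sum>w\<in>DC3 \<kappa> n. \<psi> (mat_trace w)) = - of_real (A3_minus n q) * ?K"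
      unfolding k(1) sum_DC3 A3_minus_def A2_minus_eq by simp
    moreover have "(\<Sum>w\<in>DC4 \<kappa> n. \<psi> (mat_trace w)) = inverse (of_nat q) * of_real (A4_minus n q) * ?K2"
      unfolding k(2) sum_DC4 iq[symmetric] A4_minus_eq by simp
    ultimately show ?thesis by blast
  qed
  show ?thesis
  proof (intro conjI impI)
    show "- inverse (of_nat q) * of_real (A4_plus n q) * ?K2 =
        - of_real (A4_plus n q) * (?K\<^sup>2 + (of_nat q)\<^sup>2 - of_nat q)"
      unfolding mult_minus_left K2 ..
    show "inverse (of_nat q) * of_real (A4_minus n q) * ?K2 =
        of_real (A4_minus n q) * (?K\<^sup>2 + (of_nat q)\<^sup>2 - of_nat q)"
      by (rule K2)
  qed (use even2 even4 odd1 odd3 in blast)+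
qed

end
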